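(* Let $a_0>0$ and $a_1>0$. Assume that $V\in L^1_{\rm loc}(\mathbb{R}^d)$, $V\geqslant 0$ a.e., is such that $R_V^{a_1}$ is bounded on $L^{p_1}(\mathbb{R}^d)$ for some $p_1\in[1,\infty)$ and $R_V^{a_0}$ is bounded on $L^1(\mathbb{R}^d)$. Then $R_V^a$ is bounded on $L^p(\mathbb{R}^d)$ for every $p$ and $a$ such that $1/p=\theta+(1-\theta)/p_1$ and $a=\theta a_0+(1-\theta)a_1$ with some $\theta\in(0,1)$.
   Context: $L^p=L^p(\mathbb{R}^d)$ with respect to Lebesgue measure, with norm $\|\cdot\|_p$. For an a.e. non-negative $V\in L^1_{\rm loc}$, the Schrödinger operator $L=-\frac12\Delta+V$ is the positive self-adjoint operator on $L^2$ associated with the closed sesquilinear form $Q(u,v)=\int_{\mathbb{R}^d}\frac12\langle\nabla u,\nabla v\rangle+Vu\overline v$ with domain $\mathrm{Dom}(Q)=\{f\in L^2:\nabla f\in L^2,\ V^{1/2}f\in L^2\}$ ($\nabla$ is the distributional gradient). The semigroup $e^{-tL}$ given by the spectral theorem is positivity-preserving, pointwise dominated by the heat semigroup $e^{t\Delta/2}$, and hence extends to a contraction semigroup on every $L^p$, $1\leqslant p<\infty$. For $a>0$, $1\leqslant p<\infty$ and a non-negative $f\in L^p$ define, for a.e. $x$, $R_V^af(x)=V^a(x)\cdot\frac1{\Gamma(a)}\int_0^\infty e^{-tL}f(x)\,t^{a-1}\,dt\in[0,\infty]$. A finitely simple function is a simple function supported in a compact subset of $\mathbb{R}^d$. $R_V^a$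 is said to be bounded on $L^p$ ($1\leqslant p<\infty$) if there is $C>0$ such that $\|R_V^af\|_p\leqslant C\|f\|_p$ for all non-negative finitely simple functions $f$. *)

theory Defs
  imports "HOL-Analysis.Analysis"
begin

section \<open>Square integrable functions and the spectral theorem\<close>

text \<open>Elements of \<open>L\<^sup>2\<close> are represented by functions; equality of classes is written out as
  equality almost everywhere.\<close>

definition L2 :: "'a measure \<Rightarrow> ('a \<Rightarrow> complex) set" where
  "L2 M = {f \<in> borel_measurable M. integrable M (\<lambda>x. (cmod (f x))\<^sup>2)}"

definition inner_L2 :: "'a measure \<Rightarrow> ('a \<Rightarrow> complex) \<Rightarrow> ('a \<Rightarrow> complex) \<Rightarrow> complex" where
  "inner_L2 M f g = (\<integral>x. f x * cnj (g x) \<partial>M)"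

definition unitary_L2 ::
    "'a measure \<Rightarrow> 'b measure \<Rightarrow> (('a \<Rightarrow> complex) \<Rightarrow> ('b \<Rightarrow> complex)) \<Rightarrow> bool" where
  "unitary_L2 M N U \<longleftrightarrow>
     (\<forall>f\<in>L2 M. U f \<in> L2 N) \<and>
     (\<forall>f\<in>L2 M. \<forall>g\<in>L2 M. AE y in N. U (\<lambda>x. f x + g x) y = U f y + U g y) \<and>
     (\<forall>f\<in>L2 M. \<forall>c. AE y in N. U (\<lambda>x. c * f x) y = c * U f y) \<and>
     (\<forall>f\<in>L2 M. \<forall>g\<in>L2 M. inner_L2 N (U f) (U g) = inner_L2 M f g) \<and>
     (\<forall>h\<in>L2 N. \<exists>f\<in>L2 M. AE y in N. U f y = h y)"

text \<open>An unbounded operator on \<open>L2 M\<close> is given by its graph \<open>A\<close>. The spectral theorem (on a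
  separable Hilbert space) says that a self-adjoint \<open>A\<close> is unitarily equivalent to multiplication
  by \<open>\<lambda>\<close>, with its maximal domain, on a direct sum \<open>\<Oplus>\<^sub>n L\<^sup>2(\<real>, \<mu>\<^sub>n)\<close>.
  This sum is the \<open>L\<^sup>2\<close> space of one Borel measure \<open>\<mu>\<close> on pairs \<open>(n, \<lambda>)\<close>. Since \<open>A f g\<close>
  is characterised for all \<open>f\<close> and \<open>g\<close> in \<open>L2 M\<close>, the domains are matched as well.\<close>

definition spectral_representation ::
    "'a measure \<Rightarrow> (('a \<Rightarrow> complex) \<Rightarrow> ('a \<Rightarrow> complex) \<Rightarrow> bool) \<Rightarrow>
     (nat \<times> real) measure \<Rightarrow> (('a \<Rightarrow> complex) \<Rightarrow> (nat \<times> real \<Rightarrow> complex)) \<Rightarrow> bool" where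
  "spectral_representation M A \<mu> U \<longleftrightarrow>
     sets \<mu> = sets borel \<and> sigma_finite_measure \<mu> \<and> unitary_L2 M \<mu> U \<and>
     (\<forall>f\<in>L2 M. \<forall>g\<in>L2 M. A f g \<longleftrightarrow> (AE z in \<mu>. U g z = complex_of_real (snd z) * U f z))"

text \<open>\<open>spectral_calculus M A \<phi> f g\<close> means that \<open>f\<close> lies in the domain of \<open>\<phi>(A)\<close> and that
  \<open>\<phi>(A) f = g\<close>.\<close>

definition spectral_calculus ::
    "'a measure \<Rightarrow> (('a \<Rightarrow> complex) \<Rightarrow> ('a \<Rightarrow> complex) \<Rightarrow> bool) \<Rightarrow> (real \<Rightarrow> real) \<Rightarrow>
     ('a \<Rightarrow> complex) \<Rightarrow> ('a \<Rightarrow> complex) \<Rightarrow> bool" where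
  "spectral_calculus M A \<phi> f g \<longleftrightarrow> f \<in> L2 M \<and> g \<in> L2 M \<and>
     (\<exists>\<mu> U. spectral_representation M A \<mu> U \<and>
        (AE z in \<mu>. U g z = complex_of_real (\<phi> (snd z)) * U f z))"


section \<open>Weak gradients\<close>

definition locally_integrable ::
    "('a::euclidean_space \<Rightarrow> 'b::{banach, second_countable_topology}) \<Rightarrow> bool" where
  "locally_integrable f \<longleftrightarrow> (\<forall>K. compact K \<longrightarrow> set_integrable lebesgue K f)"

definition partial_deriv ::
    "'n::finite \<Rightarrow> (real^'n \<Rightarrow> complex) \<Rightarrow> (real^'n \<Rightarrow> complex)" where
  "partial_deriv i f = (\<lambda>x. frechet_derivative f (at x) (axis i 1))"

text \<open>\<open>C\<^sup>\<infinity>\<close>: every iterated partial derivative exists and is differentiable (hence continuous).\<close>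

definition smooth_fun :: "(real^'n::finite \<Rightarrow> complex) \<Rightarrow> bool" where
  "smooth_fun f \<longleftrightarrow> (\<forall>js :: 'n list. foldr partial_deriv js f differentiable_on UNIV)"

definition test_function :: "(real^'n::finite \<Rightarrow> complex) \<Rightarrow> bool" where
  "test_function f \<longleftrightarrow> smooth_fun f \<and> (\<exists>K. compact K \<and> (\<forall>x. x \<notin> K \<longrightarrow> f x = 0))"

definition has_weak_gradient ::
    "(real^'n::finite \<Rightarrow> complex) \<Rightarrow> (real^'n \<Rightarrow> complex^'n) \<Rightarrow> bool" where
  "has_weak_gradient u G \<longleftrightarrow> locally_integrable u \<and> locally_integrable G \<and>
     (\<forall>\<phi> i. test_function \<phi> \<longrightarrow>
        (\<integral>x. u x * partial_deriv i \<phi> x \<partial>lebesgue) = - (\<integral>x. G x $ i * \<phi> x \<partial>lebesgue))"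

text \<open>Determined up to a null set whenever it exists.\<close>

definition weak_gradient ::
    "(real^'n::finite \<Rightarrow> complex) \<Rightarrow> (real^'n \<Rightarrow> complex^'n)" where
  "weak_gradient u = (SOME G. has_weak_gradient u G)"


section \<open>The operator \<open>L = - \<Delta>/2 + V\<close> and its semigroup\<close>

definition form_dom :: "(real^'n::finite \<Rightarrow> real) \<Rightarrow> (real^'n \<Rightarrow> complex) set" where
  "form_dom V = {f \<in> L2 lebesgue.
     (\<exists>G. has_weak_gradient f G \<and> (\<forall>i. (\<lambda>x. G x $ i) \<in> L2 lebesgue)) \<and>
     (\<lambda>x. complex_of_real (sqrt (V x)) * f x) \<in> L2 lebesgue}"

definition schrodinger_form ::
    "(real^'n::finite \<Rightarrow> real) \<Rightarrow> (real^'n \<Rightarrow> complex) \<Rightarrow> (real^'n \<Rightarrow> complex) \<Rightarrow> complex" where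
  "schrodinger_form V u v =
     (\<integral>x. (1/2) * (\<Sum>i\<in>UNIV. weak_gradient u x $ i * cnj (weak_gradient v x $ i))
          + complex_of_real (V x) * u x * cnj (v x) \<partial>lebesgue)"

text \<open>The graph of the operator associated with the form: \<open>schrodinger_op V u w\<close> means \<open>L u = w\<close>.\<close>

definition schrodinger_op ::
    "(real^'n::finite \<Rightarrow> real) \<Rightarrow> (real^'n \<Rightarrow> complex) \<Rightarrow> (real^'n \<Rightarrow> complex) \<Rightarrow> bool" where
  "schrodinger_op V u w \<longleftrightarrow> u \<in> form_dom V \<and> w \<in> L2 lebesgue \<and>
     (\<forall>v\<in>form_dom V. schrodinger_form V u v = inner_L2 lebesgue w v)"

text \<open>\<open>schrodinger_semigroup V t f g\<close> means \<open>exp (- t L) f = g\<close>.\<close>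

definition schrodinger_semigroup ::
    "(real^'n::finite \<Rightarrow> real) \<Rightarrow> real \<Rightarrow> (real^'n \<Rightarrow> complex) \<Rightarrow> (real^'n \<Rightarrow> complex) \<Rightarrow> bool" where
  "schrodinger_semigroup V t f g \<longleftrightarrow>
     spectral_calculus lebesgue (schrodinger_op V) (\<lambda>s. exp (- t * s)) f g"


section \<open>The operators \<open>R\<^sub>V\<^sup>a\<close>\<close>

text \<open>\<open>riesz V a f h\<close> means \<open>R\<^sub>V\<^sup>a f = h\<close> almost everywhere. To integrate in \<open>t\<close> for fixed \<open>x\<close>
  one needs a representative \<open>u t x\<close> of \<open>exp (- t L) f (x)\<close> that is jointly measurable; by Fubini
  the value of the integral does not depend on its choice, for almost every \<open>x\<close>. As \<open>f\<close> is
  non-negative, so is \<open>u t\<close> almost everywhere, and \<open>ennreal\<close> truncates nothing.\<close>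

definition riesz ::
    "(real^'n::finite \<Rightarrow> real) \<Rightarrow> real \<Rightarrow> (real^'n \<Rightarrow> real) \<Rightarrow> (real^'n \<Rightarrow> ennreal) \<Rightarrow> bool" where
  "riesz V a f h \<longleftrightarrow>
     (\<exists>u :: real \<Rightarrow> real^'n \<Rightarrow> real.
        (\<lambda>(t, x). u t x) \<in> borel_measurable borel \<and>
        (\<forall>t>0. schrodinger_semigroup V t
                 (\<lambda>x. complex_of_real (f x)) (\<lambda>x. complex_of_real (u t x))) \<and>
        (AE x in lebesgue. h x = ennreal (V x powr a) *
           (ennreal (1 / Gamma a) * (\<integral>\<^sup>+t\<in>{0<..}. ennreal (u t x * t powr (a - 1)) \<partial>lborel))))"

definition finitely_simple :: "('a::euclidean_space \<Rightarrow> real) \<Rightarrow> bool" where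
  "finitely_simple f \<longleftrightarrow>
     simple_function lebesgue f \<and> (\<exists>K. compact K \<and> (\<forall>x. x \<notin> K \<longrightarrow> f x = 0))"

text \<open>Powers of extended non-negative reals, for an exponent \<open>p > 0\<close>.\<close>

definition ennreal_powr :: "ennreal \<Rightarrow> real \<Rightarrow> ennreal" where
  "ennreal_powr y p = (if y = top then top else ennreal (enn2real y powr p))"

definition Lp_norm :: "real \<Rightarrow> ('a::euclidean_space \<Rightarrow> ennreal) \<Rightarrow> ennreal" where
  "Lp_norm p h = ennreal_powr (\<integral>\<^sup>+x. ennreal_powr (h x) p \<partial>lebesgue) (1 / p)"

definition riesz_bounded :: "(real^'n::finite \<Rightarrow> real) \<Rightarrow> real \<Rightarrow> real \<Rightarrow> bool" where
  "riesz_bounded V a p \<longleftrightarrow>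
     (\<exists>C>0. \<forall>f. finitely_simple f \<and> (\<forall>x. 0 \<le> f x) \<longrightarrow>
        (\<exists>h. riesz V a f h \<and> Lp_norm p h \<le> ennreal C * Lp_norm p (\<lambda>x. ennreal (f x))))"

end

theory Submission
  imports Defs
begin

text \<open>
  The proof is an interpolation by positivity. Given \<open>f \<ge> 0\<close>, put \<open>f\<^sub>0 = f\<^sup>p\<close> and
  \<open>f\<^sub>1 = f\<close> to the power \<open>p / p\<^sub>1\<close>, so that \<open>f\<close> is the geometric mean of \<open>f\<^sub>0\<close> and
  \<open>f\<^sub>1\<close> with weights \<open>\<theta>\<close> and \<open>1 - \<theta>\<close>. As \<open>exp (- t L)\<close> is linear and preserves positivity,
  it satisfies Hoelder's inequality pointwise: Young's inequality bounds \<open>f\<close> by a family of linear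
  combinations of \<open>f\<^sub>0\<close> and \<open>f\<^sub>1\<close>, the semigroup respects these bounds, and the best of them is
  the geometric mean of \<open>exp (- t L) f\<^sub>0\<close> and \<open>exp (- t L) f\<^sub>1\<close> (\<open>semigroup_Hoelder\<close>). The
  weights \<open>V\<close> to the power \<open>a\<close> and \<open>t\<close> to the power \<open>a - 1\<close> are themselves geometric means of
  those for \<open>a\<^sub>0\<close> and \<open>a\<^sub>1\<close>, so Hoelder's inequality in \<open>t\<close> bounds the transform of \<open>f\<close> of
  order \<open>a\<close> by a multiple of the geometric mean of the transforms of \<open>f\<^sub>0\<close> and \<open>f\<^sub>1\<close> of orders
  \<open>a\<^sub>0\<close> and \<open>a\<^sub>1\<close> (\<open>riesz_repr_Hoelder\<close>). Hoelder's inequality in \<open>x\<close>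
  (\<open>Lp_norm_interpolation\<close>) and the two assumed bounds then finish the proof, because \<open>f\<^sub>0\<close> and
  \<open>f\<^sub>1\<close> to the power \<open>p\<^sub>1\<close> are both equal to \<open>f\<^sup>p\<close>.

  What has to be built is the positivity of \<open>exp (- t L)\<close> (\<open>semigroup_comparison\<close>), starting from
  the form and the spectral theorem. For the resolvent it is the first Beurling-Deny criterion
  (\<open>resolvent_positive\<close>): testing \<open>h + s L h \<ge> 0\<close> against the negative part \<open>v\<close> of \<open>h\<close> gives
  \<open>\<integral>v\<^sup>2 \<le> 0\<close>, since the form of \<open>h\<close> and \<open>v\<close> is at most \<open>0\<close>. This uses that \<open>v\<close> is again in
  the form domain, that is, the chain rule for the modulus (\<open>weak_partial_abs\<close>). In every spectral
  representation the functions \<open>(1 + t \<lambda> / n)\<close> to the power \<open>- n\<close> converge boundedly to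
  \<open>exp (- t \<lambda>)\<close>, so the semigroup is a strong limit of powers of resolvents
  (\<open>semigroup_exponential_limit\<close>). These powers are described by the graph of \<open>L\<close> alone, and so
  they can be compared for different functions even if the semigroup acts on each of them through
  a different spectral representation.
\<close>

section \<open>Test functions\<close>

text \<open>The functions \<open>s \<mapsto> exp (- 1 / s) / s\<^sup>m\<close>, extended by \<open>0\<close> to \<open>s \<le> 0\<close>. The powers of
  \<open>1 / s\<close> are there because differentiation produces them.\<close>
definition flat_exp :: "nat \<Rightarrow> real \<Rightarrow> real" where
  "flat_exp m s = (if s \<le> 0 then 0 else inverse s ^ m * exp (- inverse s))"

lemma flat_exp_has_derivative:
  "(flat_exp m has_real_derivative flat_exp (m + 2) s - real m * flat_exp (m + 1) s) (at s)"
proof -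
  consider "s < 0" | "s = 0" | "s > 0" by linarith
  then show ?thesis
  proof cases
    case 1
    have "((\<lambda>x. 0) has_real_derivative 0) (at s)" by simp
    moreover have "eventually (\<lambda>x. x < 0) (nhds s)"
      using 1 eventually_nhds_in_open[of "{..<0}" s] by auto
    then have "eventually (\<lambda>x. (0::real) = flat_exp m x) (nhds s)"
      by eventually_elim (simp add: flat_exp_def)
    ultimately show ?thesis
      using 1 DERIV_cong_ev[of s s "\<lambda>x. 0" "flat_exp m" 0 0] by (simp add: flat_exp_def)
  next
    case 2
    \<comment> \<open>From the right, the difference quotient at \<open>0\<close> is \<open>y ^ (m + 1) / exp y\<close> for \<open>y = 1 / h\<close>.\<close>
    have "((\<lambda>y::real. y ^ (m + 1) / exp y) \<longlongrightarrow> 0) at_top"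
      by (rule tendsto_power_div_exp_0)
    then have "((\<lambda>h::real. inverse h ^ (m + 1) / exp (inverse h)) \<longlongrightarrow> 0) (at_right 0)"
      by (rule filterlim_compose[OF _ filterlim_inverse_at_top_right])
    then have "((\<lambda>h. (flat_exp m h - flat_exp m 0) / h) \<longlongrightarrow> 0) (at_right 0)"
    proof (rule Lim_transform_eventually)
      show "\<forall>\<^sub>F h in at_right 0. inverse h ^ (m + 1) / exp (inverse h) = (flat_exp m h - flat_exp m 0) / h"
        by (auto simp: eventually_at_filter flat_exp_def field_simps exp_minus intro!: always_eventually)
    qed
    moreover have "((\<lambda>h. (flat_exp m h - flat_exp m 0) / h) \<longlongrightarrow> 0) (at_left 0)"
    proof (rule Lim_transform_eventually)
      show "\<forall>\<^sub>F h in at_left 0. 0 = (flat_exp m h - flat_exp m 0) / h"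
        by (auto simp: eventually_at_filter flat_exp_def intro!: always_eventually)
    qed auto
    ultimately show ?thesis
      using 2 by (auto simp: has_field_derivative_iff filterlim_at_split flat_exp_def)
  next
    case 3
    have i: "(inverse has_real_derivative - (inverse s ^ 2)) (at s)"
      using DERIV_inverse[of s UNIV] 3 by (simp add: numeral_2_eq_2 power2_eq_square)
    have e: "((\<lambda>x. exp (- inverse x)) has_real_derivative exp (- inverse s) * inverse s ^ 2) (at s)"
      using DERIV_chain2[OF DERIV_exp DERIV_minus[OF i]] by simp
    have p: "((\<lambda>x. inverse x ^ m) has_real_derivative - (real m * inverse s ^ (m + 1))) (at s)"
      using DERIV_power[OF i, of m]
      by (cases m) (simp_all add: algebra_simps power_add numeral_2_eq_2)
    have d: "((\<lambda>x. inverse x ^ m * exp (- inverse x)) has_real_derivative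
        flat_exp (m + 2) s - real m * flat_exp (m + 1) s) (at s)"
      by (rule DERIV_cong[OF DERIV_mult[OF p e]])
         (use 3 in \<open>simp add: flat_exp_def power_add algebra_simps power2_eq_square\<close>)
    have "eventually (\<lambda>x. x > 0) (nhds s)"
      using 3 eventually_nhds_in_open[of "{0<..}" s] by auto
    then have "eventually (\<lambda>x. inverse x ^ m * exp (- inverse x) = flat_exp m x) (nhds s)"
      by eventually_elim (simp add: flat_exp_def)
    from iffD1[OF DERIV_cong_ev[OF refl this refl] d] show ?thesis .
  qed
qed

text \<open>An algebra of functions of one variable that is closed under differentiation and contains
  bump functions; hence its elements are smooth.\<close>
inductive flat_alg :: "(real \<Rightarrow> real) \<Rightarrow> bool" where
  const: "flat_alg (\<lambda>s. c)"
| add: "flat_alg f \<Longrightarrow> flat_alg g \<Longrightarrow> flat_alg (\<lambda>s. f s + g s)"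
| mult: "flat_alg f \<Longrightarrow> flat_alg g \<Longrightarrow> flat_alg (\<lambda>s. f s * g s)"
| gen: "flat_alg (\<lambda>s. flat_exp m (c * s + d))"

lemma flat_alg_derivative:
  "flat_alg f \<Longrightarrow> \<exists>f'. flat_alg f' \<and> (\<forall>s. (f has_real_derivative f' s) (at s))"
proof (induction rule: flat_alg.induct)
  case (const c)
  have "flat_alg (\<lambda>s. 0)" by (rule flat_alg.const)
  then show ?case by (intro exI[of _ "\<lambda>s. 0"]) auto
next
  case (add f g)
  then obtain f' g' where *: "flat_alg f'" "\<forall>s. (f has_real_derivative f' s) (at s)"
    "flat_alg g'" "\<forall>s. (g has_real_derivative g' s) (at s)" by blast
  have "\<forall>s. ((\<lambda>s. f s + g s) has_real_derivative f' s + g' s) (at s)"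
    using * by (auto intro: DERIV_add)
  then show ?case using flat_alg.add[OF *(1,3)] by blast
next
  case (mult f g)
  then obtain f' g' where *: "flat_alg f'" "\<forall>s. (f has_real_derivative f' s) (at s)"
    "flat_alg g'" "\<forall>s. (g has_real_derivative g' s) (at s)" by blast
  have "\<forall>s. ((\<lambda>s. f s * g s) has_real_derivative f' s * g s + g' s * f s) (at s)"
    using * by (auto intro: DERIV_mult)
  moreover have "flat_alg (\<lambda>s. f' s * g s + g' s * f s)"
    using * mult by (intro flat_alg.add flat_alg.mult)
  ultimately show ?case by (intro exI[of _ "\<lambda>s. f' s * g s + g' s * f s"]) auto
next
  case (gen m c d)
  let ?f = "\<lambda>s. c * (flat_exp (m + 2) (c * s + d) + (- real m) * flat_exp (m + 1) (c * s + d))"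
  have "flat_alg ?f"
    by (intro flat_alg.mult flat_alg.add flat_alg.const flat_alg.gen)
  moreover have "((\<lambda>s. flat_exp m (c * s + d)) has_real_derivative ?f s) (at s)" for s
    by (rule DERIV_cong[OF DERIV_chain2[OF flat_exp_has_derivative]])
       (auto intro!: derivative_eq_intros simp: algebra_simps)
  ultimately show ?case by (intro exI[of _ ?f] conjI allI)
qed

definition tensor_fun :: "('n::finite \<Rightarrow> real \<Rightarrow> real) \<Rightarrow> real^'n \<Rightarrow> complex" where
  "tensor_fun h x = complex_of_real (\<Prod>i\<in>UNIV. h i (x $ i))"

lemma tensor_fun_has_derivative:
  fixes h h' :: "'n::finite \<Rightarrow> real \<Rightarrow> real"
  assumes "\<And>i s. (h i has_real_derivative h' i s) (at s)"
  shows "(tensor_fun h has_derivative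
      (\<lambda>v. complex_of_real (\<Sum>i\<in>UNIV. v $ i * h' i (x $ i) * (\<Prod>j\<in>UNIV - {i}. h j (x $ j))))) (at x)"
proof -
  have "((\<lambda>x. h i (x $ i)) has_derivative (\<lambda>v. v $ i * h' i (x $ i))) (at x)" for i
  proof -
    have 1: "((\<lambda>x::real^'n. x $ i) has_derivative (\<lambda>v. v $ i)) (at x)"
      by (rule bounded_linear_imp_has_derivative) (rule bounded_linear_vec_nth)
    have 2: "(h i has_derivative (\<lambda>r. r * h' i (x $ i))) (at (x $ i))"
      using assms[of i "x $ i"] by (simp add: has_field_derivative_def mult.commute[of "h' i (x $ i)"] mult_commute_abs)
    show ?thesis
      using has_derivative_compose[OF 1 2] by simp
  qed
  then have "((\<lambda>x. \<Prod>i\<in>UNIV. h i (x $ i)) has_derivative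
      (\<lambda>v. \<Sum>i\<in>UNIV. v $ i * h' i (x $ i) * (\<Prod>j\<in>UNIV - {i}. h j (x $ j)))) (at x)"
    by (intro has_derivative_prod)
  from has_derivative_of_real[OF this, where 'a = complex] show ?thesis
    by (simp add: tensor_fun_def[abs_def])
qed

text \<open>A partial derivative of a product of functions of separate variables differentiates one
  factor, so products of factors from \<open>flat_alg\<close> are mapped to such products.\<close>
lemma smooth_tensor_fun:
  fixes h :: "'n::finite \<Rightarrow> real \<Rightarrow> real"
  assumes "\<And>i. flat_alg (h i)"
  shows "smooth_fun (tensor_fun h)"
proof -
  have *: "\<exists>h. (\<forall>i. flat_alg (h i)) \<and> foldr partial_deriv js f = tensor_fun h"
    if "\<exists>h. (\<forall>i. flat_alg (h i)) \<and> f = tensor_fun h" for js and f :: "real^'n \<Rightarrow> complex"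
  proof (induction js)
    case (Cons j js)
    then obtain h :: "'n \<Rightarrow> real \<Rightarrow> real" where h: "\<And>i. flat_alg (h i)" and eq: "foldr partial_deriv js f = tensor_fun h"
      by blast
    obtain h' where h': "\<And>i. flat_alg (h' i)" "\<And>i s. (h i has_real_derivative h' i s) (at s)"
      using flat_alg_derivative[OF h] by metis
    have "partial_deriv j (tensor_fun h) x = tensor_fun (h(j := h' j)) x" for x
    proof -
      have "partial_deriv j (tensor_fun h) x =
        complex_of_real (\<Sum>i\<in>UNIV. axis j 1 $ i * h' i (x $ i) * (\<Prod>k\<in>UNIV - {i}. h k (x $ k)))"
        unfolding partial_deriv_def
        by (subst frechet_derivative_at[OF tensor_fun_has_derivative[OF h'(2)], symmetric]) simp
      also have "(\<Sum>i\<in>UNIV. axis j 1 $ i * h' i (x $ i) * (\<Prod>k\<in>UNIV - {i}. h k (x $ k)))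
          = (\<Sum>i\<in>UNIV. if i = j then h' i (x $ i) * (\<Prod>k\<in>UNIV - {i}. h k (x $ k)) else 0)"
        by (intro sum.cong refl) (auto simp: axis_def)
      also have "\<dots> = h' j (x $ j) * (\<Prod>k\<in>UNIV - {j}. h k (x $ k))" by simp
      also have "\<dots> = (\<Prod>k\<in>UNIV. (h(j := h' j)) k (x $ k))"
        by (subst prod.remove[of _ j]) auto
      also have "complex_of_real (\<Prod>k\<in>UNIV. (h(j := h' j)) k (x $ k)) = tensor_fun (h(j := h' j)) x"
        by (simp only: tensor_fun_def)
      finally show ?thesis .
    qed
    then have "partial_deriv j (tensor_fun h) = tensor_fun (h(j := h' j))" by blast
    then show ?case using h h'(1) eq
      by (intro exI[of _ "h(j := h' j)"]) (simp add: fun_upd_def)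
  qed (use that in auto)
  have "tensor_fun h differentiable at x" if h: "\<And>i. flat_alg (h i)" for x and h :: "'n \<Rightarrow> real \<Rightarrow> real"
  proof -
    obtain h' where h': "\<And>i s. (h i has_real_derivative h' i s) (at s)"
      using flat_alg_derivative[OF h] by metis
    show ?thesis using tensor_fun_has_derivative[of h h' x, OF h'] unfolding differentiable_def by blast
  qed
  then show ?thesis unfolding smooth_fun_def differentiable_on_def
    by (metis * assms UNIV_I)
qed

text \<open>Real test functions carry all the analysis below; a complex test function is split into
  its real and imaginary parts.\<close>
definition real_test :: "(real^'n::finite \<Rightarrow> real) \<Rightarrow> bool" where
  "real_test \<phi> \<longleftrightarrow> test_function (\<lambda>x. complex_of_real (\<phi> x))"

text \<open>The bumps \<open>exp (- 1 / (k (s - \<alpha>))) exp (- 1 / (k (\<beta> - s)))\<close> on \<open>(\<alpha>, \<beta>)\<close> are bounded by \<open>1\<close>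
  and tend to \<open>1\<close> as \<open>k\<close> grows; multiply them over the coordinates.\<close>
lemma real_test_approximates_box:
  fixes a b :: "real^'n::finite"
  obtains \<phi> where "\<And>k. real_test (\<phi> k)" "\<And>k x. \<bar>\<phi> k x\<bar> \<le> indicator (cbox a b) x"
    "\<And>x. (\<lambda>k. \<phi> k x) \<longlonglongrightarrow> indicator (box a b) x"
proof
  define g where "g k i s = flat_exp 0 (real (Suc k) * s + - real (Suc k) * a $ i) *
     flat_exp 0 (- real (Suc k) * s + real (Suc k) * b $ i)" for k and i :: 'n and s
  define \<phi> where "\<phi> k x = (\<Prod>i\<in>UNIV. g k i (x $ i))" for k and x :: "real^'n"
  have fe: "0 \<le> flat_exp 0 s" "flat_exp 0 s \<le> 1" "s \<le> 0 \<Longrightarrow> flat_exp 0 s = 0" for s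
    by (auto simp: flat_exp_def)
  have g01: "0 \<le> g k i s" "g k i s \<le> 1" for k i s
    using fe by (auto simp: g_def intro!: mult_nonneg_nonneg mult_le_one)
  have g0: "g k i s = 0" if "\<not> (a $ i < s \<and> s < b $ i)" for k i s
  proof -
    have "real (Suc k) * s + - real (Suc k) * a $ i = real (Suc k) * (s - a $ i)"
      "- real (Suc k) * s + real (Suc k) * b $ i = real (Suc k) * (b $ i - s)"
      by (simp_all add: algebra_simps)
    then show ?thesis using that unfolding g_def
      by (metis fe(3) diff_le_0_iff_le mult_zero_left mult_zero_right mult_nonneg_nonpos not_less of_nat_0_le_iff)
  qed
  have \<phi>0: "\<phi> k x = 0" if x: "x \<notin> box a b" for k x
  proof -
    obtain i where "\<not> (a $ i < x $ i \<and> x $ i < b $ i)"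
      using x unfolding mem_box_cart(1) by blast
    then have "g k i (x $ i) = 0" by (rule g0)
    then show ?thesis unfolding \<phi>_def by (intro prod_zero) auto
  qed
  show "real_test (\<phi> k)" for k
  proof -
    have "flat_alg (g k i)" for i
      unfolding g_def by (intro flat_alg.mult flat_alg.gen)
    then have "smooth_fun (tensor_fun (g k))" by (rule smooth_tensor_fun)
    moreover have "complex_of_real (\<phi> k x) = 0" if "x \<notin> cbox a b" for x
      using \<phi>0[of x k] that box_subset_cbox[of a b] by auto
    ultimately show ?thesis
      unfolding real_test_def test_function_def
      by (intro conjI exI[of _ "cbox a b"]) (auto simp: tensor_fun_def[abs_def] \<phi>_def)
  qed
  show "\<bar>\<phi> k x\<bar> \<le> indicator (cbox a b) x" for k x
  proof (cases "x \<in> box a b")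
    case True
    have "0 \<le> \<phi> k x" "\<phi> k x \<le> 1"
      unfolding \<phi>_def using g01 by (auto intro!: prod_nonneg prod_le_1)
    then show ?thesis using True box_subset_cbox[of a b] by (auto simp: indicator_def)
  qed (simp add: \<phi>0)
  show "(\<lambda>k. \<phi> k x) \<longlonglongrightarrow> indicator (box a b) x" for x
  proof (cases "x \<in> box a b")
    case True
    have fl: "(\<lambda>k. flat_exp 0 (real (Suc k) * r)) \<longlonglongrightarrow> 1" if "r > 0" for r
    proof -
      have "(\<lambda>k. exp (- (inverse (real (Suc k)) * inverse r))) \<longlonglongrightarrow> exp (- (0 * inverse r))"
        by (intro tendsto_intros LIMSEQ_inverse_real_of_nat)
      moreover have "flat_exp 0 (real (Suc k) * r) = exp (- (inverse (real (Suc k)) * inverse r))" for k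
        using that by (simp add: flat_exp_def not_le)
      ultimately show ?thesis by (simp only:) simp
    qed
    have gl: "(\<lambda>k. g k i (x $ i)) \<longlonglongrightarrow> 1" for i
    proof -
      have "a $ i < x $ i" "x $ i < b $ i" using True by (auto simp: mem_box_cart)
      then have "(\<lambda>k. flat_exp 0 (real (Suc k) * (x $ i - a $ i)) *
          flat_exp 0 (real (Suc k) * (b $ i - x $ i))) \<longlonglongrightarrow> 1 * 1"
        by (intro tendsto_mult fl) auto
      then show ?thesis by (simp add: g_def algebra_simps)
    qed
    then have "(\<lambda>k. \<phi> k x) \<longlonglongrightarrow> (\<Prod>i\<in>(UNIV::'n set). 1)"
      unfolding \<phi>_def by (intro tendsto_prod)
    then show ?thesis using True by simp
  qed (simp add: \<phi>0)
qed

lemma real_test_zero_outside: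
  assumes "real_test \<phi>"
  obtains K where "compact K" "\<And>x. x \<notin> K \<Longrightarrow> \<phi> x = 0"
  using assms unfolding real_test_def test_function_def by auto

definition real_partial :: "'n::finite \<Rightarrow> (real^'n \<Rightarrow> real) \<Rightarrow> real^'n \<Rightarrow> real" where
  "real_partial i \<phi> x = frechet_derivative \<phi> (at x) (axis i 1)"

lemma smooth_fun_differentiable: "smooth_fun f \<Longrightarrow> f differentiable (at x)"
  unfolding smooth_fun_def differentiable_on_def by (metis UNIV_I foldr_Nil id_apply)

lemma smooth_fun_partial_deriv: "smooth_fun f \<Longrightarrow> smooth_fun (partial_deriv i f)"
  unfolding smooth_fun_def
proof (intro allI)
  fix js assume "\<forall>js. foldr partial_deriv js f differentiable_on UNIV"
  then have "foldr partial_deriv (js @ [i]) f differentiable_on UNIV" by blast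
  then show "foldr partial_deriv js (partial_deriv i f) differentiable_on UNIV" by simp
qed

lemma smooth_fun_add:
  assumes f: "smooth_fun f" and g: "smooth_fun g"
  shows "smooth_fun (\<lambda>x. f x + g x)"
proof -
  have d: "foldr partial_deriv js f differentiable (at x)" "foldr partial_deriv js g differentiable (at x)" for js x
    using f g unfolding smooth_fun_def differentiable_on_def by auto
  have *: "foldr partial_deriv js (\<lambda>x. f x + g x) = (\<lambda>x. foldr partial_deriv js f x + foldr partial_deriv js g x)" for js
  proof (induction js)
    case (Cons j js)
    have "frechet_derivative (\<lambda>x. foldr partial_deriv js f x + foldr partial_deriv js g x) (at x) =
        (\<lambda>v. frechet_derivative (foldr partial_deriv js f) (at x) v + frechet_derivative (foldr partial_deriv js g) (at x) v)" for x
      using has_derivative_add[OF d(1)[of js x, unfolded frechet_derivative_works] d(2)[of js x, unfolded frechet_derivative_works]]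
      by (rule frechet_derivative_at[symmetric])
    then show ?case by (simp add: Cons.IH partial_deriv_def[of j] fun_eq_iff)
  qed auto
  show ?thesis
    unfolding smooth_fun_def * differentiable_on_def
    using d by (auto intro: differentiable_add)
qed

lemma partial_deriv_bounded_linear:
  assumes "bounded_linear T" "f differentiable (at x)"
  shows "partial_deriv i (\<lambda>x. T (f x)) x = T (partial_deriv i f x)"
proof -
  have "(f has_derivative frechet_derivative f (at x)) (at x)"
    using assms(2) frechet_derivative_works by blast
  from bounded_linear.has_derivative[OF assms(1) this]
  show ?thesis unfolding partial_deriv_def
    by (metis frechet_derivative_at)
qed

lemma smooth_fun_bounded_linear:
  assumes T: "bounded_linear T" and f: "smooth_fun f"
  shows "smooth_fun (\<lambda>x. T (f x))"
proof -
  have *: "foldr partial_deriv js (\<lambda>x. T (f x)) = (\<lambda>x. T (foldr partial_deriv js f x))" for js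
  proof (induction js)
    case (Cons j js)
    show ?case
      using f[unfolded smooth_fun_def, rule_format, of js] partial_deriv_bounded_linear[OF T]
      by (auto simp: Cons.IH differentiable_on_def fun_eq_iff)
  qed auto
  show ?thesis
    unfolding smooth_fun_def * differentiable_on_def
  proof (intro allI ballI)
    fix js x
    have "foldr partial_deriv js f differentiable (at x)"
      using f unfolding smooth_fun_def differentiable_on_def by blast
    then show "(\<lambda>x. T (foldr partial_deriv js f x)) differentiable (at x)"
      using bounded_linear.has_derivative[OF T] unfolding differentiable_def by blast
  qed
qed

lemma smooth_fun_translate:
  assumes f: "smooth_fun f"
  shows "smooth_fun (\<lambda>x. f (x + a))"
proof -
  have d: "((\<lambda>x. g (x + a)) has_derivative g') (at x)"
    if "(g has_derivative g') (at (x + a))" for g :: "real^'a \<Rightarrow> complex" and g' x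
  proof -
    have "((\<lambda>x. x + a) has_derivative (\<lambda>v. v)) (at x)" by (auto intro!: derivative_eq_intros)
    from has_derivative_compose[OF this that] show ?thesis by simp
  qed
  have *: "foldr partial_deriv js (\<lambda>x. f (x + a)) = (\<lambda>x. foldr partial_deriv js f (x + a))" for js
  proof (induction js)
    case (Cons j js)
    have "(foldr partial_deriv js f has_derivative frechet_derivative (foldr partial_deriv js f) (at x)) (at x)" for x
      using f frechet_derivative_works unfolding smooth_fun_def differentiable_on_def by blast
    from d[OF this] have "frechet_derivative (\<lambda>x. foldr partial_deriv js f (x + a)) (at x)
        = frechet_derivative (foldr partial_deriv js f) (at (x + a))" for x
      by (metis frechet_derivative_at)
    then show ?case by (simp add: Cons.IH partial_deriv_def[of j])
  qed auto
  show ?thesis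
    unfolding smooth_fun_def * differentiable_on_def
    using f d unfolding smooth_fun_def differentiable_on_def differentiable_def by blast
qed

lemma real_test_of_real_real_partial:
  assumes "real_test \<phi>"
  shows "partial_deriv i (\<lambda>x. complex_of_real (\<phi> x)) x = complex_of_real (real_partial i \<phi> x)"
    and "(\<phi> has_derivative frechet_derivative \<phi> (at x)) (at x)"
proof -
  have "(\<lambda>x. complex_of_real (\<phi> x)) differentiable (at x)"
    using assms smooth_fun_differentiable unfolding real_test_def test_function_def by blast
  then obtain f' where "((\<lambda>x. complex_of_real (\<phi> x)) has_derivative f') (at x)"
    by (auto simp: differentiable_def)
  from has_derivative_Re[OF this] have "\<phi> differentiable (at x)"
    by (auto simp: differentiable_def)
  then show d: "(\<phi> has_derivative frechet_derivative \<phi> (at x)) (at x)"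
    using frechet_derivative_works by blast
  from has_derivative_of_real[OF this, where 'a = complex]
  show "partial_deriv i (\<lambda>x. complex_of_real (\<phi> x)) x = complex_of_real (real_partial i \<phi> x)"
    unfolding partial_deriv_def real_partial_def by (metis frechet_derivative_at)
qed

lemma real_test_linear:
  assumes "real_test \<phi>" "real_test \<psi>"
  shows "real_test (\<lambda>x. c * \<phi> x + \<psi> x)"
proof -
  obtain K where K: "compact K" "\<And>x. x \<notin> K \<Longrightarrow> \<phi> x = 0"
    using real_test_zero_outside[OF assms(1)] by blast
  obtain K' where K': "compact K'" "\<And>x. x \<notin> K' \<Longrightarrow> \<psi> x = 0"
    using real_test_zero_outside[OF assms(2)] by blast
  have "smooth_fun (\<lambda>x. complex_of_real c * complex_of_real (\<phi> x) + complex_of_real (\<psi> x))"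
    using assms unfolding real_test_def test_function_def
    by (intro smooth_fun_add smooth_fun_bounded_linear[OF bounded_linear_mult_right]) auto
  moreover have "c * \<phi> x + \<psi> x = 0" if "x \<notin> K \<union> K'" for x
    using that K(2) K'(2) by simp
  ultimately show ?thesis
    unfolding real_test_def test_function_def
    using compact_Un[OF K(1) K'(1)] by (intro conjI exI[of _ "K \<union> K'"]) (simp_all flip: of_real_mult of_real_add)
qed

lemma real_test_translate:
  assumes "real_test \<phi>"
  shows "real_test (\<lambda>x. \<phi> (x + a))" "real_partial i (\<lambda>x. \<phi> (x + a)) x = real_partial i \<phi> (x + a)"
proof -
  obtain K where K: "compact K" "\<And>x. x \<notin> K \<Longrightarrow> \<phi> x = 0"
    using assms unfolding real_test_def test_function_def by auto
  have "compact ((\<lambda>x. x - a) ` K)" using K by (simp add: compact_translation_subtract)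
  moreover have "\<phi> (x + a) = 0" if "x \<notin> (\<lambda>x. x - a) ` K" for x
    using that K(2) by (metis add_diff_cancel image_eqI)
  ultimately show "real_test (\<lambda>x. \<phi> (x + a))"
    using assms smooth_fun_translate[of "\<lambda>x. complex_of_real (\<phi> x)" a]
    unfolding real_test_def test_function_def by (metis (no_types, lifting) of_real_0)
  have "((\<lambda>x. x + a) has_derivative (\<lambda>v. v)) (at x)" by (auto intro!: derivative_eq_intros)
  from has_derivative_compose[OF this real_test_of_real_real_partial(2)[OF assms]]
  have "((\<lambda>x. \<phi> (x + a)) has_derivative frechet_derivative \<phi> (at (x + a))) (at x)" by simp
  then show "real_partial i (\<lambda>x. \<phi> (x + a)) x = real_partial i \<phi> (x + a)"
    unfolding real_partial_def by (metis frechet_derivative_at)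
qed

lemma real_test_line_derivative:
  assumes "real_test \<phi>"
  shows "((\<lambda>s. \<phi> (x - s *\<^sub>R axis i 1)) has_real_derivative - real_partial i \<phi> (x - s *\<^sub>R axis i 1)) (at s)"
proof -
  let ?D = "frechet_derivative \<phi> (at (x - s *\<^sub>R axis i 1))"
  have 1: "((\<lambda>s. x - s *\<^sub>R axis i 1) has_derivative (\<lambda>r. - (r *\<^sub>R axis i 1))) (at s)"
    by (auto intro!: derivative_eq_intros)
  have 2: "(\<phi> has_derivative ?D) (at (x - s *\<^sub>R axis i 1))"
    by (rule real_test_of_real_real_partial(2)[OF assms])
  then have "linear ?D" by (simp add: has_derivative_linear)
  then have D: "?D (- (r *\<^sub>R axis i 1)) = - real_partial i \<phi> (x - s *\<^sub>R axis i 1) * r" for r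
    by (simp add: linear_neg linear_cmul real_partial_def)
  show ?thesis
    unfolding has_field_derivative_def
    by (rule has_derivative_eq_rhs[OF has_derivative_compose[OF 1 2]]) (simp add: fun_eq_iff D)
qed

lemma real_test_bounds:
  fixes \<phi> :: "real^'n::finite \<Rightarrow> real"
  assumes "real_test \<phi>"
  obtains R M where "R > 0" "M > 0" "\<And>x. norm x > R \<Longrightarrow> \<phi> x = 0" "\<And>x. norm x > R \<Longrightarrow> real_partial i \<phi> x = 0"
    "\<And>x. \<bar>\<phi> x\<bar> \<le> M" "\<And>x. \<bar>real_partial i \<phi> x\<bar> \<le> M"
    "continuous_on UNIV \<phi>" "continuous_on UNIV (real_partial i \<phi>)"
proof -
  obtain K where K: "compact K" "\<And>x. x \<notin> K \<Longrightarrow> \<phi> x = 0"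
    using assms unfolding real_test_def test_function_def by auto
  obtain R where R: "R > 0" "\<And>x. x \<in> K \<Longrightarrow> norm x \<le> R"
    using compact_imp_bounded[OF K(1)] by (auto simp: bounded_pos)
  have z: "\<phi> x = 0" if "norm x > R" for x using that R K by force
  have rz: "real_partial i \<phi> x = 0" if "norm x > R" for x
  proof -
    have "eventually (\<lambda>y. y \<in> {y. norm y > R}) (nhds x)"
      using that by (intro eventually_nhds_in_open open_Collect_less continuous_intros) auto
    then have ev: "eventually (\<lambda>y. \<phi> y = 0) (nhds x)" by eventually_elim (use z in auto)
    have "((\<lambda>y. 0::real) has_derivative (\<lambda>v. 0)) (at x)" by simp
    then have "(\<phi> has_derivative (\<lambda>v. 0)) (at x)"
      by (rule has_derivative_transform_eventually)
         (use ev z[OF that] in \<open>auto simp: eventually_at_filter elim: eventually_mono\<close>)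
    then show ?thesis unfolding real_partial_def using frechet_derivative_at by metis
  qed
  have c1: "continuous_on UNIV \<phi>"
    using real_test_of_real_real_partial(2)[OF assms]
    by (auto intro!: continuous_at_imp_continuous_on has_derivative_continuous)
  have "partial_deriv i (\<lambda>x. complex_of_real (\<phi> x)) differentiable (at x)" for x
    using assms smooth_fun_differentiable smooth_fun_partial_deriv
    unfolding real_test_def test_function_def by blast
  then have "continuous_on UNIV (partial_deriv i (\<lambda>x. complex_of_real (\<phi> x)))"
    by (auto intro!: continuous_at_imp_continuous_on simp: differentiable_imp_continuous_within)
  moreover have "partial_deriv i (\<lambda>x. complex_of_real (\<phi> x)) = (\<lambda>x. complex_of_real (real_partial i \<phi> x))"
    using real_test_of_real_real_partial(1)[OF assms] by auto
  ultimately have "continuous_on UNIV (\<lambda>x. Re (complex_of_real (real_partial i \<phi> x)))"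
    by (metis continuous_on_Re)
  then have c2: "continuous_on UNIV (real_partial i \<phi>)" by simp
  have bd: "\<exists>M>0. \<forall>x. \<bar>f x\<bar> \<le> M" if "continuous_on UNIV f" "\<And>x. norm x > R \<Longrightarrow> f x = 0" for f :: "real^'n \<Rightarrow> real"
  proof -
    have "bounded (f ` cball 0 R)"
      using continuous_on_subset[OF that(1)]
      by (intro compact_imp_bounded compact_continuous_image) simp_all
    then obtain M where M: "M > 0" "\<And>x. norm x \<le> R \<Longrightarrow> \<bar>f x\<bar> \<le> M"
      by (auto simp: bounded_pos)
    show ?thesis using M that(2) by (metis abs_zero less_imp_le not_le)
  qed
  obtain M1 where M1: "M1 > 0" "\<And>x. \<bar>\<phi> x\<bar> \<le> M1" using bd[OF c1 z] by auto
  obtain M2 where M2: "M2 > 0" "\<And>x. \<bar>real_partial i \<phi> x\<bar> \<le> M2" using bd[OF c2 rz] by auto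
  show ?thesis
  proof (rule that[of R "max M1 M2"])
    show "\<bar>\<phi> x\<bar> \<le> max M1 M2" "\<bar>real_partial i \<phi> x\<bar> \<le> max M1 M2" for x
      using M1(2)[of x] M2(2)[of x] by linarith+
  qed (use R(1) M1(1) z rz c1 c2 in simp_all)
qed

section \<open>Real square integrable functions\<close>

definition L2_real :: "'a measure \<Rightarrow> ('a \<Rightarrow> real) set" where
  "L2_real M = {f \<in> borel_measurable M. integrable M (\<lambda>x. (f x)\<^sup>2)}"

definition L2_norm :: "'a measure \<Rightarrow> ('a \<Rightarrow> real) \<Rightarrow> real" where
  "L2_norm M f = sqrt (\<integral>x. (f x)\<^sup>2 \<partial>M)"

lemma L2_real_measurable: "f \<in> L2_real M \<Longrightarrow> f \<in> borel_measurable M"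
  by (simp add: L2_real_def)

lemma L2_norm_power: "(L2_norm M f)\<^sup>2 = (\<integral>x. (f x)\<^sup>2 \<partial>M)"
  by (simp add: L2_norm_def)

lemma L2_norm_nonneg: "0 \<le> L2_norm M f"
  by (simp add: L2_norm_def)

lemma L2_real_mult_integrable:
  assumes "f \<in> L2_real M" "g \<in> L2_real M"
  shows "integrable M (\<lambda>x. f x * g x)"
proof (rule Bochner_Integration.integrable_bound)
  show "integrable M (\<lambda>x. (f x)\<^sup>2 + (g x)\<^sup>2)" using assms by (auto simp: L2_real_def)
  show "(\<lambda>x. f x * g x) \<in> borel_measurable M" using assms by (auto simp: L2_real_def)
  show "AE x in M. norm (f x * g x) \<le> norm ((f x)\<^sup>2 + (g x)\<^sup>2)"
  proof (intro always_eventually allI)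
    fix x
    have "2 * (\<bar>f x\<bar> * \<bar>g x\<bar>) \<le> (f x)\<^sup>2 + (g x)\<^sup>2"
      using sum_squares_bound[of "\<bar>f x\<bar>" "\<bar>g x\<bar>"] by (simp add: algebra_simps)
    then show "norm (f x * g x) \<le> norm ((f x)\<^sup>2 + (g x)\<^sup>2)"
      by (simp add: abs_mult) (smt (verit) abs_ge_zero mult_nonneg_nonneg)
  qed
qed

lemma L2_real_lincomb:
  assumes "f \<in> L2_real M" "g \<in> L2_real M"
  shows "(\<lambda>x. c * f x + d * g x) \<in> L2_real M"
proof -
  have "(c * f x + d * g x)\<^sup>2 = c\<^sup>2 * (f x)\<^sup>2 + 2 * c * d * (f x * g x) + d\<^sup>2 * (g x)\<^sup>2" for x
    by (simp add: power2_eq_square algebra_simps)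
  then show ?thesis
    using assms L2_real_mult_integrable[OF assms] by (auto simp: L2_real_def)
qed

lemma L2_real_diff: "f \<in> L2_real M \<Longrightarrow> g \<in> L2_real M \<Longrightarrow> (\<lambda>x. f x - g x) \<in> L2_real M"
  using L2_real_lincomb[of f M g 1 "-1"] by simp

lemma L2_real_bound:
  assumes "f \<in> L2_real M" "g \<in> borel_measurable M" "AE x in M. \<bar>g x\<bar> \<le> \<bar>f x\<bar>"
  shows "g \<in> L2_real M"
proof -
  have "integrable M (\<lambda>x. (g x)\<^sup>2)"
    by (rule Bochner_Integration.integrable_bound[of M "\<lambda>x. (f x)\<^sup>2"])
       (use assms in \<open>auto simp: L2_real_def abs_le_square_iff elim!: eventually_mono\<close>)
  then show ?thesis using assms by (simp add: L2_real_def)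
qed

text \<open>The quadratic polynomial \<open>s \<mapsto> \<integral>(s f + g)\<^sup>2\<close> is non-negative.\<close>
lemma Cauchy_Schwarz_L2_real:
  assumes f: "f \<in> L2_real M" and g: "g \<in> L2_real M"
  shows "\<bar>\<integral>x. f x * g x \<partial>M\<bar> \<le> L2_norm M f * L2_norm M g"
proof -
  define A B C where "A = (\<integral>x. (f x)\<^sup>2 \<partial>M)" and "B = (\<integral>x. f x * g x \<partial>M)" and "C = (\<integral>x. (g x)\<^sup>2 \<partial>M)"
  have A: "A \<ge> 0" and C: "C \<ge> 0" by (auto simp: A_def C_def)
  have q: "0 \<le> s\<^sup>2 * A + 2 * s * B + C" for s
  proof -
    have "0 \<le> (\<integral>x. (s * f x + g x)\<^sup>2 \<partial>M)" by simp
    also have "(\<lambda>x. (s * f x + g x)\<^sup>2) = (\<lambda>x. s\<^sup>2 * (f x)\<^sup>2 + 2 * s * (f x * g x) + (g x)\<^sup>2)"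
      by (simp add: power2_eq_square algebra_simps)
    also have "(\<integral>x. s\<^sup>2 * (f x)\<^sup>2 + 2 * s * (f x * g x) + (g x)\<^sup>2 \<partial>M) = s\<^sup>2 * A + 2 * s * B + C"
      using f g L2_real_mult_integrable[OF f g] by (simp add: L2_real_def A_def B_def C_def)
    finally show ?thesis .
  qed
  have "B\<^sup>2 \<le> A * C"
  proof (cases "A = 0")
    case True
    have "B = 0"
    proof (rule ccontr)
      assume "B \<noteq> 0"
      \<comment> \<open>With \<open>A = 0\<close> the polynomial is linear and takes the value \<open>- 1\<close> at this point.\<close>
      then show False using q[of "- (C + 1) / (2 * B)"] True by (simp add: field_simps)
    qed
    then show ?thesis using True by simp
  next
    case False
    have "0 \<le> A * ((- B / A)\<^sup>2 * A + 2 * (- B / A) * B + C)"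
      using q[of "- B / A"] A by (intro mult_nonneg_nonneg)
    also have "\<dots> = A * C - B\<^sup>2"
      using False by (simp add: field_simps power2_eq_square)
    finally show ?thesis by simp
  qed
  then have "\<bar>B\<bar> \<le> sqrt (A * C)" by (simp add: real_le_rsqrt)
  then show ?thesis by (simp add: L2_norm_def A_def B_def C_def real_sqrt_mult)
qed

lemma L2_norm_triangle:
  assumes f: "f \<in> L2_real M" and g: "g \<in> L2_real M"
  shows "L2_norm M (\<lambda>x. f x + g x) \<le> L2_norm M f + L2_norm M g"
proof (rule power2_le_imp_le)
  have "(L2_norm M (\<lambda>x. f x + g x))\<^sup>2 = (\<integral>x. (f x)\<^sup>2 + 2 * (f x * g x) + (g x)\<^sup>2 \<partial>M)"
    unfolding L2_norm_power by (intro Bochner_Integration.integral_cong) (auto simp: power2_eq_square algebra_simps)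
  also have "\<dots> = (L2_norm M f)\<^sup>2 + 2 * (\<integral>x. f x * g x \<partial>M) + (L2_norm M g)\<^sup>2"
    using f g L2_real_mult_integrable[OF f g] by (simp add: L2_real_def L2_norm_power)
  also have "\<dots> \<le> (L2_norm M f)\<^sup>2 + 2 * (L2_norm M f * L2_norm M g) + (L2_norm M g)\<^sup>2"
    using Cauchy_Schwarz_L2_real[OF f g] by simp
  finally show "(L2_norm M (\<lambda>x. f x + g x))\<^sup>2 \<le> (L2_norm M f + L2_norm M g)\<^sup>2"
    by (simp add: power2_eq_square algebra_simps)
qed (simp add: L2_norm_nonneg)

section \<open>Local integrability\<close>

lemma borel_lebesgue_measurable: "f \<in> borel_measurable borel \<Longrightarrow> f \<in> borel_measurable lebesgue"
  by (rule measurable_completion) simp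

lemma locally_integrable_cball:
  "locally_integrable f \<Longrightarrow> integrable lebesgue (\<lambda>x. indicator (cball 0 R) x *\<^sub>R f x)"
  unfolding locally_integrable_def set_integrable_def by auto

lemma locally_integrable_measurable:
  fixes f :: "'a::euclidean_space \<Rightarrow> 'b::{banach, second_countable_topology}"
  assumes "locally_integrable f"
  shows "f \<in> borel_measurable lebesgue"
proof (rule borel_measurable_LIMSEQ_metric)
  show "(\<lambda>x. indicator (cball 0 (real n)) x *\<^sub>R f x) \<in> borel_measurable lebesgue" for n
    using locally_integrable_cball[OF assms] by (rule borel_measurable_integrable)
  show "(\<lambda>n. indicator (cball 0 (real n)) x *\<^sub>R f x) \<longlonglongrightarrow> f x" for x
  proof (rule tendsto_eventually)
    obtain N where "norm x \<le> real N" using real_arch_simple by blast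
    then show "\<forall>\<^sub>F n in sequentially. indicator (cball 0 (real n)) x *\<^sub>R f x = f x"
      by (intro eventually_sequentiallyI[of N]) (auto simp: indicator_def)
  qed
qed

lemma bounded_subset_cball0:
  fixes S :: "'a::real_normed_vector set"
  assumes "bounded S"
  obtains R where "S \<subseteq> cball 0 R"
  using assms by (auto simp: bounded_iff subset_iff)

lemma locally_integrableI_cball:
  fixes f :: "'a::euclidean_space \<Rightarrow> 'b::{banach, second_countable_topology}"
  assumes "\<And>R. integrable lebesgue (\<lambda>x. indicator (cball 0 R) x *\<^sub>R f x)"
  shows "locally_integrable f"
  unfolding locally_integrable_def
proof (intro allI impI)
  fix K :: "'a set" assume "compact K"
  then obtain R where R: "K \<subseteq> cball 0 R"
    using bounded_subset_cball0[OF compact_imp_bounded] by metis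
  have "K \<in> sets lebesgue" using borel_compact[OF \<open>compact K\<close>] by simp
  moreover have "set_integrable lebesgue (cball 0 R) f"
    using assms[of R] by (simp add: set_integrable_def)
  ultimately show "set_integrable lebesgue K f"
    using R by (meson set_integrable_subset)
qed

text \<open>The bound by a multiple of the indicator of a ball, which recurs below, encodes a bounded
  function of bounded support.\<close>
lemma locally_integrable_times_bounded:
  fixes g :: "'a::euclidean_space \<Rightarrow> real"
  assumes g: "locally_integrable g" and m: "\<psi> \<in> borel_measurable lebesgue"
    and b: "\<And>x. \<bar>\<psi> x\<bar> \<le> C * indicator (cball 0 R) x"
  shows "integrable lebesgue (\<lambda>x. g x * \<psi> x)"
proof (rule Bochner_Integration.integrable_bound)
  show "integrable lebesgue (\<lambda>x. C *\<^sub>R (indicator (cball 0 R) x *\<^sub>R g x))"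
    using locally_integrable_cball[OF g] by (rule integrable_scaleR_right)
  show "(\<lambda>x. g x * \<psi> x) \<in> borel_measurable lebesgue"
    using m locally_integrable_measurable[OF g] by simp
  show "AE x in lebesgue. norm (g x * \<psi> x) \<le> norm (C *\<^sub>R (indicator (cball 0 R) x *\<^sub>R g x))"
  proof (intro always_eventually allI)
    fix x
    have "\<bar>g x\<bar> * \<bar>\<psi> x\<bar> \<le> \<bar>g x\<bar> * \<bar>C * indicator (cball 0 R) x\<bar>"
      using b[of x] by (intro mult_left_mono) auto
    then show "norm (g x * \<psi> x) \<le> norm (C *\<^sub>R (indicator (cball 0 R) x *\<^sub>R g x))"
      by (simp add: abs_mult mult_ac)
  qed
qed

lemma integrable_indicator_cball: "integrable lebesgue (indicator (cball (0::'a::euclidean_space) R) :: 'a \<Rightarrow> real)"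
  by (intro integrable_real_indicator) (auto simp: emeasure_bounded_finite[unfolded infinity_ennreal_def])

lemma locally_integrable_const: "locally_integrable (\<lambda>x::'a::euclidean_space. c::real)"
  by (rule locally_integrableI_cball) (simp add: integrable_indicator_cball)

lemma locally_integrable_bound:
  fixes f :: "'a::euclidean_space \<Rightarrow> 'b::{banach, second_countable_topology}"
    and g :: "'a::euclidean_space \<Rightarrow> 'c::{banach, second_countable_topology}"
  assumes f: "locally_integrable f" and m: "g \<in> borel_measurable lebesgue"
    and b: "AE x in lebesgue. norm (g x) \<le> norm (f x)"
  shows "locally_integrable g"
proof (rule locally_integrableI_cball)
  fix R
  have [measurable]: "(indicator (cball 0 R) :: 'a \<Rightarrow> real) \<in> borel_measurable lebesgue"
    by (rule borel_measurable_integrable[OF integrable_indicator_cball])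
  show "integrable lebesgue (\<lambda>x. indicator (cball 0 R) x *\<^sub>R g x)"
    by (rule Bochner_Integration.integrable_bound[OF locally_integrable_cball[OF f, of R]])
       (use b m in \<open>auto elim!: eventually_mono simp: mult_left_mono\<close>)
qed

lemma locally_integrable_add:
  fixes f g :: "'a::euclidean_space \<Rightarrow> 'b::{banach, second_countable_topology}"
  assumes "locally_integrable f" "locally_integrable g"
  shows "locally_integrable (\<lambda>x. f x + g x)"
  by (rule locally_integrableI_cball)
     (use assms[THEN locally_integrable_cball] in \<open>simp add: scaleR_add_right\<close>)

lemma locally_integrable_bounded_linear:
  fixes f :: "'a::euclidean_space \<Rightarrow> 'b::{banach, second_countable_topology}"
    and T :: "'b \<Rightarrow> 'c::{banach, second_countable_topology}"
  assumes T: "bounded_linear T" and f: "locally_integrable f"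
  shows "locally_integrable (\<lambda>x. T (f x))"
proof (rule locally_integrableI_cball)
  fix R
  have "integrable lebesgue (\<lambda>x. T (indicator (cball 0 R) x *\<^sub>R f x))"
    using integrable_bounded_linear[OF T locally_integrable_cball[OF f, of R]] .
  then show "integrable lebesgue (\<lambda>x. indicator (cball 0 R) x *\<^sub>R T (f x))"
    using linear_scale[OF bounded_linear.linear[OF T]] by simp
qed

lemma L2_real_locally_integrable:
  fixes f :: "'a::euclidean_space \<Rightarrow> real"
  assumes f: "f \<in> L2_real lebesgue"
  shows "locally_integrable f"
proof (rule locally_integrableI_cball)
  fix R
  have "integrable lebesgue (\<lambda>x. indicator (cball 0 R) x * f x)"
  proof (rule L2_real_mult_integrable[OF _ f])
    have "(\<lambda>x. (indicator (cball 0 R) x :: real)\<^sup>2) = (indicator (cball 0 R) :: 'a \<Rightarrow> real)"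
      by (simp add: indicator_def fun_eq_iff)
    then show "(indicator (cball 0 R) :: 'a \<Rightarrow> real) \<in> L2_real lebesgue"
      using integrable_indicator_cball[where 'a = 'a, of R]
        borel_measurable_integrable[OF integrable_indicator_cball[where 'a = 'a, of R]]
      unfolding L2_real_def mem_Collect_eq by argo
  qed
  then show "integrable lebesgue (\<lambda>x. indicator (cball 0 R) x *\<^sub>R f x)" by simp
qed

lemma bounded_support_L2_real:
  fixes \<psi> :: "'a::euclidean_space \<Rightarrow> real"
  assumes m: "\<psi> \<in> borel_measurable lebesgue" and b: "\<And>x. \<bar>\<psi> x\<bar> \<le> C * indicator (cball 0 R) x"
  shows "\<psi> \<in> L2_real lebesgue"
proof -
  have "integrable lebesgue (\<lambda>x. 1 * \<psi> x)"
    by (rule locally_integrable_times_bounded[OF locally_integrable_const m b])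
  then have "locally_integrable \<psi>"
    by (intro locally_integrableI_cball)
       (simp add: integrable_mult_indicator[of _ lebesgue \<psi>, simplified])
  from locally_integrable_times_bounded[OF this m b] show ?thesis
    using m by (simp add: L2_real_def power2_eq_square)
qed

section \<open>Test functions determine a function and are dense\<close>

lemma real_test_measurable: "real_test \<phi> \<Longrightarrow> \<phi> \<in> borel_measurable lebesgue"
  using real_test_bounds[of \<phi> undefined]
  by (metis borel_lebesgue_measurable borel_measurable_continuous_onI)

lemma real_test_bounded_support:
  fixes \<phi> :: "real^'n::finite \<Rightarrow> real"
  assumes "real_test \<phi>"
  obtains C R where "C > 0" "R > 0" "\<And>x. \<bar>\<phi> x\<bar> \<le> C * indicator (cball 0 R) x"
    "\<And>x. \<bar>real_partial i \<phi> x\<bar> \<le> C * indicator (cball 0 R) x" "real_partial i \<phi> \<in> borel_measurable lebesgue"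
proof -
  obtain R M where *: "R > 0" "M > 0" "\<And>x. norm x > R \<Longrightarrow> \<phi> x = 0" "\<And>x. norm x > R \<Longrightarrow> real_partial i \<phi> x = 0"
    "\<And>x. \<bar>\<phi> x\<bar> \<le> M" "\<And>x. \<bar>real_partial i \<phi> x\<bar> \<le> M" "continuous_on UNIV (real_partial i \<phi>)"
    using real_test_bounds[OF assms, of i] by metis
  show ?thesis
  proof (rule that[of M R])
    show "\<bar>\<phi> x\<bar> \<le> M * indicator (cball 0 R) x" "\<bar>real_partial i \<phi> x\<bar> \<le> M * indicator (cball 0 R) x" for x
      using *(3-6)[of x] by (auto simp: indicator_def not_le)
    show "real_partial i \<phi> \<in> borel_measurable lebesgue"
      using *(7) by (intro borel_lebesgue_measurable borel_measurable_continuous_onI)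
  qed fact+
qed

lemma real_test_L2_real:
  assumes "real_test \<phi>" shows "\<phi> \<in> L2_real lebesgue"
proof -
  obtain C R where "\<And>x. \<bar>\<phi> x\<bar> \<le> C * indicator (cball 0 R) x"
    using real_test_bounded_support[OF assms, of undefined] by metis
  from bounded_support_L2_real[OF real_test_measurable[OF assms] this] show ?thesis .
qed

text \<open>Linear properties that are stable under bounded convergence with supports in a fixed ball
  pass from test functions to all bounded measurable functions of bounded support: first to
  indicators of boxes, then by Dynkin's lemma to indicators of Borel sets inside a box, to Lebesgue
  sets, which differ from Borel sets by null sets, to simple functions, and to their limits.\<close>
proposition monotone_class_test_functions:
  fixes P :: "(real^'n::finite \<Rightarrow> real) \<Rightarrow> bool"
  assumes test: "\<And>\<phi>. real_test \<phi> \<Longrightarrow> P \<phi>"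
    and lin: "\<And>f g c. P f \<Longrightarrow> P g \<Longrightarrow> P (\<lambda>x. c * f x + g x)"
    and lim: "\<And>F f C R. (\<And>k. P (F k)) \<Longrightarrow> (\<And>k::nat. F k \<in> borel_measurable lebesgue) \<Longrightarrow>
        f \<in> borel_measurable lebesgue \<Longrightarrow> (\<And>k x. \<bar>F k x\<bar> \<le> C * indicator (cball 0 R) x) \<Longrightarrow>
        (AE x in lebesgue. (\<lambda>k. F k x) \<longlonglongrightarrow> f x) \<Longrightarrow> P f"
    and f: "f \<in> borel_measurable lebesgue" "\<And>x. \<bar>f x\<bar> \<le> C * indicator (cball 0 R) x"
  shows "P f"
proof -
  have box: "P (indicator (box a b))" for a b
  proof -
    obtain \<phi> where \<phi>: "\<And>k. real_test (\<phi> k)" "\<And>k x. \<bar>\<phi> k x\<bar> \<le> indicator (cbox a b) x"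
      "\<And>x. (\<lambda>k. \<phi> k x) \<longlonglongrightarrow> indicator (box a b) x"
      using real_test_approximates_box[of a b] by metis
    obtain r where r: "cbox a b \<subseteq> cball 0 r"
      using bounded_subset_cball0[OF bounded_cbox] by metis
    show ?thesis
    proof (rule lim[of \<phi>])
      show "\<bar>\<phi> k x\<bar> \<le> 1 * indicator (cball 0 r) x" for k x
      proof (cases "x \<in> cbox a b")
        case True
        then have "x \<in> cball 0 r" using r by blast
        then show ?thesis using \<phi>(2)[of k x] True by simp
      next
        case False
        then show ?thesis using \<phi>(2)[of k x] by simp
      qed
      show "(indicator (box a b) :: real^'n \<Rightarrow> real) \<in> borel_measurable lebesgue"
        by (intro borel_lebesgue_measurable borel_measurable_indicator) simp
      show "\<phi> k \<in> borel_measurable lebesgue" for k by (rule real_test_measurable[OF \<phi>(1)])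
      show "P (\<phi> k)" for k by (rule test[OF \<phi>(1)])
    qed (use \<phi> in auto)
  qed
  have "P (\<lambda>x. - 1 * indicator (box 0 0) x + indicator (box 0 0) x)"
    by (rule lin[OF box box])
  then have zero: "P (\<lambda>x. 0)" by simp
  \<comment> \<open>All sets are cut off by one box \<open>B\<close>, so that the complements in Dynkin's lemma stay bounded.\<close>
  obtain b :: "real^'n" where "cball 0 R \<subseteq> box (- b) b"
    using bounded_subset_box_symmetric[OF bounded_cball] by blast
  define B where "B = box (- b) b"
  have B: "cball 0 R \<subseteq> B" unfolding B_def by fact
  obtain r where r: "B \<subseteq> cball 0 r"
    unfolding B_def using bounded_subset_cball0[OF bounded_box] by metis
  have borel: "P (indicator (A \<inter> B))" if "A \<in> sets borel" for A :: "(real^'n) set"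
  proof -
    let ?G = "range (\<lambda>(a, b). box a b :: (real^'n) set)"
    have "Int_stable ?G" "?G \<subseteq> Pow UNIV" "A \<in> sigma_sets UNIV ?G"
      using that by (auto simp: Int_stable_def box_Int_box borel_eq_box)
    then show ?thesis
    proof (induction rule: sigma_sets_induct_disjoint)
      case (basic A)
      then obtain c d where "A = box c d" by auto
      then show ?case using box by (simp add: B_def box_Int_box)
    next
      case empty
      then show ?case using zero by simp
    next
      case (compl A)
      have "indicator ((UNIV - A) \<inter> B) = (\<lambda>x. (-1) * indicator (A \<inter> B) x + indicator B x :: real)"
        by (auto simp: indicator_def)
      moreover have "P (indicator B)" unfolding B_def by (rule box)
      ultimately show ?case using lin[OF compl(2), of "indicator B" "-1"] by simp
    next
      case (union A)
      have Ab: "A i \<in> sets borel" for i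
        using subsetD[OF union(2) rangeI[of A i]] by (simp add: borel_eq_box)
      have part: "P (indicator ((\<Union>i<k. A i) \<inter> B))" for k
      proof (induction k)
        case (Suc k)
        have "A k \<inter> (\<Union>i<k. A i) = {}"
          using union(1) unfolding disjoint_family_on_def by (metis (no_types, lifting) Int_UN_distrib SUP_bot_conv(2) UNIV_I lessThan_iff less_irrefl)
        then have "indicator ((\<Union>i<Suc k. A i) \<inter> B) =
            (\<lambda>x. 1 * indicator ((\<Union>i<k. A i) \<inter> B) x + indicator (A k \<inter> B) x :: real)"
          by (auto simp: indicator_def lessThan_Suc fun_eq_iff)
        then show ?case using lin[OF Suc union(3)[of k], of 1] by simp
      qed (simp add: zero)
      show ?case
      proof (rule lim[of "\<lambda>k. indicator ((\<Union>i<k. A i) \<inter> B)"])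
        show "P (indicator ((\<Union>i<k. A i) \<inter> B))" for k by (rule part)
        have Bb: "B \<in> sets borel" by (simp add: B_def)
        show "(indicator ((\<Union>i<k. A i) \<inter> B) :: real^'n \<Rightarrow> real) \<in> borel_measurable lebesgue" for k
          using Ab Bb by (intro borel_lebesgue_measurable borel_measurable_indicator sets.Int sets.finite_UN) auto
        show "(indicator ((\<Union>i. A i) \<inter> B) :: real^'n \<Rightarrow> real) \<in> borel_measurable lebesgue"
          using Ab Bb by (intro borel_lebesgue_measurable borel_measurable_indicator sets.Int sets.countable_UN) auto
        show "\<bar>indicator ((\<Union>i<k. A i) \<inter> B) x :: real\<bar> \<le> 1 * indicator (cball 0 r) x" for k x
          using r by (auto simp: indicator_def)
        have "(\<lambda>k. indicator ((\<Union>i<k. A i) \<inter> B) x :: real) \<longlonglongrightarrow> indicator ((\<Union>i. A i) \<inter> B) x" for x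
        proof (cases "x \<in> (\<Union>i. A i)")
          case True
          then obtain i where "x \<in> A i" by blast
          then show ?thesis
            by (intro tendsto_eventually eventually_sequentiallyI[of "Suc i"])
               (auto simp: indicator_def)
        qed (auto simp: indicator_def)
        then show "AE x in lebesgue. (\<lambda>k. indicator ((\<Union>i<k. A i) \<inter> B) x :: real) \<longlonglongrightarrow> indicator ((\<Union>i. A i) \<inter> B) x"
          by simp
      qed
    qed
  qed
  have leb: "P (indicator (A \<inter> B))" if A: "A \<in> sets lebesgue" for A :: "(real^'n) set"
  proof (rule lim[of "\<lambda>k. indicator (main_part lborel A \<inter> B)"])
    have mp: "main_part lborel A \<in> sets borel"
      using main_part_sets[OF A] by simp
    have Bb: "B \<in> sets borel" by (simp add: B_def)
    show "P (indicator (main_part lborel A \<inter> B))" by (rule borel[OF mp])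
    show "(indicator (main_part lborel A \<inter> B) :: real^'n \<Rightarrow> real) \<in> borel_measurable lebesgue"
      using mp Bb by (intro borel_lebesgue_measurable borel_measurable_indicator sets.Int)
    have "B \<in> sets lebesgue" using Bb by auto
    then show "(indicator (A \<inter> B) :: real^'n \<Rightarrow> real) \<in> borel_measurable lebesgue"
      using A by (intro borel_measurable_indicator sets.Int)
    show "\<bar>indicator (main_part lborel A \<inter> B) x :: real\<bar> \<le> 1 * indicator (cball 0 r) x" for x
      using r by (auto simp: indicator_def)
    show "AE x in lebesgue. (\<lambda>k. indicator (main_part lborel A \<inter> B) x :: real) \<longlonglongrightarrow> indicator (A \<inter> B) x"
      using AE_completion[OF AE_in_main_part[OF A]]
      by eventually_elim (auto simp: indicator_def)
  qed
  have simple: "P (\<lambda>x. s x * indicator B x)" if s: "simple_function lebesgue s" for s :: "real^'n \<Rightarrow> real"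
  proof -
    have fin: "finite (range s)" using simple_functionD(1)[OF s] by simp
    have sets: "s -` {y} \<in> sets lebesgue" for y
      using simple_functionD(2)[OF s, of "{y}"] by simp
    have "P (\<lambda>x. \<Sum>y\<in>Y. y * indicator (s -` {y} \<inter> B) x)" if "finite Y" for Y
      using that
    proof induction
      case (insert y Y)
      then show ?case
        unfolding sum.insert[OF insert.hyps] by (intro lin[OF leb[OF sets[of y]] insert.IH])
    qed (simp add: zero)
    from this[OF fin] have "P (\<lambda>x. \<Sum>y\<in>range s. y * indicator (s -` {y} \<inter> B) x)" .
    moreover have "(\<Sum>y\<in>range s. y * indicator (s -` {y} \<inter> B) x) = s x * indicator B x" for x
    proof -
      have "(\<Sum>y\<in>range s. y * indicator (s -` {y} \<inter> B) x) = (\<Sum>y\<in>range s. if y = s x then y * indicator B x else 0)"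
        by (intro sum.cong) (auto simp: indicator_def)
      then show ?thesis using fin by simp
    qed
    ultimately show ?thesis by simp
  qed
  obtain F where F: "\<And>k. simple_function lebesgue (F k)" "\<And>x. (\<lambda>k. F k x) \<longlonglongrightarrow> f x"
    "\<And>k x. \<bar>F k x\<bar> \<le> 2 * \<bar>f x\<bar>"
    using borel_measurable_implies_sequence_metric[OF f(1), of 0] by auto
  show ?thesis
  proof (rule lim[of "\<lambda>k x. F k x * indicator B x"])
    show "P (\<lambda>x. F k x * indicator B x)" for k by (rule simple[OF F(1)])
    have "(indicator B :: real^'n \<Rightarrow> real) \<in> borel_measurable lebesgue"
      by (intro borel_lebesgue_measurable borel_measurable_indicator) (simp add: B_def)
    then show "(\<lambda>x. F k x * indicator B x) \<in> borel_measurable lebesgue" for k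
      using borel_measurable_simple_function[OF F(1)[of k]] by (intro borel_measurable_times)
    show "\<bar>F k x * indicator B x\<bar> \<le> (2 * C) * indicator (cball 0 R) x" for k x
      using order_trans[OF F(3)[of k x] mult_left_mono[OF f(2)[of x], of 2]]
      by (auto simp: indicator_def split: if_splits)
    have "(\<lambda>k. F k x * indicator B x) \<longlonglongrightarrow> f x" for x
    proof -
      have eq: "f x * indicator B x = f x"
        using f(2)[of x] subsetD[OF B, of x] by (cases "x \<in> cball 0 R") simp_all
      from tendsto_mult_right[OF F(2)[of x], of "indicator B x"] show ?thesis unfolding eq .
    qed
    then show "AE x in lebesgue. (\<lambda>k. F k x * indicator B x) \<longlonglongrightarrow> f x" by simp
  qed fact
qed

text \<open>Orthogonality to test functions extends to the sign of \<open>g\<close>, cut off to a ball.\<close>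
proposition locally_integrable_zero_if_orthogonal_to_tests:
  fixes g :: "real^'n::finite \<Rightarrow> real"
  assumes g: "locally_integrable g"
    and orth: "\<And>\<phi>. real_test \<phi> \<Longrightarrow> (\<integral>x. g x * \<phi> x \<partial>lebesgue) = 0"
  shows "AE x in lebesgue. g x = 0"
proof -
  note gm [measurable] = locally_integrable_measurable[OF g]
  have zero: "(\<integral>x. g x * \<psi> x \<partial>lebesgue) = 0"
    if \<psi>: "\<psi> \<in> borel_measurable lebesgue" "\<And>x. \<bar>\<psi> x\<bar> \<le> C * indicator (cball 0 R) x" for \<psi> C R
  proof -
    have "integrable lebesgue (\<lambda>x. g x * \<psi> x) \<and> (\<integral>x. g x * \<psi> x \<partial>lebesgue) = 0"
    proof (rule monotone_class_test_functions[OF _ _ _ \<psi>])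
      fix \<phi> :: "real^'n \<Rightarrow> real" assume \<phi>: "real_test \<phi>"
      obtain C R where "\<And>x. \<bar>\<phi> x\<bar> \<le> C * indicator (cball 0 R) x"
        using real_test_bounded_support[OF \<phi>, of undefined] by metis
      from locally_integrable_times_bounded[OF g real_test_measurable[OF \<phi>] this] orth[OF \<phi>]
      show "integrable lebesgue (\<lambda>x. g x * \<phi> x) \<and> (\<integral>x. g x * \<phi> x \<partial>lebesgue) = 0" by simp
    next
      fix f h c
      assume *: "integrable lebesgue (\<lambda>x. g x * f x) \<and> (\<integral>x. g x * f x \<partial>lebesgue) = 0"
        "integrable lebesgue (\<lambda>x. g x * h x) \<and> (\<integral>x. g x * h x \<partial>lebesgue) = 0"
      have "(\<lambda>x. g x * (c * f x + h x)) = (\<lambda>x. c * (g x * f x) + g x * h x)"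
        by (simp add: algebra_simps)
      then show "integrable lebesgue (\<lambda>x. g x * (c * f x + h x)) \<and>
          (\<integral>x. g x * (c * f x + h x) \<partial>lebesgue) = 0"
        using * by simp
    next
      fix F f C R
      assume *: "\<And>k. integrable lebesgue (\<lambda>x. g x * F k x) \<and> (\<integral>x. g x * F k x \<partial>lebesgue) = 0"
        and m [measurable]: "\<And>k::nat. F k \<in> borel_measurable lebesgue" "f \<in> borel_measurable lebesgue"
        and b: "\<And>k x. \<bar>F k x\<bar> \<le> C * indicator (cball 0 R) x"
        and l: "AE x in lebesgue. (\<lambda>k. F k x) \<longlonglongrightarrow> f x"
      have w: "integrable lebesgue (\<lambda>x. \<bar>C\<bar> * \<bar>indicator (cball 0 R) x *\<^sub>R g x\<bar>)"
        using locally_integrable_cball[OF g] by auto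
      have b': "AE x in lebesgue. norm (g x * F k x) \<le> \<bar>C\<bar> * \<bar>indicator (cball 0 R) x *\<^sub>R g x\<bar>" for k
      proof (intro always_eventually allI)
        fix x
        have "\<bar>g x\<bar> * \<bar>F k x\<bar> \<le> \<bar>g x\<bar> * \<bar>C * indicator (cball 0 R) x\<bar>"
          using b[of k x] by (intro mult_left_mono) auto
        then show "norm (g x * F k x) \<le> \<bar>C\<bar> * \<bar>indicator (cball 0 R) x *\<^sub>R g x\<bar>"
          by (simp add: abs_mult mult_ac)
      qed
      have l': "AE x in lebesgue. (\<lambda>k. g x * F k x) \<longlonglongrightarrow> g x * f x"
        using l by eventually_elim (intro tendsto_intros)
      have "(\<lambda>k. \<integral>x. g x * F k x \<partial>lebesgue) \<longlonglongrightarrow> (\<integral>x. g x * f x \<partial>lebesgue)"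
        by (rule integral_dominated_convergence[OF _ _ w l' b']) simp_all
      moreover have "(\<lambda>k. \<integral>x. g x * F k x \<partial>lebesgue) \<longlonglongrightarrow> 0"
        using * by simp
      ultimately have "(\<integral>x. g x * f x \<partial>lebesgue) = 0" by (rule LIMSEQ_unique)
      moreover have "integrable lebesgue (\<lambda>x. g x * f x)"
        by (rule integrable_dominated_convergence[OF _ _ w l' b']) simp_all
      ultimately show "integrable lebesgue (\<lambda>x. g x * f x) \<and> (\<integral>x. g x * f x \<partial>lebesgue) = 0"
        by simp
    qed
    then show ?thesis by simp
  qed
  have "AE x in lebesgue. indicator (cball 0 (real n)) x *\<^sub>R \<bar>g x\<bar> = 0" for n
  proof -
    have [measurable]: "(indicator (cball 0 (real n)) :: real^'n \<Rightarrow> real) \<in> borel_measurable lebesgue"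
      by (rule borel_measurable_integrable[OF integrable_indicator_cball])
    have "(\<integral>x. g x * (sgn (g x) * indicator (cball 0 (real n)) x) \<partial>lebesgue) = 0"
    proof (rule zero[of _ 1 "real n"])
      show "(\<lambda>x. sgn (g x) * indicator (cball 0 (real n)) x) \<in> borel_measurable lebesgue"
        by measurable
      show "\<bar>sgn (g x) * indicator (cball 0 (real n)) x\<bar> \<le> 1 * indicator (cball 0 (real n)) x" for x
        by (cases "x \<in> cball 0 (real n)") (auto simp: sgn_real_def)
    qed
    also have "(\<lambda>x. g x * (sgn (g x) * indicator (cball 0 (real n)) x)) = (\<lambda>x. indicator (cball 0 (real n)) x *\<^sub>R \<bar>g x\<bar>)"
      by (auto simp: sgn_real_def indicator_def)
    finally show ?thesis
      using locally_integrable_cball[OF g, of "real n"]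
      by (subst (asm) integral_nonneg_eq_0_iff_AE) (auto dest: integrable_abs simp: abs_mult)
  qed
  then have "AE x in lebesgue. \<forall>n. indicator (cball 0 (real n)) x *\<^sub>R \<bar>g x\<bar> = 0"
    by (simp only: AE_all_countable) simp
  then show ?thesis
  proof eventually_elim
    fix x assume *: "\<forall>n. indicator (cball 0 (real n)) x *\<^sub>R \<bar>g x\<bar> = 0"
    obtain n where "norm x \<le> real n" using real_arch_simple by blast
    then show "g x = 0" using *[rule_format, of n] by (simp add: indicator_def)
  qed
qed

text \<open>Being an \<open>L\<^sup>2\<close> limit of test functions is a property to which the monotone class argument
  applies: with supports in a fixed ball, bounded convergence implies convergence in \<open>L\<^sup>2\<close>.\<close>
proposition tests_dense_L2:
  fixes f :: "real^'n::finite \<Rightarrow> real"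
  assumes f: "f \<in> borel_measurable lebesgue" "\<And>x. \<bar>f x\<bar> \<le> C * indicator (cball 0 R) x" and "\<epsilon> > 0"
  obtains \<phi> where "real_test \<phi>" "L2_norm lebesgue (\<lambda>x. f x - \<phi> x) < \<epsilon>"
proof -
  define P where "P f \<longleftrightarrow> f \<in> L2_real lebesgue \<and> (\<forall>\<epsilon>>0. \<exists>\<phi>. real_test \<phi> \<and> L2_norm lebesgue (\<lambda>x. f x - \<phi> x) < \<epsilon>)"
    for f :: "real^'n \<Rightarrow> real"
  have "P f"
  proof (rule monotone_class_test_functions[OF _ _ _ f])
    show "P \<phi>" if "real_test \<phi>" for \<phi>
      unfolding P_def using that real_test_L2_real[OF that]
      by (auto intro!: exI[of _ \<phi>] simp: L2_norm_def)
  next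
    fix f g c assume fg: "P f" "P g"
    show "P (\<lambda>x. c * f x + g x)"
      unfolding P_def
    proof (intro conjI allI impI)
      show "(\<lambda>x. c * f x + g x) \<in> L2_real lebesgue"
        using fg L2_real_lincomb[of f lebesgue g c 1] by (simp add: P_def)
      fix \<epsilon> :: real assume "\<epsilon> > 0"
      define \<delta> where "\<delta> = \<epsilon> / (2 * (\<bar>c\<bar> + 1))"
      have "\<delta> > 0" using \<open>\<epsilon> > 0\<close> by (simp add: \<delta>_def)
      then obtain \<phi> \<psi> where *: "real_test \<phi>" "L2_norm lebesgue (\<lambda>x. f x - \<phi> x) < \<delta>"
        "real_test \<psi>" "L2_norm lebesgue (\<lambda>x. g x - \<psi> x) < \<delta>"
        using fg unfolding P_def by blast
      have L: "(\<lambda>x. f x - \<phi> x) \<in> L2_real lebesgue" "(\<lambda>x. g x - \<psi> x) \<in> L2_real lebesgue"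
        using fg * real_test_L2_real L2_real_diff unfolding P_def by blast+
      have cL: "(\<lambda>x. c * (f x - \<phi> x)) \<in> L2_real lebesgue"
        using L2_real_lincomb[OF L(1) L(1), of c 0] by simp
      have "L2_norm lebesgue (\<lambda>x. c * (f x - \<phi> x)) = \<bar>c\<bar> * L2_norm lebesgue (\<lambda>x. f x - \<phi> x)"
        by (simp add: L2_norm_def power_mult_distrib real_sqrt_mult)
      then have "L2_norm lebesgue (\<lambda>x. c * (f x - \<phi> x) + (g x - \<psi> x)) \<le> \<bar>c\<bar> * \<delta> + \<delta>"
        using L2_norm_triangle[OF cL L(2)] *(2,4) mult_left_mono[of "L2_norm lebesgue (\<lambda>x. f x - \<phi> x)" \<delta> "\<bar>c\<bar>"]
        by linarith
      also have "\<dots> = \<epsilon> / 2"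
      proof -
        have "K * (\<epsilon> / (2 * K)) = \<epsilon> / 2" if "K > 0" for K using that by simp
        from this[of "\<bar>c\<bar> + 1"] have "(\<bar>c\<bar> + 1) * \<delta> = \<epsilon> / 2" by (simp add: \<delta>_def)
        then show ?thesis by (simp add: distrib_right)
      qed
      also have "\<dots> < \<epsilon>" using \<open>\<epsilon> > 0\<close> by simp
      also have "(\<lambda>x. c * (f x - \<phi> x) + (g x - \<psi> x)) = (\<lambda>x. c * f x + g x - (c * \<phi> x + \<psi> x))"
        by (simp add: algebra_simps)
      finally show "\<exists>\<phi>. real_test \<phi> \<and> L2_norm lebesgue (\<lambda>x. c * f x + g x - \<phi> x) < \<epsilon>"
        using real_test_linear[OF *(1,3), of c] by blast
    qed
  next
    fix F f C R
    assume *: "\<And>k. P (F k)"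
      and m [measurable]: "\<And>k::nat. F k \<in> borel_measurable lebesgue" "f \<in> borel_measurable lebesgue"
      and b: "\<And>k x. \<bar>F k x\<bar> \<le> C * indicator (cball 0 R) x"
      and l: "AE x in lebesgue. (\<lambda>k. F k x) \<longlonglongrightarrow> f x"
    define B where "B x = \<bar>C\<bar> * indicator (cball 0 R) x" for x :: "real^'n"
    have ind: "(indicator (cball 0 R) :: real^'n \<Rightarrow> real) \<in> borel_measurable lebesgue"
      by (rule borel_measurable_integrable[OF integrable_indicator_cball])
    have BL: "B \<in> L2_real lebesgue"
      by (rule bounded_support_L2_real[of _ "\<bar>C\<bar>" R]) (use ind in \<open>auto simp: B_def[abs_def]\<close>)
    have b': "\<bar>F k x\<bar> \<le> B x" for k x
      using b[of k x] by (auto simp: B_def indicator_def split: if_splits)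
    have fB: "AE x in lebesgue. \<bar>f x\<bar> \<le> B x"
      using l by eventually_elim (rule tendsto_upperbound[OF tendsto_rabs], use b' in auto)
    have fL: "f \<in> L2_real lebesgue"
      by (rule L2_real_bound[OF BL m(2)]) (use fB in \<open>auto elim!: eventually_mono\<close>)
    have FL: "F k \<in> L2_real lebesgue" for k using * by (simp add: P_def)
    have "(\<lambda>k. \<integral>x. (f x - F k x)\<^sup>2 \<partial>lebesgue) \<longlonglongrightarrow> (\<integral>x. 0 \<partial>(lebesgue :: (real^'n) measure))"
    proof (rule integral_dominated_convergence)
      show "integrable lebesgue (\<lambda>x. 4 * (B x)\<^sup>2)" using BL by (simp add: L2_real_def)
      show "AE x in lebesgue. (\<lambda>k. (f x - F k x)\<^sup>2) \<longlonglongrightarrow> 0"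
        using l
      proof eventually_elim
        fix x assume "(\<lambda>k. F k x) \<longlonglongrightarrow> f x"
        then have "(\<lambda>k. (f x - F k x)\<^sup>2) \<longlonglongrightarrow> (f x - f x)\<^sup>2" by (intro tendsto_intros)
        then show "(\<lambda>k. (f x - F k x)\<^sup>2) \<longlonglongrightarrow> 0" by simp
      qed
      show "AE x in lebesgue. norm ((f x - F k x)\<^sup>2) \<le> 4 * (B x)\<^sup>2" for k
        using fB
      proof eventually_elim
        fix x assume "\<bar>f x\<bar> \<le> B x"
        then have "\<bar>f x - F k x\<bar> \<le> \<bar>2 * B x\<bar>" using b'[of k x] by linarith
        then have "(f x - F k x)\<^sup>2 \<le> (2 * B x)\<^sup>2" by (simp only: abs_le_square_iff)
        then show "norm ((f x - F k x)\<^sup>2) \<le> 4 * (B x)\<^sup>2" by (simp add: power_mult_distrib)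
      qed
    qed simp_all
    then have lim: "(\<lambda>k. L2_norm lebesgue (\<lambda>x. f x - F k x)) \<longlonglongrightarrow> 0"
      unfolding L2_norm_def using tendsto_real_sqrt by fastforce
    show "P f"
      unfolding P_def
    proof (intro conjI allI impI fL)
      fix \<epsilon> :: real assume "\<epsilon> > 0"
      then have "eventually (\<lambda>k. L2_norm lebesgue (\<lambda>x. f x - F k x) < \<epsilon> / 2) sequentially"
        using order_tendstoD(2)[OF lim, of "\<epsilon> / 2"] by simp
      then obtain k where k: "L2_norm lebesgue (\<lambda>x. f x - F k x) < \<epsilon> / 2"
        by (auto simp: eventually_sequentially)
      obtain \<phi> where \<phi>: "real_test \<phi>" "L2_norm lebesgue (\<lambda>x. F k x - \<phi> x) < \<epsilon> / 2"
        using *[of k] \<open>\<epsilon> > 0\<close> unfolding P_def by (metis half_gt_zero)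
      have "L2_norm lebesgue (\<lambda>x. (f x - F k x) + (F k x - \<phi> x)) < \<epsilon>"
        using L2_norm_triangle[OF L2_real_diff[OF fL FL] L2_real_diff[OF FL real_test_L2_real[OF \<phi>(1)]], of k k] k \<phi>(2)
        by linarith
      then show "\<exists>\<phi>. real_test \<phi> \<and> L2_norm lebesgue (\<lambda>x. f x - \<phi> x) < \<epsilon>"
        using \<phi>(1) by auto
    qed
  qed
  then show ?thesis using that \<open>\<epsilon> > 0\<close> unfolding P_def by blast
qed

section \<open>The weak derivative of the modulus\<close>

lemma
  fixes a :: "'a::euclidean_space"
  shows lebesgue_translation_measurable: "(\<lambda>x. x + a) \<in> lebesgue \<rightarrow>\<^sub>M lebesgue"
    and lebesgue_translation_distr: "distr lebesgue lebesgue (\<lambda>x. x + a) = lebesgue"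
proof -
  have T: "(\<lambda>x. a + (\<Sum>j\<in>Basis. (1 * (x \<bullet> j)) *\<^sub>R j)) = (\<lambda>x. x + a)"
    by (simp add: euclidean_representation add.commute)
  show "(\<lambda>x. x + a) \<in> lebesgue \<rightarrow>\<^sub>M lebesgue"
    using lebesgue_affine_measurable[of "\<lambda>_. 1" a] unfolding T by simp
  show "distr lebesgue lebesgue (\<lambda>x. x + a) = lebesgue"
    using lebesgue_affine_euclidean[of "\<lambda>_. 1" a] unfolding T by (simp add: density_1)
qed

lemma borel_measurable_lebesgue_translation:
  "f \<in> borel_measurable lebesgue \<Longrightarrow> (\<lambda>x. f (x + a)) \<in> borel_measurable lebesgue"
  using measurable_compose[OF lebesgue_translation_measurable] .

lemma integral_lebesgue_translation:
  fixes f :: "'a::euclidean_space \<Rightarrow> real"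
  assumes "f \<in> borel_measurable lebesgue"
  shows "(\<integral>x. f (x + a) \<partial>lebesgue) = (\<integral>x. f x \<partial>lebesgue)"
  using integral_distr[OF lebesgue_translation_measurable assms, of a]
  by (simp add: lebesgue_translation_distr)

lemma integrable_lebesgue_translation:
  fixes f :: "'a::euclidean_space \<Rightarrow> real"
  assumes "f \<in> borel_measurable lebesgue"
  shows "integrable lebesgue (\<lambda>x. f (x + a)) \<longleftrightarrow> integrable lebesgue f"
  using integrable_distr_eq[OF lebesgue_translation_measurable assms, of a]
  by (simp add: lebesgue_translation_distr)

lemma L2_real_translation:
  fixes f :: "'a::euclidean_space \<Rightarrow> real"
  assumes f: "f \<in> L2_real lebesgue"
  shows "(\<lambda>x. f (x + a)) \<in> L2_real lebesgue" "L2_norm lebesgue (\<lambda>x. f (x + a)) = L2_norm lebesgue f"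
proof -
  have m: "f \<in> borel_measurable lebesgue" and m2: "(\<lambda>x. (f x)\<^sup>2) \<in> borel_measurable lebesgue"
    using L2_real_measurable[OF f] by auto
  show "(\<lambda>x. f (x + a)) \<in> L2_real lebesgue"
    using f borel_measurable_lebesgue_translation[OF m] integrable_lebesgue_translation[OF m2, of a]
    by (auto simp: L2_real_def)
  show "L2_norm lebesgue (\<lambda>x. f (x + a)) = L2_norm lebesgue f"
    using integral_lebesgue_translation[OF m2, of a] by (simp add: L2_norm_def)
qed

lemma abs_le_indicator_bound: "\<bar>y :: real\<bar> \<le> C * indicator A x \<Longrightarrow> C > 0 \<Longrightarrow> \<bar>y\<bar> \<le> C"
  by (cases "x \<in> A") simp_all

text \<open>The difference quotients of \<open>\<phi>\<close> are bounded by a multiple of the indicator of one ball, so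
  dominated convergence justifies differentiation under the integral.\<close>
lemma integral_line_derivative:
  fixes w \<phi> :: "real^'n::finite \<Rightarrow> real"
  assumes w: "locally_integrable w" and \<phi>: "real_test \<phi>"
  shows "((\<lambda>s. \<integral>x. w x * \<phi> (x - s *\<^sub>R axis i 1) \<partial>lebesgue) has_real_derivative
      - (\<integral>x. w x * real_partial i \<phi> (x - s *\<^sub>R axis i 1) \<partial>lebesgue)) (at s)"
proof -
  let ?e = "axis i 1 :: real^'n"
  obtain C R where C: "C > 0" and R: "R > 0"
    and b: "\<And>x. \<bar>\<phi> x\<bar> \<le> C * indicator (cball 0 R) x" "\<And>x. \<bar>real_partial i \<phi> x\<bar> \<le> C * indicator (cball 0 R) x"
    and rm: "real_partial i \<phi> \<in> borel_measurable lebesgue"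
    using real_test_bounded_support[OF \<phi>, of i] by metis
  have wm: "w \<in> borel_measurable lebesgue" by (rule locally_integrable_measurable[OF w])
  have m: "(\<lambda>x. \<phi> (x - r *\<^sub>R ?e)) \<in> borel_measurable lebesgue" for r
    using borel_measurable_lebesgue_translation[OF real_test_measurable[OF \<phi>], of "- r *\<^sub>R ?e"] by simp
  have rm': "(\<lambda>x. real_partial i \<phi> (x - r *\<^sub>R ?e)) \<in> borel_measurable lebesgue" for r
    using borel_measurable_lebesgue_translation[OF rm, of "- r *\<^sub>R ?e"] by simp
  have far: "x - r *\<^sub>R ?e \<notin> cball 0 R" if "norm x > R + \<bar>r\<bar>" for x r
    using that norm_triangle_ineq2[of x "r *\<^sub>R ?e"] by simp
  have int: "integrable lebesgue (\<lambda>x. w x * \<phi> (x - r *\<^sub>R ?e))" for r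
  proof (rule locally_integrable_times_bounded[OF w m, of _ C "R + \<bar>r\<bar>"])
    fix x
    show "\<bar>\<phi> (x - r *\<^sub>R ?e)\<bar> \<le> C * indicator (cball 0 (R + \<bar>r\<bar>)) x"
    proof (cases "norm x > R + \<bar>r\<bar>")
      case True
      then show ?thesis using b(1)[of "x - r *\<^sub>R ?e"] far[OF True] by simp
    next
      case False
      have "\<bar>\<phi> (x - r *\<^sub>R ?e)\<bar> \<le> C"
        by (rule abs_le_indicator_bound[OF b(1) C])
      then show ?thesis using False by simp
    qed
  qed
  let ?c = "\<lambda>s. \<integral>x. w x * \<phi> (x - s *\<^sub>R ?e) \<partial>lebesgue"
  let ?D = "- (\<integral>x. w x * real_partial i \<phi> (x - s *\<^sub>R ?e) \<partial>lebesgue)"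
  have "((\<lambda>y. (?c y - ?c s) / (y - s)) \<circ> X) \<longlonglongrightarrow> ?D"
    if X: "\<forall>n. X n \<in> UNIV - {s}" "X \<longlonglongrightarrow> s" for X
  proof -
    obtain N where N: "\<And>n. n \<ge> N \<Longrightarrow> \<bar>X n - s\<bar> < 1"
      using LIMSEQ_D[OF X(2), of 1] by auto
    define Y where "Y n = X (n + N)" for n
    have Y: "Y n \<noteq> s" "\<bar>Y n - s\<bar> < 1" for n using X(1) N by (auto simp: Y_def)
    have Yl: "Y \<longlonglongrightarrow> s" unfolding Y_def using X(2) by (rule LIMSEQ_ignore_initial_segment)
    define Q where "Q n x = w x * ((\<phi> (x - Y n *\<^sub>R ?e) - \<phi> (x - s *\<^sub>R ?e)) / (Y n - s))" for n x
    have Qi: "(\<integral>x. Q n x \<partial>lebesgue) = (?c (Y n) - ?c s) / (Y n - s)" for n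
    proof -
      have "Q n = (\<lambda>x. (w x * \<phi> (x - Y n *\<^sub>R ?e) - w x * \<phi> (x - s *\<^sub>R ?e)) / (Y n - s))"
        by (auto simp: Q_def right_diff_distrib)
      then show ?thesis using int[of "Y n"] int[of s] by simp
    qed
    have Qb: "norm (Q n x) \<le> C * \<bar>indicator (cball 0 (R + \<bar>s\<bar> + 1)) x *\<^sub>R w x\<bar>" for n x
    proof (cases "norm x > R + \<bar>s\<bar> + 1")
      case True
      then have "norm x > R + \<bar>Y n\<bar>" "norm x > R + \<bar>s\<bar>" using Y(2)[of n] by linarith+
      then have "\<phi> (x - Y n *\<^sub>R ?e) = 0" "\<phi> (x - s *\<^sub>R ?e) = 0"
        using b(1)[of "x - Y n *\<^sub>R ?e"] b(1)[of "x - s *\<^sub>R ?e"] far by simp_all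
      then show ?thesis using True C by (simp add: Q_def)
    next
      case False
      have "norm (\<phi> (x - Y n *\<^sub>R ?e) - \<phi> (x - s *\<^sub>R ?e)) \<le> C * norm (Y n - s)"
      proof (rule field_differentiable_bound[of UNIV "\<lambda>s. \<phi> (x - s *\<^sub>R ?e)"])
        show "((\<lambda>s. \<phi> (x - s *\<^sub>R ?e)) has_field_derivative - real_partial i \<phi> (x - z *\<^sub>R ?e)) (at z)" for z
          by (rule real_test_line_derivative[OF \<phi>])
        show "norm (- real_partial i \<phi> (x - z *\<^sub>R ?e)) \<le> C" for z
          using abs_le_indicator_bound[OF b(2) C] by simp
      qed auto
      then have "\<bar>(\<phi> (x - Y n *\<^sub>R ?e) - \<phi> (x - s *\<^sub>R ?e)) / (Y n - s)\<bar> \<le> C"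
        using Y(1)[of n] by (simp add: divide_le_eq)
      then have "\<bar>w x\<bar> * \<bar>(\<phi> (x - Y n *\<^sub>R ?e) - \<phi> (x - s *\<^sub>R ?e)) / (Y n - s)\<bar> \<le> \<bar>w x\<bar> * C"
        by (intro mult_left_mono) auto
      then show ?thesis using False by (simp add: Q_def abs_mult mult.commute)
    qed
    have Ql: "(\<lambda>n. Q n x) \<longlonglongrightarrow> w x * - real_partial i \<phi> (x - s *\<^sub>R ?e)" for x
    proof -
      have "((\<lambda>y. (\<phi> (x - y *\<^sub>R ?e) - \<phi> (x - s *\<^sub>R ?e)) / (y - s)) \<longlongrightarrow> - real_partial i \<phi> (x - s *\<^sub>R ?e)) (at s)"
        using real_test_line_derivative[OF \<phi>, of x i s] by (simp add: has_field_derivative_iff)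
      then have "(\<lambda>n. (\<phi> (x - Y n *\<^sub>R ?e) - \<phi> (x - s *\<^sub>R ?e)) / (Y n - s)) \<longlonglongrightarrow> - real_partial i \<phi> (x - s *\<^sub>R ?e)"
        using Yl Y(1) unfolding tendsto_at_iff_sequentially by (auto simp: comp_def)
      then show ?thesis unfolding Q_def by (intro tendsto_mult tendsto_const)
    qed
    have "(\<lambda>n. \<integral>x. Q n x \<partial>lebesgue) \<longlonglongrightarrow> (\<integral>x. w x * - real_partial i \<phi> (x - s *\<^sub>R ?e) \<partial>lebesgue)"
    proof (rule integral_dominated_convergence)
      show "integrable lebesgue (\<lambda>x. C * \<bar>indicator (cball 0 (R + \<bar>s\<bar> + 1)) x *\<^sub>R w x\<bar>)"
        using locally_integrable_cball[OF w] by (intro integrable_mult_right integrable_abs)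
      show "(\<lambda>x. w x * - real_partial i \<phi> (x - s *\<^sub>R ?e)) \<in> borel_measurable lebesgue"
        using wm rm'[of s] by simp
      show "Q n \<in> borel_measurable lebesgue" for n
        unfolding Q_def[abs_def] using wm m[of s] m[of "Y n"] by simp
    qed (use Qb Ql in auto)
    then have "(\<lambda>n. (?c (Y n) - ?c s) / (Y n - s)) \<longlonglongrightarrow> ?D" unfolding Qi by simp
    then show ?thesis unfolding Y_def comp_def by (rule LIMSEQ_offset)
  qed
  then show ?thesis
    unfolding has_field_derivative_iff tendsto_at_iff_sequentially by blast
qed

definition weak_partial :: "'n::finite \<Rightarrow> (real^'n \<Rightarrow> real) \<Rightarrow> (real^'n \<Rightarrow> real) \<Rightarrow> bool" where
  "weak_partial i u G \<longleftrightarrow> locally_integrable u \<and> locally_integrable G \<and>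
     (\<forall>\<phi>. real_test \<phi> \<longrightarrow> (\<integral>x. u x * real_partial i \<phi> x \<partial>lebesgue) = - (\<integral>x. G x * \<phi> x \<partial>lebesgue))"

text \<open>Translation invariance moves a difference from the test function onto \<open>u\<close>. Weak derivatives
  are thereby read off from difference quotients, which are compatible with nonlinear functions
  of \<open>u\<close>.\<close>
lemma integral_difference_shift:
  fixes u \<phi> :: "real^'n::finite \<Rightarrow> real"
  assumes u: "locally_integrable u" and \<phi>: "real_test \<phi>"
    and i2: "integrable lebesgue (\<lambda>x. u (x + a) * \<phi> x)"
  shows "(\<integral>x. (u (x + a) - u x) * \<phi> x \<partial>lebesgue) =
    (\<integral>x. u x * \<phi> (x - a) \<partial>lebesgue) - (\<integral>x. u x * \<phi> x \<partial>lebesgue)"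
proof -
  obtain C R where b: "\<And>x. \<bar>\<phi> x\<bar> \<le> C * indicator (cball 0 R) x"
    using real_test_bounded_support[OF \<phi>, of undefined] by metis
  have i1: "integrable lebesgue (\<lambda>x. u x * \<phi> x)"
    by (rule locally_integrable_times_bounded[OF u real_test_measurable[OF \<phi>] b])
  have "(\<lambda>x. \<phi> (x - a)) \<in> borel_measurable lebesgue"
    using borel_measurable_lebesgue_translation[OF real_test_measurable[OF \<phi>], of "- a"] by simp
  then have "(\<lambda>x. u x * \<phi> (x - a)) \<in> borel_measurable lebesgue"
    using locally_integrable_measurable[OF u] by simp
  from integral_lebesgue_translation[OF this, of a]
  have "(\<integral>x. u (x + a) * \<phi> x \<partial>lebesgue) = (\<integral>x. u x * \<phi> (x - a) \<partial>lebesgue)" by simp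
  then show ?thesis
    using i1 i2 by (simp add: left_diff_distrib)
qed

text \<open>The second order Taylor estimate for \<open>r \<mapsto> sqrt (r\<^sup>2 + \<delta>\<^sup>2)\<close>. With \<open>A\<close> and \<open>B\<close> for the two roots
  the remainder is \<open>(A B - a b - \<delta>\<^sup>2) / A\<close>, which lies between \<open>0\<close>, by the Cauchy-Schwarz inequality,
  and \<open>(b - a)\<^sup>2 / (2 A)\<close>, by \<open>2 A B \<le> A\<^sup>2 + B\<^sup>2\<close>.\<close>
lemma sqrt_remainder:
  fixes a b \<delta> :: real
  assumes "\<delta> > 0"
  shows "\<bar>sqrt (b\<^sup>2 + \<delta>\<^sup>2) - sqrt (a\<^sup>2 + \<delta>\<^sup>2) - a / sqrt (a\<^sup>2 + \<delta>\<^sup>2) * (b - a)\<bar> \<le> (b - a)\<^sup>2 / (2 * \<delta>)"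
proof -
  define A B where "A = sqrt (a\<^sup>2 + \<delta>\<^sup>2)" and "B = sqrt (b\<^sup>2 + \<delta>\<^sup>2)"
  have A2: "A\<^sup>2 = a\<^sup>2 + \<delta>\<^sup>2" and B2: "B\<^sup>2 = b\<^sup>2 + \<delta>\<^sup>2" by (simp_all add: A_def B_def)
  have A: "A \<ge> \<delta>" unfolding A_def by (rule real_le_rsqrt) simp
  have B: "B \<ge> 0" by (simp add: B_def)
  have "A > 0" using A assms by linarith
  have eq: "B - A - a / A * (b - a) = (A * B - a * b - \<delta>\<^sup>2) / A"
    using \<open>A > 0\<close> A2 by (simp add: field_simps power2_eq_square)
  have up: "A * B - a * b - \<delta>\<^sup>2 \<le> (b - a)\<^sup>2 / 2"
    using sum_squares_bound[of A B] A2 B2 by (simp add: power2_eq_square algebra_simps)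
  have "(a * b + \<delta>\<^sup>2)\<^sup>2 + (\<delta> * (a - b))\<^sup>2 = (A * B)\<^sup>2"
    unfolding power_mult_distrib[of A B] A2 B2 by (simp add: power2_eq_square algebra_simps)
  then have "(a * b + \<delta>\<^sup>2)\<^sup>2 \<le> (A * B)\<^sup>2" by (smt (verit) zero_le_power2)
  then have "\<bar>a * b + \<delta>\<^sup>2\<bar> \<le> A * B" using \<open>A > 0\<close> B by (simp add: abs_le_square_iff[symmetric] abs_mult)
  then have lo: "0 \<le> A * B - a * b - \<delta>\<^sup>2" by linarith
  have "(A * B - a * b - \<delta>\<^sup>2) / A \<le> ((b - a)\<^sup>2 / 2) / \<delta>"
    using up lo A assms by (intro frac_le) auto
  moreover have "0 \<le> (A * B - a * b - \<delta>\<^sup>2) / A" using lo \<open>A > 0\<close> by simp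
  ultimately have "\<bar>B - A - a / A * (b - a)\<bar> \<le> (b - a)\<^sup>2 / (2 * \<delta>)" unfolding eq by simp
  then show ?thesis by (simp add: A_def B_def)
qed

context
  fixes u G :: "real^'n::finite \<Rightarrow> real" and i :: 'n
  assumes u: "u \<in> L2_real lebesgue" and G: "G \<in> L2_real lebesgue" and uG: "weak_partial i u G"
begin

private abbreviation "e \<equiv> axis i 1 :: real^'n"
private definition "dif h x = u (x + h *\<^sub>R e) - u x"

lemma dif_L2_real: "dif h \<in> L2_real lebesgue"
  unfolding dif_def[abs_def] by (intro L2_real_diff L2_real_translation u)

text \<open>Pairing \<open>u\<close> with translates of a test function is differentiable in the translation, and by
  the definition of the weak derivative the derivative is the pairing with \<open>G\<close>.\<close>
lemma pairing_derivative:
  assumes \<phi>: "real_test \<phi>"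
  shows "((\<lambda>s. \<integral>x. u x * \<phi> (x - s *\<^sub>R e) \<partial>lebesgue) has_real_derivative
      (\<integral>x. G x * \<phi> (x - s *\<^sub>R e) \<partial>lebesgue)) (at s)"
proof -
  have "(\<integral>x. u x * real_partial i (\<lambda>x. \<phi> (x + - s *\<^sub>R e)) x \<partial>lebesgue) = - (\<integral>x. G x * \<phi> (x + - s *\<^sub>R e) \<partial>lebesgue)"
    using uG real_test_translate(1)[OF \<phi>] unfolding weak_partial_def by blast
  then show ?thesis
    using integral_line_derivative[OF L2_real_locally_integrable[OF u] \<phi>, of i s]
    by (simp add: real_test_translate(2)[OF \<phi>, of i "- s *\<^sub>R e", simplified])
qed

lemma pairing_difference:
  assumes \<phi>: "real_test \<phi>"
  shows "(\<integral>x. dif h x * \<phi> x \<partial>lebesgue) =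
      (\<integral>x. u x * \<phi> (x - h *\<^sub>R e) \<partial>lebesgue) - (\<integral>x. u x * \<phi> (x - 0 *\<^sub>R e) \<partial>lebesgue)"
  using integral_difference_shift[OF L2_real_locally_integrable[OF u] \<phi>
      L2_real_mult_integrable[OF L2_real_translation(1)[OF u] real_test_L2_real[OF \<phi>]], of "h *\<^sub>R e"]
  by (simp add: dif_def)

lemma pairing_bound_test:
  assumes \<phi>: "real_test \<phi>"
  shows "\<bar>\<integral>x. dif h x * \<phi> x \<partial>lebesgue\<bar> \<le> \<bar>h\<bar> * L2_norm lebesgue G * L2_norm lebesgue \<phi>"
proof -
  have "norm ((\<integral>x. u x * \<phi> (x - h *\<^sub>R e) \<partial>lebesgue) - (\<integral>x. u x * \<phi> (x - 0 *\<^sub>R e) \<partial>lebesgue))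
      \<le> (L2_norm lebesgue G * L2_norm lebesgue \<phi>) * norm (h - 0)"
  proof (rule field_differentiable_bound[of UNIV "\<lambda>s. \<integral>x. u x * \<phi> (x - s *\<^sub>R e) \<partial>lebesgue"])
    show "((\<lambda>s. \<integral>x. u x * \<phi> (x - s *\<^sub>R e) \<partial>lebesgue) has_field_derivative
        (\<integral>x. G x * \<phi> (x - z *\<^sub>R e) \<partial>lebesgue)) (at z)" for z
      by (rule pairing_derivative[OF \<phi>])
    show "norm (\<integral>x. G x * \<phi> (x - z *\<^sub>R e) \<partial>lebesgue) \<le> L2_norm lebesgue G * L2_norm lebesgue \<phi>" for z
      using Cauchy_Schwarz_L2_real[OF G L2_real_translation(1)[OF real_test_L2_real[OF \<phi>], of "- z *\<^sub>R e"]]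
      by (simp add: L2_real_translation(2)[OF real_test_L2_real[OF \<phi>], of "- z *\<^sub>R e", simplified])
  qed auto
  then show ?thesis
    by (simp only: pairing_difference[OF \<phi>] real_norm_def diff_zero mult.commute[of _ "\<bar>h\<bar>"] mult.assoc[symmetric])
qed

text \<open>The mean value theorem gives the bound for test functions, and density extends it.\<close>
lemma pairing_bound:
  assumes \<psi>: "\<psi> \<in> borel_measurable lebesgue" "\<And>x. \<bar>\<psi> x\<bar> \<le> C * indicator (cball 0 R) x"
  shows "\<bar>\<integral>x. dif h x * \<psi> x \<partial>lebesgue\<bar> \<le> \<bar>h\<bar> * L2_norm lebesgue G * L2_norm lebesgue \<psi>"
proof (rule field_le_epsilon)
  fix \<epsilon> :: real assume "\<epsilon> > 0"
  have \<psi>L: "\<psi> \<in> L2_real lebesgue" by (rule bounded_support_L2_real[OF \<psi>])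
  define K where "K = \<bar>h\<bar> * L2_norm lebesgue G + L2_norm lebesgue (dif h) + 1"
  have K: "K > 0" by (auto simp: K_def intro!: add_nonneg_pos add_nonneg_nonneg mult_nonneg_nonneg L2_norm_nonneg)
  obtain \<phi> where \<phi>: "real_test \<phi>" and d: "L2_norm lebesgue (\<lambda>x. \<psi> x - \<phi> x) < \<epsilon> / K"
    using tests_dense_L2[OF \<psi>, of "\<epsilon> / K"] \<open>\<epsilon> > 0\<close> K by auto
  have \<phi>L: "\<phi> \<in> L2_real lebesgue" by (rule real_test_L2_real[OF \<phi>])
  have dL: "(\<lambda>x. \<psi> x - \<phi> x) \<in> L2_real lebesgue" by (rule L2_real_diff[OF \<psi>L \<phi>L])
  have "(\<integral>x. dif h x * \<psi> x \<partial>lebesgue) = (\<integral>x. dif h x * \<phi> x \<partial>lebesgue) + (\<integral>x. dif h x * (\<psi> x - \<phi> x) \<partial>lebesgue)"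
    using L2_real_mult_integrable[OF dif_L2_real \<phi>L, of h] L2_real_mult_integrable[OF dif_L2_real \<psi>L, of h]
    by (simp add: right_diff_distrib)
  moreover have "\<bar>\<integral>x. dif h x * (\<psi> x - \<phi> x) \<partial>lebesgue\<bar> \<le> L2_norm lebesgue (dif h) * L2_norm lebesgue (\<lambda>x. \<psi> x - \<phi> x)"
    by (rule Cauchy_Schwarz_L2_real[OF dif_L2_real dL])
  moreover have "L2_norm lebesgue \<phi> \<le> L2_norm lebesgue \<psi> + L2_norm lebesgue (\<lambda>x. \<psi> x - \<phi> x)"
  proof -
    have "L2_norm lebesgue (\<lambda>x. \<psi> x + (- 1) * (\<psi> x - \<phi> x)) \<le> L2_norm lebesgue \<psi> + L2_norm lebesgue (\<lambda>x. (- 1) * (\<psi> x - \<phi> x))"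
      using L2_real_lincomb[OF dL dL, of "-1" 0] by (intro L2_norm_triangle[OF \<psi>L]) simp
    then show ?thesis by (simp add: L2_norm_def power2_commute)
  qed
  then have "\<bar>h\<bar> * L2_norm lebesgue G * L2_norm lebesgue \<phi> \<le> \<bar>h\<bar> * L2_norm lebesgue G * (L2_norm lebesgue \<psi> + L2_norm lebesgue (\<lambda>x. \<psi> x - \<phi> x))"
    by (intro mult_left_mono mult_nonneg_nonneg L2_norm_nonneg) auto
  ultimately have "\<bar>\<integral>x. dif h x * \<psi> x \<partial>lebesgue\<bar> \<le> \<bar>h\<bar> * L2_norm lebesgue G * L2_norm lebesgue \<psi> +
      (\<bar>h\<bar> * L2_norm lebesgue G + L2_norm lebesgue (dif h)) * L2_norm lebesgue (\<lambda>x. \<psi> x - \<phi> x)"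
    using pairing_bound_test[OF \<phi>, of h] by (simp add: algebra_simps)
  also have "(\<bar>h\<bar> * L2_norm lebesgue G + L2_norm lebesgue (dif h)) * L2_norm lebesgue (\<lambda>x. \<psi> x - \<phi> x) \<le> K * (\<epsilon> / K)"
    using d by (intro mult_mono) (auto simp: K_def intro!: add_nonneg_pos add_nonneg_nonneg mult_nonneg_nonneg L2_norm_nonneg)
  finally show "\<bar>\<integral>x. dif h x * \<psi> x \<partial>lebesgue\<bar> \<le> \<bar>h\<bar> * L2_norm lebesgue G * L2_norm lebesgue \<psi> + \<epsilon>"
    using K by simp
qed

text \<open>Duality: the bound for pairings is applied to truncations of the difference itself.\<close>
lemma L2_norm_dif_le: "L2_norm lebesgue (dif h) \<le> \<bar>h\<bar> * L2_norm lebesgue G"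
proof -
  define S where "S n = {x. \<bar>dif h x\<bar> \<le> real n} \<inter> cball 0 (real n)" for n
  define \<psi> where "\<psi> n x = dif h x * indicator (S n) x" for n x
  have m [measurable]: "dif h \<in> borel_measurable lebesgue" by (rule L2_real_measurable[OF dif_L2_real])
  have "{x. \<bar>dif h x\<bar> \<le> real n} \<in> sets lebesgue" for n
  proof -
    have "{x\<in>space lebesgue. \<bar>dif h x\<bar> \<le> real n} \<in> sets lebesgue" by measurable
    then show ?thesis by simp
  qed
  then have "S n \<in> sets lebesgue" for n unfolding S_def by (intro sets.Int) auto
  then have \<psi>m: "\<psi> n \<in> borel_measurable lebesgue" for n
    unfolding \<psi>_def[abs_def] by (intro borel_measurable_times m borel_measurable_indicator)
  have \<psi>b: "\<bar>\<psi> n x\<bar> \<le> real n * indicator (cball 0 (real n)) x" for n x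
    by (auto simp: \<psi>_def S_def indicator_def)
  have \<psi>L: "\<psi> n \<in> L2_real lebesgue" for n by (rule bounded_support_L2_real[OF \<psi>m \<psi>b])
  have le: "L2_norm lebesgue (\<psi> n) \<le> \<bar>h\<bar> * L2_norm lebesgue G" for n
  proof -
    have "dif h x * \<psi> n x = (\<psi> n x)\<^sup>2" for x
      by (simp add: \<psi>_def power2_eq_square indicator_def)
    then have "(L2_norm lebesgue (\<psi> n))\<^sup>2 \<le> \<bar>h\<bar> * L2_norm lebesgue G * L2_norm lebesgue (\<psi> n)"
      using pairing_bound[OF \<psi>m \<psi>b, of h n] by (simp add: L2_norm_power)
    then show ?thesis
      using L2_norm_nonneg[of lebesgue "\<psi> n"] L2_norm_nonneg[of lebesgue G]
      by (cases "L2_norm lebesgue (\<psi> n) = 0") (auto simp: power2_eq_square)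
  qed
  have "(\<lambda>n. \<integral>x. (\<psi> n x)\<^sup>2 \<partial>lebesgue) \<longlonglongrightarrow> (\<integral>x. (dif h x)\<^sup>2 \<partial>lebesgue)"
  proof (rule integral_dominated_convergence)
    show "integrable lebesgue (\<lambda>x. (dif h x)\<^sup>2)" using dif_L2_real by (simp add: L2_real_def)
    show "AE x in lebesgue. (\<lambda>n. (\<psi> n x)\<^sup>2) \<longlonglongrightarrow> (dif h x)\<^sup>2"
    proof (rule AE_I2, rule tendsto_eventually)
      fix x
      obtain N where "max (norm x) \<bar>dif h x\<bar> \<le> real N" using real_arch_simple by blast
      then show "\<forall>\<^sub>F n in sequentially. (\<psi> n x)\<^sup>2 = (dif h x)\<^sup>2"
        by (intro eventually_sequentiallyI[of N]) (auto simp: \<psi>_def S_def indicator_def)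
    qed
    show "AE x in lebesgue. norm ((\<psi> n x)\<^sup>2) \<le> (dif h x)\<^sup>2" for n
      by (auto simp: \<psi>_def indicator_def)
  qed (use m \<psi>m in auto)
  then have "(\<lambda>n. L2_norm lebesgue (\<psi> n)) \<longlonglongrightarrow> L2_norm lebesgue (dif h)"
    unfolding L2_norm_def by (rule tendsto_real_sqrt)
  then show ?thesis by (rule LIMSEQ_le_const2) (use le in auto)
qed

text \<open>For test functions this is the derivative at \<open>0\<close> of the pairing. The difference quotients are
  bounded in \<open>L\<^sup>2\<close>, so density suffices for the rest.\<close>
lemma difference_quotient_weak_limit:
  assumes \<psi>: "\<psi> \<in> borel_measurable lebesgue" "\<And>x. \<bar>\<psi> x\<bar> \<le> C * indicator (cball 0 R) x"
  shows "((\<lambda>h. (\<integral>x. dif h x * \<psi> x \<partial>lebesgue) / h) \<longlongrightarrow> (\<integral>x. G x * \<psi> x \<partial>lebesgue)) (at 0)"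
proof (rule tendstoI)
  fix \<epsilon> :: real assume "\<epsilon> > 0"
  have \<psi>L: "\<psi> \<in> L2_real lebesgue" by (rule bounded_support_L2_real[OF \<psi>])
  define K where "K = 2 * L2_norm lebesgue G + 1"
  have K: "K > 0" using L2_norm_nonneg[of lebesgue G] by (simp add: K_def)
  obtain \<phi> where \<phi>: "real_test \<phi>" and d: "L2_norm lebesgue (\<lambda>x. \<psi> x - \<phi> x) < \<epsilon> / (2 * K)"
    using tests_dense_L2[OF \<psi>, of "\<epsilon> / (2 * K)"] \<open>\<epsilon> > 0\<close> K by auto
  have \<phi>L: "\<phi> \<in> L2_real lebesgue" by (rule real_test_L2_real[OF \<phi>])
  have dL: "(\<lambda>x. \<psi> x - \<phi> x) \<in> L2_real lebesgue" by (rule L2_real_diff[OF \<psi>L \<phi>L])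
  have "((\<lambda>h. (\<integral>x. dif h x * \<phi> x \<partial>lebesgue) / h) \<longlongrightarrow> (\<integral>x. G x * \<phi> x \<partial>lebesgue)) (at 0)"
    using pairing_derivative[OF \<phi>, of 0] by (simp add: has_field_derivative_iff pairing_difference[OF \<phi>])
  then have "\<forall>\<^sub>F h in at 0. dist ((\<integral>x. dif h x * \<phi> x \<partial>lebesgue) / h) (\<integral>x. G x * \<phi> x \<partial>lebesgue) < \<epsilon> / 2"
    using \<open>\<epsilon> > 0\<close> by (intro tendstoD) auto
  moreover have "\<forall>\<^sub>F h in at (0::real). h \<noteq> 0" by (simp add: eventually_at_filter)
  ultimately show "\<forall>\<^sub>F h in at 0. dist ((\<integral>x. dif h x * \<psi> x \<partial>lebesgue) / h) (\<integral>x. G x * \<psi> x \<partial>lebesgue) < \<epsilon>"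
  proof eventually_elim
    fix h :: real
    assume 1: "dist ((\<integral>x. dif h x * \<phi> x \<partial>lebesgue) / h) (\<integral>x. G x * \<phi> x \<partial>lebesgue) < \<epsilon> / 2" and h: "h \<noteq> 0"
    let ?n = "L2_norm lebesgue (\<lambda>x. \<psi> x - \<phi> x)"
    have 2: "(\<integral>x. dif h x * \<psi> x \<partial>lebesgue) = (\<integral>x. dif h x * \<phi> x \<partial>lebesgue) + (\<integral>x. dif h x * (\<psi> x - \<phi> x) \<partial>lebesgue)"
      using L2_real_mult_integrable[OF dif_L2_real \<phi>L, of h] L2_real_mult_integrable[OF dif_L2_real \<psi>L, of h]
      by (simp add: right_diff_distrib)
    have 3: "(\<integral>x. G x * \<psi> x \<partial>lebesgue) = (\<integral>x. G x * \<phi> x \<partial>lebesgue) + (\<integral>x. G x * (\<psi> x - \<phi> x) \<partial>lebesgue)"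
      using L2_real_mult_integrable[OF G \<phi>L] L2_real_mult_integrable[OF G \<psi>L]
      by (simp add: right_diff_distrib)
    have "\<bar>\<integral>x. dif h x * (\<psi> x - \<phi> x) \<partial>lebesgue\<bar> \<le> L2_norm lebesgue (dif h) * ?n"
      by (rule Cauchy_Schwarz_L2_real[OF dif_L2_real dL])
    also have "\<dots> \<le> \<bar>h\<bar> * L2_norm lebesgue G * ?n"
      by (intro mult_right_mono L2_norm_dif_le L2_norm_nonneg)
    finally have 4: "\<bar>(\<integral>x. dif h x * (\<psi> x - \<phi> x) \<partial>lebesgue) / h\<bar> \<le> L2_norm lebesgue G * ?n"
      using h by (simp add: divide_le_eq mult_ac)
    have 5: "\<bar>\<integral>x. G x * (\<psi> x - \<phi> x) \<partial>lebesgue\<bar> \<le> L2_norm lebesgue G * ?n"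
      by (rule Cauchy_Schwarz_L2_real[OF G dL])
    have "2 * (L2_norm lebesgue G * ?n) \<le> K * ?n"
      using L2_norm_nonneg[of lebesgue "\<lambda>x. \<psi> x - \<phi> x"] by (simp add: K_def algebra_simps)
    also have "\<dots> < K * (\<epsilon> / (2 * K))" using d K by (intro mult_strict_left_mono)
    also have "\<dots> = \<epsilon> / 2" using K by simp
    finally show "dist ((\<integral>x. dif h x * \<psi> x \<partial>lebesgue) / h) (\<integral>x. G x * \<psi> x \<partial>lebesgue) < \<epsilon>"
      using 1 4 5 unfolding 2 3 add_divide_distrib dist_real_def by argo
  qed
qed

text \<open>Replacing the derivative of \<open>\<phi>\<close> by a difference quotient and shifting the difference onto
  \<open>w = sqrt (u\<^sup>2 + \<delta>\<^sup>2)\<close> leaves, to first order, the difference of \<open>u\<close> times \<open>u / w\<close>, which converges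
  weakly. The remainder is quadratic in the difference of \<open>u\<close>, hence of size \<open>h\<^sup>2\<close> in \<open>L\<^sup>1\<close>, and
  disappears after division by \<open>h\<close>.\<close>
lemma weak_partial_sqrt:
  assumes \<delta>: "\<delta> > 0"
  shows "weak_partial i (\<lambda>x. sqrt ((u x)\<^sup>2 + \<delta>\<^sup>2)) (\<lambda>x. u x / sqrt ((u x)\<^sup>2 + \<delta>\<^sup>2) * G x)"
proof -
  note um [measurable] = L2_real_measurable[OF u] and Gm [measurable] = L2_real_measurable[OF G]
  define w where "w x = sqrt ((u x)\<^sup>2 + \<delta>\<^sup>2)" for x
  have wm [measurable]: "w \<in> borel_measurable lebesgue" unfolding w_def[abs_def] by measurable
  have wpos: "w x > 0" for x unfolding w_def using \<delta> by (simp add: add_nonneg_pos)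
  have uw: "\<bar>u x\<bar> \<le> w x" for x unfolding w_def by (rule real_le_rsqrt) simp
  have w1: "locally_integrable w"
  proof (rule locally_integrable_bound[OF _ wm])
    have "locally_integrable (\<lambda>x. \<bar>u x\<bar>)"
      by (rule locally_integrable_bound[OF L2_real_locally_integrable[OF u]]) auto
    then show "locally_integrable (\<lambda>x. \<bar>u x\<bar> + \<delta>)"
      by (intro locally_integrable_add locally_integrable_const)
    have "w x \<le> \<bar>u x\<bar> + \<delta>" for x
      unfolding w_def using \<delta> by (intro real_le_lsqrt) (auto simp: power2_sum)
    then show "AE x in lebesgue. norm (w x) \<le> norm (\<bar>u x\<bar> + \<delta>)"
      using wpos \<delta> by (auto simp: less_imp_le)
  qed
  have m1: "\<bar>u x / w x\<bar> \<le> 1" for x using uw[of x] wpos[of x] by simp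
  have w2: "locally_integrable (\<lambda>x. u x / w x * G x)"
  proof (rule locally_integrable_bound[OF L2_real_locally_integrable[OF G]])
    show "AE x in lebesgue. norm (u x / w x * G x) \<le> norm (G x)"
      using mult_right_mono[OF m1, of "\<bar>G x\<bar>" for x] by (simp add: abs_mult)
  qed measurable
  have "(\<integral>x. w x * real_partial i \<phi> x \<partial>lebesgue) = - (\<integral>x. u x / w x * G x * \<phi> x \<partial>lebesgue)"
    if \<phi>: "real_test \<phi>" for \<phi>
  proof -
    obtain C R where C: "C > 0" and b: "\<And>x. \<bar>\<phi> x\<bar> \<le> C * indicator (cball 0 R) x"
      using real_test_bounded_support[OF \<phi>, of i] by metis
    have bC: "\<bar>\<phi> x\<bar> \<le> C" for x by (rule abs_le_indicator_bound[OF b C])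
    note \<phi>m [measurable] = real_test_measurable[OF \<phi>]
    note \<phi>L = real_test_L2_real[OF \<phi>]
    define \<psi> where "\<psi> x = u x / w x * \<phi> x" for x
    have \<psi>m [measurable]: "\<psi> \<in> borel_measurable lebesgue" unfolding \<psi>_def[abs_def] by measurable
    have "\<bar>\<psi> x\<bar> \<le> \<bar>\<phi> x\<bar>" for x
      using mult_right_mono[OF m1[of x], of "\<bar>\<phi> x\<bar>"] by (simp add: \<psi>_def abs_mult)
    then have \<psi>b: "\<bar>\<psi> x\<bar> \<le> C * indicator (cball 0 R) x" for x using b order_trans by blast
    have \<psi>L: "\<psi> \<in> L2_real lebesgue" by (rule bounded_support_L2_real[OF \<psi>m \<psi>b])
    define c where "c s = (\<integral>x. w x * \<phi> (x - s *\<^sub>R e) \<partial>lebesgue)" for s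
    define rem where "rem h x = w (x + h *\<^sub>R e) - w x - u x / w x * dif h x" for h x
    have remb: "\<bar>rem h x\<bar> \<le> (dif h x)\<^sup>2 / (2 * \<delta>)" for h x
      using sqrt_remainder[OF \<delta>, of "u (x + h *\<^sub>R e)" "u x"] by (simp add: rem_def w_def dif_def)
    have difm [measurable]: "dif h \<in> borel_measurable lebesgue" for h by (rule L2_real_measurable[OF dif_L2_real])
    have wsm [measurable]: "(\<lambda>x. w (x + h *\<^sub>R e)) \<in> borel_measurable lebesgue" for h
      by (rule borel_measurable_lebesgue_translation[OF wm])
    have remm [measurable]: "rem h \<in> borel_measurable lebesgue" for h unfolding rem_def[abs_def] by measurable
    have dom: "integrable lebesgue (\<lambda>x. C / (2 * \<delta>) * (dif h x)\<^sup>2)" for h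
      using dif_L2_real[of h] by (simp add: L2_real_def)
    have rb: "\<bar>rem h x * \<phi> x\<bar> \<le> C / (2 * \<delta>) * (dif h x)\<^sup>2" for h x
    proof -
      have "\<bar>rem h x\<bar> * \<bar>\<phi> x\<bar> \<le> (dif h x)\<^sup>2 / (2 * \<delta>) * C"
        using remb bC \<delta> by (intro mult_mono) auto
      then show ?thesis by (simp add: abs_mult mult_ac)
    qed
    have ri: "integrable lebesgue (\<lambda>x. rem h x * \<phi> x)" for h
      by (rule Bochner_Integration.integrable_bound[OF dom[of h]])
         (use order_trans[OF rb abs_ge_self, of h] in \<open>simp_all only: real_norm_def AE_I2 borel_measurable_times remm \<phi>m\<close>)
    have rbound: "\<bar>\<integral>x. rem h x * \<phi> x \<partial>lebesgue\<bar> \<le> C / (2 * \<delta>) * (L2_norm lebesgue G)\<^sup>2 * h\<^sup>2" for h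
    proof -
      have "\<bar>\<integral>x. rem h x * \<phi> x \<partial>lebesgue\<bar> \<le> (\<integral>x. C / (2 * \<delta>) * (dif h x)\<^sup>2 \<partial>lebesgue)"
        by (rule order_trans[OF integral_abs_bound integral_mono[OF integrable_abs[OF ri] dom rb]])
      also have "\<dots> = C / (2 * \<delta>) * (L2_norm lebesgue (dif h))\<^sup>2" by (simp add: L2_norm_power)
      also have "\<dots> \<le> C / (2 * \<delta>) * (\<bar>h\<bar> * L2_norm lebesgue G)\<^sup>2"
        using C \<delta> by (intro mult_left_mono power_mono L2_norm_dif_le L2_norm_nonneg) auto
      finally show ?thesis by (simp add: power_mult_distrib mult_ac)
    qed
    have split: "c h - c 0 = (\<integral>x. dif h x * \<psi> x \<partial>lebesgue) + (\<integral>x. rem h x * \<phi> x \<partial>lebesgue)" for h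
    proof -
      have eq: "(w (x + h *\<^sub>R e) - w x) * \<phi> x = dif h x * \<psi> x + rem h x * \<phi> x" for x
        by (simp add: rem_def \<psi>_def algebra_simps)
      have i1: "integrable lebesgue (\<lambda>x. dif h x * \<psi> x)"
        by (rule L2_real_mult_integrable[OF dif_L2_real \<psi>L])
      have iw: "integrable lebesgue (\<lambda>x. w x * \<phi> x)"
        by (rule locally_integrable_times_bounded[OF w1 \<phi>m b])
      have "integrable lebesgue (\<lambda>x. (dif h x * \<psi> x + rem h x * \<phi> x) + w x * \<phi> x)"
        using i1 ri[of h] iw by simp
      then have "integrable lebesgue (\<lambda>x. w (x + h *\<^sub>R e) * \<phi> x)"
        unfolding eq[symmetric] by (simp add: left_diff_distrib)
      from integral_difference_shift[OF w1 \<phi> this]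
      have "c h - c 0 = (\<integral>x. (w (x + h *\<^sub>R e) - w x) * \<phi> x \<partial>lebesgue)" by (simp add: c_def)
      then show ?thesis unfolding eq using i1 ri[of h] by simp
    qed
    have "((\<lambda>h. (\<integral>x. rem h x * \<phi> x \<partial>lebesgue) / h) \<longlongrightarrow> 0) (at 0)"
    proof (rule Lim_null_comparison)
      show "\<forall>\<^sub>F h in at 0. norm ((\<integral>x. rem h x * \<phi> x \<partial>lebesgue) / h) \<le> C / (2 * \<delta>) * (L2_norm lebesgue G)\<^sup>2 * \<bar>h\<bar>"
        using eventually_neq_at_within[of "0::real"]
      proof eventually_elim
        fix h :: real assume h: "h \<noteq> 0"
        have "h\<^sup>2 = \<bar>h\<bar> * \<bar>h\<bar>" by (simp add: power2_eq_square)
        then show "norm ((\<integral>x. rem h x * \<phi> x \<partial>lebesgue) / h) \<le> C / (2 * \<delta>) * (L2_norm lebesgue G)\<^sup>2 * \<bar>h\<bar>"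
          using rbound[of h] h by (simp add: divide_le_eq mult.assoc)
      qed
      have "((\<lambda>h::real. C / (2 * \<delta>) * (L2_norm lebesgue G)\<^sup>2 * \<bar>h\<bar>) \<longlongrightarrow> C / (2 * \<delta>) * (L2_norm lebesgue G)\<^sup>2 * \<bar>0\<bar>) (at 0)"
        by (intro tendsto_intros)
      then show "((\<lambda>h::real. C / (2 * \<delta>) * (L2_norm lebesgue G)\<^sup>2 * \<bar>h\<bar>) \<longlongrightarrow> 0) (at 0)" by simp
    qed
    from tendsto_add[OF difference_quotient_weak_limit[OF \<psi>m \<psi>b] this]
    have "((\<lambda>h. (c h - c 0) / (h - 0)) \<longlongrightarrow> (\<integral>x. G x * \<psi> x \<partial>lebesgue)) (at 0)"
      by (simp add: split add_divide_distrib)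
    moreover have "((\<lambda>h. (c h - c 0) / (h - 0)) \<longlongrightarrow> - (\<integral>x. w x * real_partial i \<phi> x \<partial>lebesgue)) (at 0)"
      using integral_line_derivative[OF w1 \<phi>, of i 0] by (simp add: has_field_derivative_iff c_def)
    ultimately have "(\<integral>x. G x * \<psi> x \<partial>lebesgue) = - (\<integral>x. w x * real_partial i \<phi> x \<partial>lebesgue)"
      by (rule tendsto_unique[rotated]) simp
    then show ?thesis by (simp add: \<psi>_def mult_ac)
  qed
  with w1 w2 have "weak_partial i w (\<lambda>x. u x / w x * G x)" unfolding weak_partial_def by blast
  then show ?thesis unfolding w_def[abs_def] .
qed

text \<open>Let \<open>\<delta>\<close> tend to \<open>0\<close> in \<open>weak_partial_sqrt\<close>. On \<open>{u = 0}\<close> the limit of \<open>u / sqrt (u\<^sup>2 + \<delta>\<^sup>2)\<close> is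
  \<open>0\<close>, the value of \<open>sgn\<close> there.\<close>
lemma weak_partial_abs: "weak_partial i (\<lambda>x. \<bar>u x\<bar>) (\<lambda>x. sgn (u x) * G x)"
  unfolding weak_partial_def
proof (intro conjI allI impI)
  note um [measurable] = L2_real_measurable[OF u] and Gm [measurable] = L2_real_measurable[OF G]
  show "locally_integrable (\<lambda>x. \<bar>u x\<bar>)"
    by (rule locally_integrable_bound[OF L2_real_locally_integrable[OF u]]) auto
  show "locally_integrable (\<lambda>x. sgn (u x) * G x)"
    by (rule locally_integrable_bound[OF L2_real_locally_integrable[OF G]]) (auto simp: sgn_real_def)
  fix \<phi> :: "real^'n \<Rightarrow> real" assume \<phi>: "real_test \<phi>"
  define \<delta> where "\<delta> n = inverse (real (Suc n))" for n
  have \<delta>: "\<delta> n > 0" "\<delta> n \<le> 1" for n by (auto simp: \<delta>_def inverse_le_1_iff)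
  have \<delta>l: "\<delta> \<longlonglongrightarrow> 0" unfolding \<delta>_def by (rule LIMSEQ_inverse_real_of_nat)
  define w where "w n x = sqrt ((u x)\<^sup>2 + (\<delta> n)\<^sup>2)" for n x
  have wm [measurable]: "w n \<in> borel_measurable lebesgue" for n unfolding w_def[abs_def] by measurable
  have wpos: "w n x > 0" for n x unfolding w_def using \<delta>[of n] by (simp add: add_nonneg_pos)
  have uw: "\<bar>u x\<bar> \<le> w n x" for n x unfolding w_def by (rule real_le_rsqrt) simp
  have wu: "w n x \<le> \<bar>u x\<bar> + 1" for n x
  proof -
    have "w n x \<le> \<bar>u x\<bar> + \<delta> n"
      unfolding w_def using \<delta>(1)[of n] by (intro real_le_lsqrt) (auto simp: power2_sum)
    then show ?thesis using \<delta>(2)[of n] by simp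
  qed
  have wl: "(\<lambda>n. w n x) \<longlonglongrightarrow> \<bar>u x\<bar>" for x
  proof -
    have "(\<lambda>n. w n x) \<longlonglongrightarrow> sqrt ((u x)\<^sup>2 + 0\<^sup>2)" unfolding w_def by (intro tendsto_intros \<delta>l)
    then show ?thesis by simp
  qed
  have ul: "(\<lambda>n. u x / w n x) \<longlonglongrightarrow> sgn (u x)" for x
  proof (cases "u x = 0")
    case False
    then have "(\<lambda>n. u x / w n x) \<longlonglongrightarrow> u x / \<bar>u x\<bar>" by (intro tendsto_intros wl) simp
    then show ?thesis by (simp add: sgn_real_def abs_if split: if_splits)
  qed simp
  have m1: "\<bar>u x / w n x\<bar> \<le> 1" for n x using uw[of x n] wpos[of n x] by simp
  obtain C R where C: "C > 0" and b: "\<And>x. \<bar>\<phi> x\<bar> \<le> C * indicator (cball 0 R) x"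
      "\<And>x. \<bar>real_partial i \<phi> x\<bar> \<le> C * indicator (cball 0 R) x" and rm [measurable]: "real_partial i \<phi> \<in> borel_measurable lebesgue"
    using real_test_bounded_support[OF \<phi>, of i] by metis
  note \<phi>m [measurable] = real_test_measurable[OF \<phi>]
  have u1: "locally_integrable (\<lambda>x. \<bar>u x\<bar> + 1)"
    by (intro locally_integrable_add locally_integrable_const
        locally_integrable_bound[OF L2_real_locally_integrable[OF u]]) auto
  have L: "(\<lambda>n. \<integral>x. w n x * real_partial i \<phi> x \<partial>lebesgue) \<longlonglongrightarrow> (\<integral>x. \<bar>u x\<bar> * real_partial i \<phi> x \<partial>lebesgue)"
  proof (rule integral_dominated_convergence)
    show "integrable lebesgue (\<lambda>x. \<bar>(\<bar>u x\<bar> + 1) * real_partial i \<phi> x\<bar>)"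
      by (intro integrable_abs locally_integrable_times_bounded[OF u1 rm b(2)])
    show "AE x in lebesgue. norm (w n x * real_partial i \<phi> x) \<le> \<bar>(\<bar>u x\<bar> + 1) * real_partial i \<phi> x\<bar>" for n
      using wu[of n] wpos[of n] by (auto simp: abs_mult less_imp_le intro!: always_eventually mult_right_mono)
    show "AE x in lebesgue. (\<lambda>n. w n x * real_partial i \<phi> x) \<longlonglongrightarrow> \<bar>u x\<bar> * real_partial i \<phi> x"
      by (intro always_eventually allI tendsto_intros wl)
  qed auto
  have "(\<lambda>n. \<integral>x. u x / w n x * G x * \<phi> x \<partial>lebesgue) \<longlonglongrightarrow> (\<integral>x. sgn (u x) * G x * \<phi> x \<partial>lebesgue)"
  proof (rule integral_dominated_convergence)
    show "integrable lebesgue (\<lambda>x. \<bar>G x * \<phi> x\<bar>)"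
      by (intro integrable_abs locally_integrable_times_bounded[OF L2_real_locally_integrable[OF G] \<phi>m b(1)])
    show "AE x in lebesgue. norm (u x / w n x * G x * \<phi> x) \<le> \<bar>G x * \<phi> x\<bar>" for n
    proof (intro always_eventually allI)
      fix x
      show "norm (u x / w n x * G x * \<phi> x) \<le> \<bar>G x * \<phi> x\<bar>"
        using mult_right_mono[OF m1[of x n], of "\<bar>G x * \<phi> x\<bar>"] by (simp add: abs_mult mult_ac)
    qed
    show "AE x in lebesgue. (\<lambda>n. u x / w n x * G x * \<phi> x) \<longlonglongrightarrow> sgn (u x) * G x * \<phi> x"
      by (intro always_eventually allI tendsto_mult tendsto_const ul)
  qed auto
  from tendsto_minus[OF this] have "(\<lambda>n. \<integral>x. w n x * real_partial i \<phi> x \<partial>lebesgue) \<longlonglongrightarrow> - (\<integral>x. sgn (u x) * G x * \<phi> x \<partial>lebesgue)"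
    using weak_partial_sqrt[OF \<delta>(1)] \<phi> by (simp add: weak_partial_def w_def)
  with L show "(\<integral>x. \<bar>u x\<bar> * real_partial i \<phi> x \<partial>lebesgue) = - (\<integral>x. sgn (u x) * G x * \<phi> x \<partial>lebesgue)"
    by (rule LIMSEQ_unique)
qed

end

section \<open>Complex square integrable functions\<close>

lemma borel_measurable_cnj [measurable (raw)]:
  "f \<in> borel_measurable M \<Longrightarrow> (\<lambda>x. cnj (f x)) \<in> borel_measurable M"
  unfolding borel_measurable_complex_iff by simp

lemma L2_measurable: "f \<in> L2 M \<Longrightarrow> f \<in> borel_measurable M"
  by (simp add: L2_def)

lemma L2_iff: "f \<in> L2 M \<longleftrightarrow> (\<lambda>x. Re (f x)) \<in> L2_real M \<and> (\<lambda>x. Im (f x)) \<in> L2_real M"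
proof
  assume f: "f \<in> L2 M"
  then have m [measurable]: "f \<in> borel_measurable M" and i: "integrable M (\<lambda>x. (cmod (f x))\<^sup>2)"
    by (auto simp: L2_def)
  have "integrable M (\<lambda>x. (Re (f x))\<^sup>2)"
    by (rule Bochner_Integration.integrable_bound[OF i]) (auto simp: cmod_power2)
  moreover have "integrable M (\<lambda>x. (Im (f x))\<^sup>2)"
    by (rule Bochner_Integration.integrable_bound[OF i]) (auto simp: cmod_power2)
  ultimately show "(\<lambda>x. Re (f x)) \<in> L2_real M \<and> (\<lambda>x. Im (f x)) \<in> L2_real M"
    by (simp add: L2_real_def)
next
  assume *: "(\<lambda>x. Re (f x)) \<in> L2_real M \<and> (\<lambda>x. Im (f x)) \<in> L2_real M"
  then have "f \<in> borel_measurable M"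
    unfolding borel_measurable_complex_iff by (auto simp: L2_real_def)
  moreover have "integrable M (\<lambda>x. (cmod (f x))\<^sup>2)"
    using * by (simp add: L2_real_def cmod_power2)
  ultimately show "f \<in> L2 M" by (simp add: L2_def)
qed

lemma L2_of_real_iff: "(\<lambda>x. complex_of_real (f x)) \<in> L2 M \<longleftrightarrow> f \<in> L2_real M"
  by (simp add: L2_iff) (simp add: L2_real_def)

lemma L2_mult_integrable:
  assumes "f \<in> L2 M" "g \<in> L2 M"
  shows "integrable M (\<lambda>x. f x * g x)" "integrable M (\<lambda>x. f x * cnj (g x))"
proof -
  have n: "(\<lambda>x. cmod (f x)) \<in> L2_real M" "(\<lambda>x. cmod (g x)) \<in> L2_real M"
    using assms by (auto simp: L2_real_def L2_def)
  have m: "f \<in> borel_measurable M" "g \<in> borel_measurable M" using assms by (auto simp: L2_def)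
  show "integrable M (\<lambda>x. f x * g x)"
    by (rule Bochner_Integration.integrable_bound[OF L2_real_mult_integrable[OF n]])
       (use m in \<open>auto simp: norm_mult\<close>)
  show "integrable M (\<lambda>x. f x * cnj (g x))"
    by (rule Bochner_Integration.integrable_bound[OF L2_real_mult_integrable[OF n]])
       (use m in \<open>auto simp: norm_mult intro!: borel_measurable_times borel_measurable_cnj\<close>)
qed

lemma L2_bound:
  assumes "f \<in> L2 M" "g \<in> borel_measurable M" "AE x in M. cmod (g x) \<le> C * cmod (f x)"
  shows "g \<in> L2 M"
proof -
  have "integrable M (\<lambda>x. (cmod (g x))\<^sup>2)"
  proof (rule Bochner_Integration.integrable_bound)
    show "integrable M (\<lambda>x. C\<^sup>2 * (cmod (f x))\<^sup>2)" using assms(1) by (simp add: L2_def)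
    show "AE x in M. norm ((cmod (g x))\<^sup>2) \<le> norm (C\<^sup>2 * (cmod (f x))\<^sup>2)"
      using assms(3)
    proof eventually_elim
      fix x assume "cmod (g x) \<le> C * cmod (f x)"
      then have "(cmod (g x))\<^sup>2 \<le> (C * cmod (f x))\<^sup>2" by (intro power_mono) auto
      then show "norm ((cmod (g x))\<^sup>2) \<le> norm (C\<^sup>2 * (cmod (f x))\<^sup>2)"
        by (simp add: power_mult_distrib)
    qed
  qed (use assms(2) in measurable)
  then show ?thesis using assms(2) by (simp add: L2_def)
qed

lemma L2_lincomb:
  assumes f: "f \<in> L2 M" and g: "g \<in> L2 M"
  shows "(\<lambda>x. c * f x + d * g x) \<in> L2 M"
proof -
  have n: "(\<lambda>x. cmod (f x)) \<in> L2_real M" "(\<lambda>x. cmod (g x)) \<in> L2_real M"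
    using assms by (auto simp: L2_real_def L2_def)
  from L2_real_lincomb[OF n, of "cmod c" "cmod d"]
  have "(\<lambda>x. complex_of_real (cmod c * cmod (f x) + cmod d * cmod (g x))) \<in> L2 M"
    unfolding L2_of_real_iff .
  then show ?thesis
  proof (rule L2_bound[where C = 1])
    show "(\<lambda>x. c * f x + d * g x) \<in> borel_measurable M" using f g by (auto simp: L2_def)
    show "AE x in M. cmod (c * f x + d * g x) \<le> 1 * cmod (complex_of_real (cmod c * cmod (f x) + cmod d * cmod (g x)))"
    proof (intro AE_I2)
      fix x
      have "cmod (c * f x + d * g x) \<le> cmod c * cmod (f x) + cmod d * cmod (g x)"
        using norm_triangle_ineq[of "c * f x" "d * g x"] by (simp add: norm_mult)
      also have "\<dots> \<le> \<bar>cmod c * cmod (f x) + cmod d * cmod (g x)\<bar>" by simp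
      finally show "cmod (c * f x + d * g x) \<le> 1 * cmod (complex_of_real (cmod c * cmod (f x) + cmod d * cmod (g x)))"
        by (simp only: norm_of_real mult_1)
    qed
  qed
qed

lemma inner_L2_self: "inner_L2 M f f = complex_of_real (\<integral>x. (cmod (f x))\<^sup>2 \<partial>M)"
proof -
  have "(\<lambda>x. f x * cnj (f x)) = (\<lambda>x. complex_of_real ((cmod (f x))\<^sup>2))"
    by (simp add: complex_norm_square fun_eq_iff del: of_real_power)
  then show ?thesis unfolding inner_L2_def by (simp only: integral_complex_of_real)
qed

section \<open>Weak gradients\<close>

lemma locally_integrable_sum:
  fixes f :: "'i \<Rightarrow> 'a::euclidean_space \<Rightarrow> 'b::{banach, second_countable_topology}"
  assumes "finite I" "\<And>i. i \<in> I \<Longrightarrow> locally_integrable (f i)"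
  shows "locally_integrable (\<lambda>x. \<Sum>i\<in>I. f i x)"
  using assms
proof induction
  case empty
  show ?case by (rule locally_integrableI_cball) simp
qed (auto intro: locally_integrable_add)

lemma locally_integrable_vec:
  fixes g :: "'n::finite \<Rightarrow> 'a::euclidean_space \<Rightarrow> complex"
  assumes "\<And>i. locally_integrable (g i)"
  shows "locally_integrable (\<lambda>x. \<chi> i. g i x)"
proof -
  have "bounded_linear (\<lambda>c. axis i c :: complex^'n)" for i
    by (intro linear_conv_bounded_linear[THEN iffD1] linearI) (auto simp: axis_def vec_eq_iff)
  then have "locally_integrable (\<lambda>x. \<Sum>i\<in>UNIV. axis i (g i x) :: complex^'n)"
    by (intro locally_integrable_sum locally_integrable_bounded_linear[OF _ assms]) auto
  moreover have "(\<Sum>i\<in>UNIV. axis i (g i x)) = (\<chi> i. g i x)" for x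
    by (simp add: vec_eq_iff sum_component axis_def)
  ultimately show ?thesis by simp
qed

lemma locally_integrable_nth:
  fixes G :: "'a::euclidean_space \<Rightarrow> complex^'n"
  assumes "locally_integrable G"
  shows "locally_integrable (\<lambda>x. G x $ i)"
  by (rule locally_integrable_bounded_linear[OF bounded_linear_vec_nth assms])

lemma integrable_times_real:
  fixes u :: "'a::euclidean_space \<Rightarrow> complex"
  assumes u: "locally_integrable u" and \<psi>: "\<psi> \<in> borel_measurable lebesgue" "\<And>x. \<bar>\<psi> x\<bar> \<le> C * indicator (cball 0 R) x"
  shows "integrable lebesgue (\<lambda>x. u x * complex_of_real (\<psi> x))"
proof (rule Bochner_Integration.integrable_bound)
  have "locally_integrable (\<lambda>x. cmod (u x))"
    by (rule locally_integrable_bound[OF u]) (use locally_integrable_measurable[OF u] in auto)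
  then show "integrable lebesgue (\<lambda>x. cmod (u x) * \<psi> x)"
    by (rule locally_integrable_times_bounded[OF _ \<psi>])
  show "(\<lambda>x. u x * complex_of_real (\<psi> x)) \<in> borel_measurable lebesgue"
    using locally_integrable_measurable[OF u] \<psi>(1) by simp
qed (simp add: norm_mult abs_mult)

lemma test_integrable:
  fixes u :: "real^'n::finite \<Rightarrow> complex"
  assumes u: "locally_integrable u" and \<phi>: "real_test \<phi>"
  shows "integrable lebesgue (\<lambda>x. u x * complex_of_real (\<phi> x))"
    and "integrable lebesgue (\<lambda>x. u x * complex_of_real (real_partial i \<phi> x))"
proof -
  obtain C R where b: "\<And>x. \<bar>\<phi> x\<bar> \<le> C * indicator (cball 0 R) x" "\<And>x. \<bar>real_partial i \<phi> x\<bar> \<le> C * indicator (cball 0 R) x"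
      "real_partial i \<phi> \<in> borel_measurable lebesgue"
    using real_test_bounded_support[OF \<phi>, of i] by metis
  show "integrable lebesgue (\<lambda>x. u x * complex_of_real (\<phi> x))"
    by (rule integrable_times_real[OF u real_test_measurable[OF \<phi>] b(1)])
  show "integrable lebesgue (\<lambda>x. u x * complex_of_real (real_partial i \<phi> x))"
    by (rule integrable_times_real[OF u b(3,2)])
qed

lemma test_function_Re_Im:
  assumes \<phi>: "test_function \<phi>"
  shows "real_test (\<lambda>x. Re (\<phi> x))" "real_test (\<lambda>x. Im (\<phi> x))"
    and "partial_deriv i \<phi> x = complex_of_real (real_partial i (\<lambda>x. Re (\<phi> x)) x) + \<i> * complex_of_real (real_partial i (\<lambda>x. Im (\<phi> x)) x)"
proof -
  obtain K where K: "compact K" "\<And>x. x \<notin> K \<Longrightarrow> \<phi> x = 0" and s: "smooth_fun \<phi>"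
    using \<phi> unfolding test_function_def by auto
  have bl: "bounded_linear (\<lambda>z. complex_of_real (Re z))" "bounded_linear (\<lambda>z. complex_of_real (Im z))"
    by (intro bounded_linear_compose[OF bounded_linear_of_real] bounded_linear_Re bounded_linear_Im)+
  show R: "real_test (\<lambda>x. Re (\<phi> x))" and I: "real_test (\<lambda>x. Im (\<phi> x))"
    unfolding real_test_def test_function_def
    using smooth_fun_bounded_linear[OF bl(1) s] smooth_fun_bounded_linear[OF bl(2) s] K
    by (auto intro!: exI[of _ K])
  have d: "\<phi> differentiable (at x)" by (rule smooth_fun_differentiable[OF s])
  have "Re (partial_deriv i \<phi> x) = real_partial i (\<lambda>x. Re (\<phi> x)) x"
    using partial_deriv_bounded_linear[OF bl(1) d, of i] real_test_of_real_real_partial(1)[OF R, of i x]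
    by (simp only: of_real_eq_iff)
  moreover have "Im (partial_deriv i \<phi> x) = real_partial i (\<lambda>x. Im (\<phi> x)) x"
    using partial_deriv_bounded_linear[OF bl(2) d, of i] real_test_of_real_real_partial(1)[OF I, of i x]
    by (simp only: of_real_eq_iff)
  ultimately show "partial_deriv i \<phi> x = complex_of_real (real_partial i (\<lambda>x. Re (\<phi> x)) x) + \<i> * complex_of_real (real_partial i (\<lambda>x. Im (\<phi> x)) x)"
    by (simp add: complex_eq_iff)
qed

text \<open>Complex test functions enter the definition of a weak gradient linearly, so their real and
  imaginary parts can be tested separately.\<close>
lemma has_weak_gradient_iff_real_tests:
  fixes u :: "real^'n::finite \<Rightarrow> complex"
  shows "has_weak_gradient u G \<longleftrightarrow> locally_integrable u \<and> locally_integrable G \<and>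
     (\<forall>\<phi> i. real_test \<phi> \<longrightarrow> (\<integral>x. u x * complex_of_real (real_partial i \<phi> x) \<partial>lebesgue) =
         - (\<integral>x. G x $ i * complex_of_real (\<phi> x) \<partial>lebesgue))" (is "?L \<longleftrightarrow> ?R")
proof
  assume L: ?L
  have "(\<integral>x. u x * complex_of_real (real_partial i \<phi> x) \<partial>lebesgue) = - (\<integral>x. G x $ i * complex_of_real (\<phi> x) \<partial>lebesgue)"
    if \<phi>: "real_test \<phi>" for \<phi> i
  proof -
    have "(\<integral>x. u x * partial_deriv i (\<lambda>x. complex_of_real (\<phi> x)) x \<partial>lebesgue) =
        - (\<integral>x. G x $ i * complex_of_real (\<phi> x) \<partial>lebesgue)"
      using L \<phi> unfolding has_weak_gradient_def real_test_def by blast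
    then show ?thesis by (simp add: real_test_of_real_real_partial(1)[OF \<phi>])
  qed
  then show ?R using L unfolding has_weak_gradient_def by blast
next
  assume R: ?R
  then have u: "locally_integrable u" and G: "locally_integrable G" by auto
  have "(\<integral>x. u x * partial_deriv i \<phi> x \<partial>lebesgue) = - (\<integral>x. G x $ i * \<phi> x \<partial>lebesgue)"
    if \<phi>: "test_function \<phi>" for \<phi> i
  proof -
    note r = test_function_Re_Im[OF \<phi>]
    note Gi = locally_integrable_nth[OF G, of i]
    have "(\<integral>x. u x * partial_deriv i \<phi> x \<partial>lebesgue) =
      (\<integral>x. u x * complex_of_real (real_partial i (\<lambda>x. Re (\<phi> x)) x) + \<i> * (u x * complex_of_real (real_partial i (\<lambda>x. Im (\<phi> x)) x)) \<partial>lebesgue)"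
      unfolding r(3) by (simp add: algebra_simps)
    also have "\<dots> = (\<integral>x. u x * complex_of_real (real_partial i (\<lambda>x. Re (\<phi> x)) x) \<partial>lebesgue) +
        \<i> * (\<integral>x. u x * complex_of_real (real_partial i (\<lambda>x. Im (\<phi> x)) x) \<partial>lebesgue)"
      using test_integrable(2)[OF u r(1), of i] test_integrable(2)[OF u r(2), of i] by simp
    also have "\<dots> = - ((\<integral>x. G x $ i * complex_of_real (Re (\<phi> x)) \<partial>lebesgue) +
        \<i> * (\<integral>x. G x $ i * complex_of_real (Im (\<phi> x)) \<partial>lebesgue))"
      using R r(1,2) by (simp add: algebra_simps)
    also have "(\<integral>x. G x $ i * complex_of_real (Re (\<phi> x)) \<partial>lebesgue) + \<i> * (\<integral>x. G x $ i * complex_of_real (Im (\<phi> x)) \<partial>lebesgue)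
       = (\<integral>x. G x $ i * complex_of_real (Re (\<phi> x)) + \<i> * (G x $ i * complex_of_real (Im (\<phi> x))) \<partial>lebesgue)"
      using test_integrable(1)[OF Gi r(1)] test_integrable(1)[OF Gi r(2)] by simp
    also have "(\<lambda>x. G x $ i * complex_of_real (Re (\<phi> x)) + \<i> * (G x $ i * complex_of_real (Im (\<phi> x)))) = (\<lambda>x. G x $ i * \<phi> x)"
      by (auto simp: complex_eq_iff algebra_simps)
    finally show ?thesis .
  qed
  then show ?L using u G unfolding has_weak_gradient_def by blast
qed

lemma has_weak_gradient_Re_Im:
  assumes "has_weak_gradient u G"
  shows "weak_partial i (\<lambda>x. Re (u x)) (\<lambda>x. Re (G x $ i))" "weak_partial i (\<lambda>x. Im (u x)) (\<lambda>x. Im (G x $ i))"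
proof -
  have u: "locally_integrable u" and G: "locally_integrable G" and
    eq: "\<And>\<phi>. real_test \<phi> \<Longrightarrow> (\<integral>x. u x * complex_of_real (real_partial i \<phi> x) \<partial>lebesgue) =
         - (\<integral>x. G x $ i * complex_of_real (\<phi> x) \<partial>lebesgue)"
    using assms unfolding has_weak_gradient_iff_real_tests by blast+
  note Gi = locally_integrable_nth[OF G, of i]
  have *: "(\<integral>x. Re (u x) * real_partial i \<phi> x \<partial>lebesgue) = - (\<integral>x. Re (G x $ i) * \<phi> x \<partial>lebesgue)"
    "(\<integral>x. Im (u x) * real_partial i \<phi> x \<partial>lebesgue) = - (\<integral>x. Im (G x $ i) * \<phi> x \<partial>lebesgue)" if \<phi>: "real_test \<phi>" for \<phi>
    using arg_cong[OF eq[OF \<phi>], of Re] arg_cong[OF eq[OF \<phi>], of Im]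
      integral_Re[OF test_integrable(2)[OF u \<phi>, of i]] integral_Im[OF test_integrable(2)[OF u \<phi>, of i]]
      integral_Re[OF test_integrable(1)[OF Gi \<phi>]] integral_Im[OF test_integrable(1)[OF Gi \<phi>]]
    by simp_all
  show "weak_partial i (\<lambda>x. Re (u x)) (\<lambda>x. Re (G x $ i))" "weak_partial i (\<lambda>x. Im (u x)) (\<lambda>x. Im (G x $ i))"
    unfolding weak_partial_def
    using * locally_integrable_bounded_linear[OF bounded_linear_Re u] locally_integrable_bounded_linear[OF bounded_linear_Im u]
      locally_integrable_bounded_linear[OF bounded_linear_Re Gi] locally_integrable_bounded_linear[OF bounded_linear_Im Gi]
    by blast+
qed

lemma has_weak_gradient_of_real:
  fixes u :: "real^'n::finite \<Rightarrow> real" and g :: "'n \<Rightarrow> real^'n \<Rightarrow> real"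
  assumes w: "\<And>i. weak_partial i u (g i)"
  shows "has_weak_gradient (\<lambda>x. complex_of_real (u x)) (\<lambda>x. \<chi> i. complex_of_real (g i x))"
  unfolding has_weak_gradient_iff_real_tests
proof (intro conjI allI impI)
  show "locally_integrable (\<lambda>x. complex_of_real (u x))"
    using w locally_integrable_bounded_linear[OF bounded_linear_of_real] unfolding weak_partial_def by blast
  show "locally_integrable (\<lambda>x. \<chi> i. complex_of_real (g i x))"
    using w locally_integrable_bounded_linear[OF bounded_linear_of_real] unfolding weak_partial_def
    by (intro locally_integrable_vec) blast
  fix \<phi> :: "real^'n \<Rightarrow> real" and i assume \<phi>: "real_test \<phi>"
  show "(\<integral>x. complex_of_real (u x) * complex_of_real (real_partial i \<phi> x) \<partial>lebesgue) =
        - (\<integral>x. (\<chi> i. complex_of_real (g i x)) $ i * complex_of_real (\<phi> x) \<partial>lebesgue)"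
    using w[of i] \<phi> by (simp add: weak_partial_def flip: of_real_mult)
qed

lemma has_weak_gradient_lincomb:
  fixes u v :: "real^'n::finite \<Rightarrow> complex"
  assumes "has_weak_gradient u G" "has_weak_gradient v H"
  shows "has_weak_gradient (\<lambda>x. c * u x + d * v x) (\<lambda>x. \<chi> i. c * G x $ i + d * H x $ i)"
  unfolding has_weak_gradient_iff_real_tests
proof (intro conjI allI impI)
  have u: "locally_integrable u" and G: "locally_integrable G" and v: "locally_integrable v" and H: "locally_integrable H"
    using assms unfolding has_weak_gradient_def by auto
  have l: "locally_integrable (\<lambda>x. c * f x + d * g x)" if "locally_integrable f" "locally_integrable g"
    for f g :: "real^'n \<Rightarrow> complex"
    using that by (intro locally_integrable_add locally_integrable_bounded_linear[OF bounded_linear_mult_right])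
  show "locally_integrable (\<lambda>x. c * u x + d * v x)" by (rule l[OF u v])
  show "locally_integrable (\<lambda>x. \<chi> i. c * G x $ i + d * H x $ i)"
    by (intro locally_integrable_vec l locally_integrable_nth G H)
  fix \<phi> :: "real^'n \<Rightarrow> real" and i assume \<phi>: "real_test \<phi>"
  have "(\<integral>x. (c * u x + d * v x) * complex_of_real (real_partial i \<phi> x) \<partial>lebesgue) =
     (\<integral>x. c * (u x * complex_of_real (real_partial i \<phi> x)) + d * (v x * complex_of_real (real_partial i \<phi> x)) \<partial>lebesgue)"
    by (simp add: algebra_simps)
  also have "\<dots> = c * (\<integral>x. u x * complex_of_real (real_partial i \<phi> x) \<partial>lebesgue) + d * (\<integral>x. v x * complex_of_real (real_partial i \<phi> x) \<partial>lebesgue)"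
    using test_integrable(2)[OF u \<phi>, of i] test_integrable(2)[OF v \<phi>, of i] by simp
  also have "\<dots> = - (c * (\<integral>x. G x $ i * complex_of_real (\<phi> x) \<partial>lebesgue) + d * (\<integral>x. H x $ i * complex_of_real (\<phi> x) \<partial>lebesgue))"
    using assms \<phi> unfolding has_weak_gradient_iff_real_tests by simp
  also have "c * (\<integral>x. G x $ i * complex_of_real (\<phi> x) \<partial>lebesgue) + d * (\<integral>x. H x $ i * complex_of_real (\<phi> x) \<partial>lebesgue)
     = (\<integral>x. c * (G x $ i * complex_of_real (\<phi> x)) + d * (H x $ i * complex_of_real (\<phi> x)) \<partial>lebesgue)"
    using test_integrable(1)[OF locally_integrable_nth[OF G] \<phi>, of i] test_integrable(1)[OF locally_integrable_nth[OF H] \<phi>, of i] by simp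
  finally show "(\<integral>x. (c * u x + d * v x) * complex_of_real (real_partial i \<phi> x) \<partial>lebesgue) =
      - (\<integral>x. (\<chi> i. c * G x $ i + d * H x $ i) $ i * complex_of_real (\<phi> x) \<partial>lebesgue)"
    by (simp add: algebra_simps)
qed

lemma weak_partial_unique:
  fixes u :: "real^'n::finite \<Rightarrow> real"
  assumes "weak_partial i u g" "weak_partial i u h"
  shows "AE x in lebesgue. g x = h x"
proof -
  have g: "locally_integrable g" and h: "locally_integrable h"
    using assms unfolding weak_partial_def by auto
  have "AE x in lebesgue. g x + - h x = 0"
  proof (rule locally_integrable_zero_if_orthogonal_to_tests)
    show "locally_integrable (\<lambda>x. g x + - h x)"
      by (intro locally_integrable_add g locally_integrable_bounded_linear[OF bounded_linear_minus[OF bounded_linear_ident] h])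
    fix \<phi> :: "real^'n \<Rightarrow> real" assume \<phi>: "real_test \<phi>"
    obtain C R where b: "\<And>x. \<bar>\<phi> x\<bar> \<le> C * indicator (cball 0 R) x"
      using real_test_bounded_support[OF \<phi>, of i] by metis
    have "integrable lebesgue (\<lambda>x. g x * \<phi> x)" "integrable lebesgue (\<lambda>x. h x * \<phi> x)"
      by (intro locally_integrable_times_bounded[OF _ real_test_measurable[OF \<phi>] b] g h)+
    moreover have "(\<integral>x. g x * \<phi> x \<partial>lebesgue) = (\<integral>x. h x * \<phi> x \<partial>lebesgue)"
      using assms \<phi> unfolding weak_partial_def by (metis neg_equal_iff_equal)
    ultimately show "(\<integral>x. (g x + - h x) * \<phi> x \<partial>lebesgue) = 0"
      by (simp add: left_diff_distrib)
  qed
  then show ?thesis by eventually_elim simp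
qed

text \<open>Uniqueness makes the chosen gradient in the definition of the form replaceable by any other
  weak gradient.\<close>
lemma has_weak_gradient_unique:
  fixes u :: "real^'n::finite \<Rightarrow> complex"
  assumes "has_weak_gradient u G" "has_weak_gradient u H"
  shows "AE x in lebesgue. G x = H x"
proof -
  have "AE x in lebesgue. \<forall>i\<in>UNIV. G x $ i = H x $ i"
  proof (rule AE_finite_allI)
    fix i
    show "AE x in lebesgue. G x $ i = H x $ i"
      using weak_partial_unique[OF has_weak_gradient_Re_Im(1)[OF assms(1)] has_weak_gradient_Re_Im(1)[OF assms(2)], of i]
        weak_partial_unique[OF has_weak_gradient_Re_Im(2)[OF assms(1)] has_weak_gradient_Re_Im(2)[OF assms(2)], of i]
      by eventually_elim (simp add: complex_eq_iff)
  qed simp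
  then show ?thesis by eventually_elim (simp add: vec_eq_iff)
qed

section \<open>The form and positivity of the resolvent\<close>

text \<open>The weak gradients that witness membership in the form domain.\<close>
definition gradient_L2 :: "(real^'n \<Rightarrow> complex) \<Rightarrow> (real^'n \<Rightarrow> complex^'n) \<Rightarrow> bool" where
  "gradient_L2 u G \<longleftrightarrow> has_weak_gradient u G \<and> (\<forall>i. (\<lambda>x. G x $ i) \<in> L2 lebesgue)"

lemma form_dom_gradient:
  assumes "u \<in> form_dom V"
  obtains G where "gradient_L2 u G"
  using assms unfolding form_dom_def gradient_L2_def by blast

lemma form_domI:
  assumes "u \<in> L2 lebesgue" "gradient_L2 u G" "(\<lambda>x. complex_of_real (sqrt (V x)) * u x) \<in> L2 lebesgue"
  shows "u \<in> form_dom V"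
  using assms unfolding form_dom_def gradient_L2_def by blast

lemma form_dom_L2:
  assumes "u \<in> form_dom V"
  shows "u \<in> L2 lebesgue" "(\<lambda>x. complex_of_real (sqrt (V x)) * u x) \<in> L2 lebesgue"
  using assms unfolding form_dom_def by auto

lemma gradient_L2_lincomb:
  assumes "gradient_L2 u G" "gradient_L2 v H"
  shows "gradient_L2 (\<lambda>x. c * u x + d * v x) (\<lambda>x. \<chi> i. c * G x $ i + d * H x $ i)"
  using assms has_weak_gradient_lincomb[of u G v H c d]
  unfolding gradient_L2_def by (simp add: L2_lincomb)

lemma form_dom_lincomb:
  assumes u: "u \<in> form_dom V" and v: "v \<in> form_dom V"
  shows "(\<lambda>x. c * u x + d * v x) \<in> form_dom V"
proof -
  obtain G H where "gradient_L2 u G" "gradient_L2 v H"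
    using form_dom_gradient[OF u] form_dom_gradient[OF v] by metis
  from gradient_L2_lincomb[OF this, of c d] show ?thesis
  proof (rule form_domI[rotated])
    show "(\<lambda>x. c * u x + d * v x) \<in> L2 lebesgue"
      by (intro L2_lincomb form_dom_L2(1)[OF u] form_dom_L2(1)[OF v])
    have "(\<lambda>x. c * (complex_of_real (sqrt (V x)) * u x) + d * (complex_of_real (sqrt (V x)) * v x)) \<in> L2 lebesgue"
      by (intro L2_lincomb form_dom_L2(2)[OF u] form_dom_L2(2)[OF v])
    then show "(\<lambda>x. complex_of_real (sqrt (V x)) * (c * u x + d * v x)) \<in> L2 lebesgue"
      by (simp add: algebra_simps)
  qed
qed

context
  fixes V :: "real^'n::finite \<Rightarrow> real"
  assumes V: "locally_integrable V" and Vpos: "AE x in lebesgue. 0 \<le> V x"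
begin

lemma potential_term_integrable:
  assumes u: "u \<in> form_dom V" and v: "v \<in> form_dom V"
  shows "integrable lebesgue (\<lambda>x. complex_of_real (V x) * u x * cnj (v x))"
proof -
  have m: "V \<in> borel_measurable lebesgue" "u \<in> borel_measurable lebesgue" "v \<in> borel_measurable lebesgue"
    using locally_integrable_measurable[OF V] form_dom_L2(1)[OF u] form_dom_L2(1)[OF v] by (auto simp: L2_def)
  have "AE x in lebesgue. complex_of_real (sqrt (V x)) * u x * cnj (complex_of_real (sqrt (V x)) * v x)
      = complex_of_real (V x) * u x * cnj (v x)"
    using Vpos
  proof eventually_elim
    fix x assume "0 \<le> V x"
    then have "complex_of_real (V x) = complex_of_real (sqrt (V x)) * complex_of_real (sqrt (V x))"
      by (simp flip: of_real_mult)
    then show "complex_of_real (sqrt (V x)) * u x * cnj (complex_of_real (sqrt (V x)) * v x)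
      = complex_of_real (V x) * u x * cnj (v x)" by simp
  qed
  then show ?thesis
    by (rule integrable_cong_AE_imp[OF L2_mult_integrable(2)[OF form_dom_L2(2)[OF u] form_dom_L2(2)[OF v]], rotated])
       (use m in measurable)
qed

lemma schrodinger_form_eq:
  assumes u: "u \<in> form_dom V" and v: "v \<in> form_dom V" and G: "gradient_L2 u G" and H: "gradient_L2 v H"
  shows "integrable lebesgue (\<lambda>x. (1/2) * (\<Sum>i\<in>UNIV. G x $ i * cnj (H x $ i)) + complex_of_real (V x) * u x * cnj (v x))"
    and "schrodinger_form V u v =
      (\<integral>x. (1/2) * (\<Sum>i\<in>UNIV. G x $ i * cnj (H x $ i)) + complex_of_real (V x) * u x * cnj (v x) \<partial>lebesgue)"
proof -
  have i: "integrable lebesgue (\<lambda>x. G x $ i * cnj (H x $ i))" for i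
    using G H unfolding gradient_L2_def by (intro L2_mult_integrable) auto
  show int: "integrable lebesgue (\<lambda>x. (1/2) * (\<Sum>i\<in>UNIV. G x $ i * cnj (H x $ i)) + complex_of_real (V x) * u x * cnj (v x))"
    by (intro Bochner_Integration.integrable_add integrable_mult_right Bochner_Integration.integrable_sum i potential_term_integrable u v)
  have wu: "has_weak_gradient u (weak_gradient u)" and wv: "has_weak_gradient v (weak_gradient v)"
    unfolding weak_gradient_def using G H unfolding gradient_L2_def by (metis someI_ex)+
  have m: "(\<lambda>x. weak_gradient u x $ i) \<in> borel_measurable lebesgue" "(\<lambda>x. weak_gradient v x $ i) \<in> borel_measurable lebesgue" for i
    using wu wv unfolding has_weak_gradient_def
    by (auto intro!: locally_integrable_measurable locally_integrable_nth)
  have au: "AE x in lebesgue. weak_gradient u x = G x"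
    using has_weak_gradient_unique[OF wu] G unfolding gradient_L2_def by blast
  have av: "AE x in lebesgue. weak_gradient v x = H x"
    using has_weak_gradient_unique[OF wv] H unfolding gradient_L2_def by blast
  show "schrodinger_form V u v =
      (\<integral>x. (1/2) * (\<Sum>i\<in>UNIV. G x $ i * cnj (H x $ i)) + complex_of_real (V x) * u x * cnj (v x) \<partial>lebesgue)"
    unfolding schrodinger_form_def
  proof (rule integral_cong_AE)
    show "(\<lambda>x. 1 / 2 * (\<Sum>i\<in>UNIV. G x $ i * cnj (H x $ i)) + complex_of_real (V x) * u x * cnj (v x)) \<in> borel_measurable lebesgue"
      using int by (rule borel_measurable_integrable)
    have "(\<lambda>x. complex_of_real (V x) * u x * cnj (v x)) \<in> borel_measurable lebesgue"
      using potential_term_integrable[OF u v] by (rule borel_measurable_integrable)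
    then show "(\<lambda>x. 1 / 2 * (\<Sum>i\<in>UNIV. weak_gradient u x $ i * cnj (weak_gradient v x $ i)) + complex_of_real (V x) * u x * cnj (v x)) \<in> borel_measurable lebesgue"
      using m by (intro borel_measurable_add borel_measurable_times[OF borel_measurable_const]
          borel_measurable_sum borel_measurable_times[OF m(1) borel_measurable_cnj[OF m(2)]])
    show "AE x in lebesgue. 1 / 2 * (\<Sum>i\<in>UNIV. weak_gradient u x $ i * cnj (weak_gradient v x $ i)) + complex_of_real (V x) * u x * cnj (v x)
        = 1 / 2 * (\<Sum>i\<in>UNIV. G x $ i * cnj (H x $ i)) + complex_of_real (V x) * u x * cnj (v x)"
      using au av by eventually_elim simp
  qed
qed

lemma schrodinger_op_lincomb:
  assumes A: "schrodinger_op V u w" and B: "schrodinger_op V u' w'"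
  shows "schrodinger_op V (\<lambda>x. c * u x + d * u' x) (\<lambda>x. c * w x + d * w' x)"
  unfolding schrodinger_op_def
proof (intro conjI ballI)
  have u: "u \<in> form_dom V" "u' \<in> form_dom V" and w: "w \<in> L2 lebesgue" "w' \<in> L2 lebesgue"
    using A B unfolding schrodinger_op_def by auto
  show dom: "(\<lambda>x. c * u x + d * u' x) \<in> form_dom V" by (rule form_dom_lincomb[OF u])
  show "(\<lambda>x. c * w x + d * w' x) \<in> L2 lebesgue" by (rule L2_lincomb[OF w])
  fix v assume v: "v \<in> form_dom V"
  obtain G G' H where G: "gradient_L2 u G" and G': "gradient_L2 u' G'" and H: "gradient_L2 v H"
    using form_dom_gradient[OF u(1)] form_dom_gradient[OF u(2)] form_dom_gradient[OF v] by metis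
  note i1 = schrodinger_form_eq[OF u(1) v G H] and i2 = schrodinger_form_eq[OF u(2) v G' H]
  have "schrodinger_form V (\<lambda>x. c * u x + d * u' x) v =
     (\<integral>x. c * ((1/2) * (\<Sum>i\<in>UNIV. G x $ i * cnj (H x $ i)) + complex_of_real (V x) * u x * cnj (v x)) +
           d * ((1/2) * (\<Sum>i\<in>UNIV. G' x $ i * cnj (H x $ i)) + complex_of_real (V x) * u' x * cnj (v x)) \<partial>lebesgue)"
    unfolding schrodinger_form_eq(2)[OF dom v gradient_L2_lincomb[OF G G'] H]
    by (simp add: algebra_simps sum.distrib sum_distrib_left)
  also have "\<dots> = c * schrodinger_form V u v + d * schrodinger_form V u' v"
    using i1 i2 by simp
  also have "\<dots> = c * inner_L2 lebesgue w v + d * inner_L2 lebesgue w' v"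
    using A B v unfolding schrodinger_op_def by simp
  also have "\<dots> = (\<integral>x. c * (w x * cnj (v x)) + d * (w' x * cnj (v x)) \<partial>lebesgue)"
    using L2_mult_integrable(2)[OF w(1) form_dom_L2(1)[OF v]] L2_mult_integrable(2)[OF w(2) form_dom_L2(1)[OF v]]
    by (simp add: inner_L2_def)
  also have "\<dots> = inner_L2 lebesgue (\<lambda>x. c * w x + d * w' x) v"
    by (simp add: inner_L2_def algebra_simps)
  finally show "schrodinger_form V (\<lambda>x. c * u x + d * u' x) v = inner_L2 lebesgue (\<lambda>x. c * w x + d * w' x) v" .
qed

lemma schrodinger_form_nonneg:
  assumes u: "u \<in> form_dom V"
  shows "0 \<le> Re (schrodinger_form V u u)"
proof -
  obtain G where G: "gradient_L2 u G" using form_dom_gradient[OF u] .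
  have "0 \<le> (\<integral>x. Re ((1/2) * (\<Sum>i\<in>UNIV. G x $ i * cnj (G x $ i)) + complex_of_real (V x) * u x * cnj (u x)) \<partial>lebesgue)"
  proof (rule integral_nonneg_AE)
    show "AE x in lebesgue. 0 \<le> Re ((1/2) * (\<Sum>i\<in>UNIV. G x $ i * cnj (G x $ i)) + complex_of_real (V x) * u x * cnj (u x))"
      using Vpos
    proof eventually_elim
      fix x assume "0 \<le> V x"
      have r: "Re (z * cnj z) \<ge> 0" for z by (simp add: complex_norm_square[symmetric])
      have "Re ((1/2) * (\<Sum>i\<in>UNIV. G x $ i * cnj (G x $ i))) \<ge> 0"
        using sum_nonneg[of UNIV "\<lambda>i. Re (G x $ i * cnj (G x $ i))"] r by simp
      moreover have "Re (complex_of_real (V x) * u x * cnj (u x)) = V x * Re (u x * cnj (u x))"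
        by (simp add: algebra_simps)
      then have "Re (complex_of_real (V x) * u x * cnj (u x)) \<ge> 0"
        using r[of "u x"] \<open>0 \<le> V x\<close> by simp
      ultimately show "0 \<le> Re ((1/2) * (\<Sum>i\<in>UNIV. G x $ i * cnj (G x $ i)) + complex_of_real (V x) * u x * cnj (u x))"
        by simp
    qed
  qed
  then show ?thesis
    using integral_Re[OF schrodinger_form_eq(1)[OF u u G G]] schrodinger_form_eq(2)[OF u u G G] by simp
qed

text \<open>The test function is the negative part \<open>v\<close> of \<open>Re h\<close>, with gradient \<open>(sgn (Re h) - 1) / 2\<close>
  times that of \<open>Re h\<close>. On \<open>{Re h = 0}\<close> this factor is \<open>- 1 / 2\<close> instead of \<open>0\<close>, but only its sign
  matters: the gradient part of the form of \<open>h\<close> and \<open>v\<close> has real part at most \<open>0\<close>, and so has the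
  potential part, because \<open>(Re h) v = - v\<^sup>2\<close>.\<close>
proposition resolvent_positive:
  assumes op: "schrodinger_op V h k" and s: "s > 0"
    and nonneg: "AE x in lebesgue. 0 \<le> Re (h x + complex_of_real s * k x)"
  shows "AE x in lebesgue. 0 \<le> Re (h x)"
proof -
  have h: "h \<in> form_dom V" and k: "k \<in> L2 lebesgue"
    and eq: "\<And>v. v \<in> form_dom V \<Longrightarrow> schrodinger_form V h v = inner_L2 lebesgue k v"
    using op unfolding schrodinger_op_def by auto
  obtain G where G: "gradient_L2 h G" using form_dom_gradient[OF h] .
  define w where "w x = Re (h x)" for x
  define g where "g i x = Re (G x $ i)" for i x
  define v where "v x = (\<bar>w x\<bar> - w x) / 2" for x
  define H where "H i x = (sgn (w x) * g i x - g i x) / 2" for i x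
  have wL: "w \<in> L2_real lebesgue" using form_dom_L2(1)[OF h] unfolding w_def[abs_def] L2_iff by simp
  have gL: "g i \<in> L2_real lebesgue" for i using G unfolding g_def[abs_def] gradient_L2_def L2_iff by simp
  have wg: "weak_partial i w (g i)" for i
    using has_weak_gradient_Re_Im(1) G unfolding gradient_L2_def w_def[abs_def] g_def[abs_def] by blast
  note wm [measurable] = L2_real_measurable[OF wL]
  note gm [measurable] = L2_real_measurable[OF gL]
  have hw: "has_weak_gradient (\<lambda>x. complex_of_real (w x)) (\<lambda>x. \<chi> i. complex_of_real (g i x))"
    by (rule has_weak_gradient_of_real[OF wg])
  have ha: "has_weak_gradient (\<lambda>x. complex_of_real \<bar>w x\<bar>) (\<lambda>x. \<chi> i. complex_of_real (sgn (w x) * g i x))"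
    by (rule has_weak_gradient_of_real[OF weak_partial_abs[OF wL gL wg]])
  have HL: "H i \<in> L2_real lebesgue" for i
    by (rule L2_real_bound[OF gL[of i]]) (auto simp: H_def[abs_def] sgn_real_def)
  have "(\<lambda>x. (1/2) * complex_of_real \<bar>w x\<bar> + (- 1/2) * complex_of_real (w x)) = (\<lambda>x. complex_of_real (v x))"
    by (auto simp: v_def field_simps)
  moreover have "(\<lambda>x. \<chi> i. (1/2) * (\<chi> i. complex_of_real (sgn (w x) * g i x)) $ i + (- 1/2) * (\<chi> i. complex_of_real (g i x)) $ i)
      = (\<lambda>x. \<chi> i. complex_of_real (H i x))"
    by (auto simp: H_def field_simps vec_eq_iff)
  ultimately have "has_weak_gradient (\<lambda>x. complex_of_real (v x)) (\<lambda>x. \<chi> i. complex_of_real (H i x))"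
    using has_weak_gradient_lincomb[OF ha hw, of "1/2" "- 1/2"] by simp
  then have vH: "gradient_L2 (\<lambda>x. complex_of_real (v x)) (\<lambda>x. \<chi> i. complex_of_real (H i x))"
    using HL by (simp add: gradient_L2_def L2_of_real_iff)
  have vw: "\<bar>v x\<bar> \<le> \<bar>w x\<bar>" for x by (simp add: v_def)
  have vm [measurable]: "v \<in> borel_measurable lebesgue" unfolding v_def[abs_def] by measurable
  have vL: "v \<in> L2_real lebesgue" by (rule L2_real_bound[OF wL vm]) (use vw in auto)
  have vdom: "(\<lambda>x. complex_of_real (v x)) \<in> form_dom V"
  proof (rule form_domI[OF _ vH])
    show "(\<lambda>x. complex_of_real (v x)) \<in> L2 lebesgue" using vL by (simp add: L2_of_real_iff)
    show "(\<lambda>x. complex_of_real (sqrt (V x)) * complex_of_real (v x)) \<in> L2 lebesgue"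
    proof (rule L2_bound[OF form_dom_L2(2)[OF h], of _ 1])
      show "(\<lambda>x. complex_of_real (sqrt (V x)) * complex_of_real (v x)) \<in> borel_measurable lebesgue"
        using locally_integrable_measurable[OF V] by measurable
      have "\<bar>v x\<bar> \<le> cmod (h x)" for x
        using vw[of x] abs_Re_le_cmod[of "h x"] by (simp add: w_def)
      then show "AE x in lebesgue. cmod (complex_of_real (sqrt (V x)) * complex_of_real (v x)) \<le> 1 * cmod (complex_of_real (sqrt (V x)) * h x)"
        by (auto simp: norm_mult intro!: mult_left_mono)
    qed
  qed
  have v0: "0 \<le> v x" for x by (simp add: v_def)
  have wv: "w x * v x = - (v x)\<^sup>2" for x by (auto simp: v_def power2_eq_square abs_if field_simps)
  have kL: "(\<lambda>x. Re (k x)) \<in> L2_real lebesgue" using k by (simp add: L2_iff)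
  have "Re (schrodinger_form V h (\<lambda>x. complex_of_real (v x))) \<le> 0"
  proof -
    note F = schrodinger_form_eq[OF h vdom G vH]
    have "0 \<le> (\<integral>x. - Re ((1/2) * (\<Sum>i\<in>UNIV. G x $ i * cnj ((\<chi> i. complex_of_real (H i x)) $ i)) +
        complex_of_real (V x) * h x * cnj (complex_of_real (v x))) \<partial>lebesgue)"
    proof (rule integral_nonneg_AE)
      show "AE x in lebesgue. 0 \<le> - Re ((1/2) * (\<Sum>i\<in>UNIV. G x $ i * cnj ((\<chi> i. complex_of_real (H i x)) $ i)) +
          complex_of_real (V x) * h x * cnj (complex_of_real (v x)))"
        using Vpos
      proof eventually_elim
        fix x assume "0 \<le> V x"
        have "g i x * H i x \<le> 0" for i
        proof -
          have "g i x * H i x = (sgn (w x) - 1) / 2 * (g i x)\<^sup>2"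
            by (simp add: H_def power2_eq_square field_simps)
          moreover have "(sgn (w x) - 1) / 2 \<le> 0" by (simp add: sgn_real_def)
          ultimately show ?thesis using mult_nonpos_nonneg[OF _ zero_le_power2] by metis
        qed
        then have "(\<Sum>i\<in>UNIV. g i x * H i x) \<le> 0" by (intro sum_nonpos) auto
        moreover have "V x * (w x * v x) \<le> 0" using \<open>0 \<le> V x\<close> by (simp add: wv)
        ultimately show "0 \<le> - Re ((1/2) * (\<Sum>i\<in>UNIV. G x $ i * cnj ((\<chi> i. complex_of_real (H i x)) $ i)) +
          complex_of_real (V x) * h x * cnj (complex_of_real (v x)))"
          by (simp add: g_def w_def mult.assoc)
      qed
    qed
    also have "\<dots> = - Re (schrodinger_form V h (\<lambda>x. complex_of_real (v x)))"
      unfolding F(2) integral_Re[OF F(1), symmetric] by (rule Bochner_Integration.integral_minus)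
    finally show ?thesis by simp
  qed
  then have kv: "(\<integral>x. Re (k x) * v x \<partial>lebesgue) \<le> 0"
    using eq[OF vdom] integral_Re[OF L2_mult_integrable(2)[OF k form_dom_L2(1)[OF vdom]]]
    by (simp add: inner_L2_def)
  have iv: "integrable lebesgue (\<lambda>x. (v x)\<^sup>2)" using vL by (simp add: L2_real_def)
  have ik: "integrable lebesgue (\<lambda>x. Re (k x) * v x)" by (rule L2_real_mult_integrable[OF kL vL])
  have "0 \<le> (\<integral>x. s * (Re (k x) * v x) - (v x)\<^sup>2 \<partial>lebesgue)"
  proof (rule integral_nonneg_AE)
    show "AE x in lebesgue. 0 \<le> s * (Re (k x) * v x) - (v x)\<^sup>2"
      using nonneg
    proof eventually_elim
      fix x assume "0 \<le> Re (h x + complex_of_real s * k x)"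
      then have "0 \<le> (w x + s * Re (k x)) * v x" using v0[of x] by (simp add: w_def)
      then show "0 \<le> s * (Re (k x) * v x) - (v x)\<^sup>2" using wv[of x] by (simp add: algebra_simps)
    qed
  qed
  also have "\<dots> = s * (\<integral>x. Re (k x) * v x \<partial>lebesgue) - (\<integral>x. (v x)\<^sup>2 \<partial>lebesgue)"
    using ik iv by simp
  finally have "(\<integral>x. (v x)\<^sup>2 \<partial>lebesgue) \<le> 0"
    using kv s by (smt (verit) mult_nonneg_nonpos)
  moreover have "0 \<le> (\<integral>x. (v x)\<^sup>2 \<partial>lebesgue)" by simp
  ultimately have "(\<integral>x. (v x)\<^sup>2 \<partial>lebesgue) = 0" by linarith
  then have "AE x in lebesgue. (v x)\<^sup>2 = 0"
    using integral_nonneg_eq_0_iff_AE[OF iv] by simp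
  then show ?thesis
    by eventually_elim (simp add: v_def w_def abs_if split: if_splits)
qed

end

section \<open>Positivity of the semigroup\<close>

lemma unitary_lincomb:
  assumes U: "unitary_L2 M N U" and f: "f \<in> L2 M" and g: "g \<in> L2 M"
  shows "AE y in N. U (\<lambda>x. c * f x + d * g x) y = c * U f y + d * U g y"
proof -
  have cf: "(\<lambda>x. c * f x) \<in> L2 M" and dg: "(\<lambda>x. d * g x) \<in> L2 M"
    using L2_lincomb[OF f f, of c 0] L2_lincomb[OF g g, of d 0] by simp_all
  have add: "AE y in N. U (\<lambda>x. p x + q x) y = U p y + U q y" if "p \<in> L2 M" "q \<in> L2 M" for p q
    using U that unfolding unitary_L2_def by blast
  have scale: "AE y in N. U (\<lambda>x. r * p x) y = r * U p y" if "p \<in> L2 M" for p r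
    using U that unfolding unitary_L2_def by blast
  show ?thesis
    using add[OF cf dg] scale[OF f, of c] scale[OF g, of d] by eventually_elim simp
qed

lemma L2_diff: "f \<in> L2 M \<Longrightarrow> g \<in> L2 M \<Longrightarrow> (\<lambda>x. f x - g x) \<in> L2 M"
  using L2_lincomb[of f M g 1 "-1"] by simp

lemma unitary_L2_in: "unitary_L2 M N U \<Longrightarrow> f \<in> L2 M \<Longrightarrow> U f \<in> L2 N"
  unfolding unitary_L2_def by blast

lemma unitary_distance:
  assumes U: "unitary_L2 M N U" and f: "f \<in> L2 M" and g: "g \<in> L2 M"
  shows "(\<integral>y. (cmod (U f y - U g y))\<^sup>2 \<partial>N) = (\<integral>x. (cmod (f x - g x))\<^sup>2 \<partial>M)"
proof -
  have d: "(\<lambda>x. f x - g x) \<in> L2 M" by (rule L2_diff[OF f g])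
  have ae: "AE y in N. U (\<lambda>x. f x - g x) y = U f y - U g y"
    using unitary_lincomb[OF U f g, of 1 "-1"] by simp
  have m: "U (\<lambda>x. f x - g x) \<in> borel_measurable N" "U f \<in> borel_measurable N" "U g \<in> borel_measurable N"
    using unitary_L2_in[OF U] f g d by (auto simp: L2_def)
  have "inner_L2 N (U (\<lambda>x. f x - g x)) (U (\<lambda>x. f x - g x)) = inner_L2 M (\<lambda>x. f x - g x) (\<lambda>x. f x - g x)"
    using U d unfolding unitary_L2_def by blast
  then have "(\<integral>y. (cmod (U (\<lambda>x. f x - g x) y))\<^sup>2 \<partial>N) = (\<integral>x. (cmod (f x - g x))\<^sup>2 \<partial>M)"
    unfolding inner_L2_self of_real_eq_iff .
  moreover have "(\<integral>y. (cmod (U (\<lambda>x. f x - g x) y))\<^sup>2 \<partial>N) = (\<integral>y. (cmod (U f y - U g y))\<^sup>2 \<partial>N)"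
    by (rule integral_cong_AE) (use m ae in \<open>auto elim: eventually_mono\<close>)
  ultimately show ?thesis by simp
qed

lemma L2_distance_zero_iff:
  assumes "f \<in> L2 M" "g \<in> L2 M"
  shows "(\<integral>x. (cmod (f x - g x))\<^sup>2 \<partial>M) = 0 \<longleftrightarrow> (AE x in M. f x = g x)"
proof -
  have "integrable M (\<lambda>x. (cmod (f x - g x))\<^sup>2)"
    using L2_diff[OF assms] by (simp add: L2_def)
  then show ?thesis by (subst integral_nonneg_eq_0_iff_AE) auto
qed

lemma unitary_AE_eq_iff:
  assumes U: "unitary_L2 M N U" and f: "f \<in> L2 M" and g: "g \<in> L2 M"
  shows "(AE y in N. U f y = U g y) \<longleftrightarrow> (AE x in M. f x = g x)"
  using unitary_distance[OF assms] L2_distance_zero_iff[OF f g]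
    L2_distance_zero_iff[OF unitary_L2_in[OF U f] unitary_L2_in[OF U g]] by simp

lemma unitary_surj:
  assumes "unitary_L2 M N U" "h \<in> L2 N"
  obtains f where "f \<in> L2 M" "AE y in N. U f y = h y"
  using assms unfolding unitary_L2_def by blast

lemma L2_times_bounded:
  assumes "F \<in> L2 M" "m \<in> borel_measurable M" "AE z in M. \<bar>m z\<bar> \<le> C"
  shows "(\<lambda>z. complex_of_real (m z) * F z) \<in> L2 M"
proof (rule L2_bound[OF assms(1), of _ C])
  show "(\<lambda>z. complex_of_real (m z) * F z) \<in> borel_measurable M"
    using assms(2) L2_measurable[OF assms(1)] by simp
  show "AE z in M. cmod (complex_of_real (m z) * F z) \<le> C * cmod (F z)"
    using assms(3) by eventually_elim (simp add: norm_mult mult_right_mono)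
qed

lemma snd_measurable:
  assumes "sets \<mu> = sets (borel :: (nat \<times> real) measure)"
  shows "(\<lambda>z. snd z) \<in> borel_measurable \<mu>"
proof -
  have "(\<lambda>z::nat \<times> real. snd z) \<in> borel_measurable borel"
    by (intro borel_measurable_continuous_onI continuous_intros)
  then show ?thesis by (simp add: measurable_cong_sets[OF assms refl])
qed

context
  fixes V :: "real^'n::finite \<Rightarrow> real"
  assumes V: "locally_integrable V" and Vpos: "AE x in lebesgue. 0 \<le> V x"
begin

text \<open>If the spectral measure charged \<open>{\<lambda> < 0}\<close>, a function in the domain of the operator whose
  transform lives there would have a negative form.\<close>
lemma spectrum_nonneg:
  assumes rep: "spectral_representation lebesgue (schrodinger_op V) \<mu> U"
  shows "AE z in \<mu>. 0 \<le> snd z"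
proof -
  have sets: "sets \<mu> = sets borel" and sf: "sigma_finite_measure \<mu>" and U: "unitary_L2 lebesgue \<mu> U"
    and A: "\<And>f g. f \<in> L2 lebesgue \<Longrightarrow> g \<in> L2 lebesgue \<Longrightarrow>
      schrodinger_op V f g \<longleftrightarrow> (AE z in \<mu>. U g z = complex_of_real (snd z) * U f z)"
    using rep unfolding spectral_representation_def by auto
  note sm [measurable] = snd_measurable[OF sets]
  obtain h :: "nat \<times> real \<Rightarrow> real" where h: "h \<in> borel_measurable \<mu>" "\<And>z. h z > 0" "integrable \<mu> h"
    using sigma_finite_measure.obtain_positive_integrable_function[OF sf] by metis
  note h(1) [measurable]
  \<comment> \<open>The denominator makes \<open>\<lambda> \<psi>\<close> square integrable, which puts \<open>\<psi>\<close> in the domain.\<close>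
  define \<psi> where "\<psi> z = (if snd z < 0 then sqrt (h z) / (1 + \<bar>snd z\<bar>) else 0)" for z
  have \<psi>m [measurable]: "\<psi> \<in> borel_measurable \<mu>" unfolding \<psi>_def[abs_def] by measurable
  have rL: "(\<lambda>z. sqrt (h z)) \<in> L2_real \<mu>"
    using h(2,3) by (simp add: L2_real_def less_imp_le)
  have b1: "\<bar>\<psi> z\<bar> \<le> \<bar>sqrt (h z)\<bar>" for z
    using h(2)[of z] by (auto simp: \<psi>_def divide_le_eq mult_le_cancel_left1)
  have b2: "\<bar>snd z * \<psi> z\<bar> \<le> \<bar>sqrt (h z)\<bar>" for z
  proof (cases "snd z < 0")
    case True
    have "\<bar>snd z\<bar> / (1 + \<bar>snd z\<bar>) \<le> 1" by simp
    from mult_left_mono[OF this, of "\<bar>sqrt (h z)\<bar>"]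
    show ?thesis using True by (simp add: \<psi>_def abs_mult mult.commute)
  qed (simp add: \<psi>_def)
  have \<psi>L: "(\<lambda>z. complex_of_real (\<psi> z)) \<in> L2 \<mu>" "(\<lambda>z. complex_of_real (snd z * \<psi> z)) \<in> L2 \<mu>"
    unfolding L2_of_real_iff using b1 b2 by (auto intro!: L2_real_bound[OF rL])
  obtain f where f: "f \<in> L2 lebesgue" "AE z in \<mu>. U f z = complex_of_real (\<psi> z)"
    using unitary_surj[OF U \<psi>L(1)] .
  obtain g where g: "g \<in> L2 lebesgue" "AE z in \<mu>. U g z = complex_of_real (snd z * \<psi> z)"
    using unitary_surj[OF U \<psi>L(2)] .
  have "AE z in \<mu>. U g z = complex_of_real (snd z) * U f z"
    using f(2) g(2) by eventually_elim simp
  then have op: "schrodinger_op V f g" using A f(1) g(1) by blast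
  then have dom: "f \<in> form_dom V" and eq: "schrodinger_form V f f = inner_L2 lebesgue g f"
    unfolding schrodinger_op_def by auto
  have "inner_L2 lebesgue g f = inner_L2 \<mu> (U g) (U f)"
    using U f(1) g(1) unfolding unitary_L2_def by simp
  also have "\<dots> = (\<integral>z. complex_of_real (snd z * (\<psi> z)\<^sup>2) \<partial>\<mu>)"
    unfolding inner_L2_def
  proof (rule integral_cong_AE)
    show "(\<lambda>z. U g z * cnj (U f z)) \<in> borel_measurable \<mu>"
      using L2_measurable[OF unitary_L2_in[OF U f(1)]] L2_measurable[OF unitary_L2_in[OF U g(1)]] by measurable
    show "AE z in \<mu>. U g z * cnj (U f z) = complex_of_real (snd z * (\<psi> z)\<^sup>2)"
      using f(2) g(2) by eventually_elim (simp add: power2_eq_square)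
  qed measurable
  also have "\<dots> = complex_of_real (\<integral>z. snd z * (\<psi> z)\<^sup>2 \<partial>\<mu>)" by (rule integral_complex_of_real)
  finally have "0 \<le> (\<integral>z. snd z * (\<psi> z)\<^sup>2 \<partial>\<mu>)"
    using schrodinger_form_nonneg[OF V Vpos dom] eq by simp
  moreover have nn: "0 \<le> - (snd z * (\<psi> z)\<^sup>2)" for z
    by (cases "snd z < 0") (auto simp: \<psi>_def mult_nonpos_nonneg)
  moreover have "0 \<le> (\<integral>z. - (snd z * (\<psi> z)\<^sup>2) \<partial>\<mu>)" using nn by (intro Bochner_Integration.integral_nonneg)
  ultimately have i0: "(\<integral>z. - (snd z * (\<psi> z)\<^sup>2) \<partial>\<mu>) = 0" by simp
  have "integrable \<mu> (\<lambda>z. snd z * \<psi> z * \<psi> z)"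
    using \<psi>L unfolding L2_of_real_iff by (intro L2_real_mult_integrable)
  then have "integrable \<mu> (\<lambda>z. - (snd z * (\<psi> z)\<^sup>2))" by (simp add: power2_eq_square mult.assoc)
  from iffD1[OF integral_nonneg_eq_0_iff_AE[OF this AE_I2[OF nn]] i0]
  have "AE z in \<mu>. - (snd z * (\<psi> z)\<^sup>2) = 0" .
  then show ?thesis
  proof eventually_elim
    fix z assume "- (snd z * (\<psi> z)\<^sup>2) = 0"
    then show "0 \<le> snd z" using h(2)[of z] by (cases "snd z < 0") (auto simp: \<psi>_def)
  qed
qed

text \<open>In the spectral representation the resolvent is multiplication by the bounded function
  \<open>1 / (1 + s \<lambda>)\<close>; the pair \<open>(h, k)\<close> with \<open>k = L h\<close> then solves the resolvent equation in the
  original space because the representation is injective.\<close>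
lemma resolvent_exists:
  assumes rep: "spectral_representation lebesgue (schrodinger_op V) \<mu> U" and s: "s > 0" and f: "f \<in> L2 lebesgue"
  obtains h k where "h \<in> L2 lebesgue" "schrodinger_op V h k" "AE x in lebesgue. f x = h x + complex_of_real s * k x"
    "AE z in \<mu>. U h z = complex_of_real (1 / (1 + s * snd z)) * U f z"
proof -
  have sets: "sets \<mu> = sets borel" and U: "unitary_L2 lebesgue \<mu> U"
    and A: "\<And>f g. f \<in> L2 lebesgue \<Longrightarrow> g \<in> L2 lebesgue \<Longrightarrow>
      schrodinger_op V f g \<longleftrightarrow> (AE z in \<mu>. U g z = complex_of_real (snd z) * U f z)"
    using rep unfolding spectral_representation_def by auto
  note sm [measurable] = snd_measurable[OF sets]
  note pos = spectrum_nonneg[OF rep]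
  note Uf = unitary_L2_in[OF U f]
  have "(\<lambda>z. complex_of_real (1 / (1 + s * snd z)) * U f z) \<in> L2 \<mu>"
  proof (rule L2_times_bounded[OF Uf, of _ 1])
    show "AE z in \<mu>. \<bar>1 / (1 + s * snd z)\<bar> \<le> 1"
      using pos by eventually_elim (use s in \<open>simp add: divide_le_eq\<close>)
  qed measurable
  then obtain h where h: "h \<in> L2 lebesgue" "AE z in \<mu>. U h z = complex_of_real (1 / (1 + s * snd z)) * U f z"
    using unitary_surj[OF U] by blast
  have "(\<lambda>z. complex_of_real (snd z / (1 + s * snd z)) * U f z) \<in> L2 \<mu>"
  proof (rule L2_times_bounded[OF Uf, of _ "1 / s"])
    show "AE z in \<mu>. \<bar>snd z / (1 + s * snd z)\<bar> \<le> 1 / s"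
      using pos
    proof eventually_elim
      fix z :: "nat \<times> real" assume "0 \<le> snd z"
      then have "0 < 1 + s * snd z" using s by (simp add: add_pos_nonneg)
      then show "\<bar>snd z / (1 + s * snd z)\<bar> \<le> 1 / s"
        using s \<open>0 \<le> snd z\<close> by (simp add: field_simps)
    qed
  qed measurable
  then obtain k where k: "k \<in> L2 lebesgue" "AE z in \<mu>. U k z = complex_of_real (snd z / (1 + s * snd z)) * U f z"
    using unitary_surj[OF U] by blast
  have op: "schrodinger_op V h k"
    unfolding A[OF h(1) k(1)] using h(2) k(2) by eventually_elim simp
  have "AE z in \<mu>. U f z = U (\<lambda>x. 1 * h x + complex_of_real s * k x) z"
    using unitary_lincomb[OF U h(1) k(1), of 1 "complex_of_real s"] h(2) k(2) pos
  proof eventually_elim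
    fix z assume *: "U (\<lambda>x. 1 * h x + complex_of_real s * k x) z = 1 * U h z + complex_of_real s * U k z"
      "U h z = complex_of_real (1 / (1 + s * snd z)) * U f z" "U k z = complex_of_real (snd z / (1 + s * snd z)) * U f z"
      "0 \<le> snd z"
    have p: "0 < 1 + s * snd z" using s *(4) by (simp add: add_pos_nonneg)
    have "1 * U h z + complex_of_real s * U k z = complex_of_real (1 / (1 + s * snd z) + s * (snd z / (1 + s * snd z))) * U f z"
      unfolding *(2,3) by (simp add: algebra_simps)
    also have "1 / (1 + s * snd z) + s * (snd z / (1 + s * snd z)) = 1"
      using p by (simp add: divide_simps)
    finally show "U f z = U (\<lambda>x. 1 * h x + complex_of_real s * k x) z" using *(1) by simp
  qed
  then have "AE x in lebesgue. f x = 1 * h x + complex_of_real s * k x"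
    using unitary_AE_eq_iff[OF U f L2_lincomb[OF h(1) k(1)]] by blast
  then have "AE x in lebesgue. f x = h x + complex_of_real s * k x" by simp
  with h op show ?thesis using that by blast
qed

text \<open>\<open>h\<close> is the \<open>m\<close>-th power of \<open>(1 + s L)\<close> inverse, applied to \<open>f\<close>. Writing \<open>1 + s L\<close> through the graph
  of \<open>L\<close> keeps the relation independent of a spectral representation.\<close>
primrec resolvent_power :: "real \<Rightarrow> nat \<Rightarrow> (real^'n \<Rightarrow> complex) \<Rightarrow> (real^'n \<Rightarrow> complex) \<Rightarrow> bool" where
  "resolvent_power s 0 f h \<longleftrightarrow> (AE x in lebesgue. f x = h x)"
| "resolvent_power s (Suc m) f h \<longleftrightarrow> (\<exists>h' k. resolvent_power s m f h' \<and> schrodinger_op V h k \<and>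
     (AE x in lebesgue. h' x = h x + complex_of_real s * k x))"

lemma resolvent_power_lincomb:
  assumes "resolvent_power s m f h" "resolvent_power s m f' h'"
  shows "resolvent_power s m (\<lambda>x. c * f x + d * f' x) (\<lambda>x. c * h x + d * h' x)"
  using assms
proof (induction m arbitrary: h h')
  case 0
  then show ?case by (auto elim: eventually_elim2)
next
  case (Suc m)
  then obtain g k g' k' where *: "resolvent_power s m f g" "schrodinger_op V h k"
    "AE x in lebesgue. g x = h x + complex_of_real s * k x"
    "resolvent_power s m f' g'" "schrodinger_op V h' k'"
    "AE x in lebesgue. g' x = h' x + complex_of_real s * k' x" by auto
  have "AE x in lebesgue. c * g x + d * g' x = c * h x + d * h' x + complex_of_real s * (c * k x + d * k' x)"
    using *(3,6) by eventually_elim (simp add: algebra_simps)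
  then show ?case
    using Suc.IH[OF *(1,4)] schrodinger_op_lincomb[OF V Vpos *(2,5), of c d] by auto
qed

lemma resolvent_power_positive:
  assumes "resolvent_power s m f h" "s > 0" "AE x in lebesgue. 0 \<le> Re (f x)"
  shows "AE x in lebesgue. 0 \<le> Re (h x)"
  using assms(1)
proof (induction m arbitrary: h)
  case 0
  then have "AE x in lebesgue. f x = h x" by simp
  then show ?case using assms(3) by eventually_elim simp
next
  case (Suc m)
  then obtain g k where *: "resolvent_power s m f g" "schrodinger_op V h k"
    "AE x in lebesgue. g x = h x + complex_of_real s * k x" by auto
  have "AE x in lebesgue. 0 \<le> Re (h x + complex_of_real s * k x)"
    using Suc.IH[OF *(1)] *(3) by eventually_elim simp
  then show ?case by (rule resolvent_positive[OF V Vpos *(2) assms(2)])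
qed

lemma resolvent_power_exists:
  assumes rep: "spectral_representation lebesgue (schrodinger_op V) \<mu> U" and s: "s > 0" and f: "f \<in> L2 lebesgue"
  shows "\<exists>h \<in> L2 lebesgue. resolvent_power s m f h \<and>
    (AE z in \<mu>. U h z = complex_of_real ((1 / (1 + s * snd z)) ^ m) * U f z)"
proof (induction m)
  case 0
  show ?case using f by (intro bexI[of _ f]) auto
next
  case (Suc m)
  then obtain g where g: "g \<in> L2 lebesgue" "resolvent_power s m f g"
    "AE z in \<mu>. U g z = complex_of_real ((1 / (1 + s * snd z)) ^ m) * U f z" by blast
  obtain h k where h: "h \<in> L2 lebesgue" "schrodinger_op V h k" "AE x in lebesgue. g x = h x + complex_of_real s * k x"
    "AE z in \<mu>. U h z = complex_of_real (1 / (1 + s * snd z)) * U g z"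
    using resolvent_exists[OF rep s g(1)] .
  have "AE z in \<mu>. U h z = complex_of_real ((1 / (1 + s * snd z)) ^ Suc m) * U f z"
    using h(4) g(3) by eventually_elim simp
  then show ?case using h g(2) by auto
qed

text \<open>\<open>g\<close> is the limit of \<open>(1 + t L / n)\<close> to the power \<open>- n\<close>, applied to \<open>f\<close>.\<close>
definition exponential_limit :: "real \<Rightarrow> (real^'n \<Rightarrow> complex) \<Rightarrow> (real^'n \<Rightarrow> complex) \<Rightarrow> bool" where
  "exponential_limit t f g \<longleftrightarrow> g \<in> L2 lebesgue \<and>
     (\<exists>h. (\<forall>n. h n \<in> L2 lebesgue \<and> resolvent_power (t / real (Suc n)) (Suc n) f (h n)) \<and>
       (\<lambda>n. \<integral>x. (cmod (h n x - g x))\<^sup>2 \<partial>lebesgue) \<longlonglongrightarrow> 0)"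

lemma semigroup_exponential_limit:
  assumes sg: "schrodinger_semigroup V t f g" and t: "t > 0"
  shows "exponential_limit t f g"
proof -
  obtain \<mu> U where f: "f \<in> L2 lebesgue" and g: "g \<in> L2 lebesgue"
    and rep: "spectral_representation lebesgue (schrodinger_op V) \<mu> U"
    and Ug: "AE z in \<mu>. U g z = complex_of_real (exp (- t * snd z)) * U f z"
    using sg unfolding schrodinger_semigroup_def spectral_calculus_def by blast
  have sets: "sets \<mu> = sets borel" and U: "unitary_L2 lebesgue \<mu> U"
    using rep unfolding spectral_representation_def by auto
  note sm [measurable] = snd_measurable[OF sets]
  note pos = spectrum_nonneg[OF rep]
  note Uf = unitary_L2_in[OF U f]
  note Ufm [measurable] = L2_measurable[OF Uf]
  define r where "r n z = (1 / (1 + t / real (Suc n) * snd z)) ^ Suc n" for n and z :: "nat \<times> real"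
  have rm [measurable]: "r n \<in> borel_measurable \<mu>" for n unfolding r_def[abs_def] by measurable
  have "\<forall>n. \<exists>h. h \<in> L2 lebesgue \<and> resolvent_power (t / real (Suc n)) (Suc n) f h \<and>
      (AE z in \<mu>. U h z = complex_of_real (r n z) * U f z)"
  proof
    fix n
    have "t / real (Suc n) > 0" using t by simp
    from resolvent_power_exists[OF rep this f, of "Suc n"]
    show "\<exists>h. h \<in> L2 lebesgue \<and> resolvent_power (t / real (Suc n)) (Suc n) f h \<and>
      (AE z in \<mu>. U h z = complex_of_real (r n z) * U f z)"
      unfolding r_def by blast
  qed
  then obtain h where h: "\<And>n. h n \<in> L2 lebesgue" "\<And>n. resolvent_power (t / real (Suc n)) (Suc n) f (h n)"
    "\<And>n. AE z in \<mu>. U (h n) z = complex_of_real (r n z) * U f z" by metis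
  have eq: "(\<integral>x. (cmod (h n x - g x))\<^sup>2 \<partial>lebesgue) = (\<integral>z. (r n z - exp (- t * snd z))\<^sup>2 * (cmod (U f z))\<^sup>2 \<partial>\<mu>)" for n
  proof -
    have "(\<integral>x. (cmod (h n x - g x))\<^sup>2 \<partial>lebesgue) = (\<integral>z. (cmod (U (h n) z - U g z))\<^sup>2 \<partial>\<mu>)"
      by (rule unitary_distance[OF U h(1) g, symmetric])
    also have "\<dots> = (\<integral>z. (r n z - exp (- t * snd z))\<^sup>2 * (cmod (U f z))\<^sup>2 \<partial>\<mu>)"
    proof (rule integral_cong_AE)
      show "(\<lambda>z. (cmod (U (h n) z - U g z))\<^sup>2) \<in> borel_measurable \<mu>"
        using L2_measurable[OF unitary_L2_in[OF U h(1)]] L2_measurable[OF unitary_L2_in[OF U g]] by measurable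
      show "AE z in \<mu>. (cmod (U (h n) z - U g z))\<^sup>2 = (r n z - exp (- t * snd z))\<^sup>2 * (cmod (U f z))\<^sup>2"
        using h(3)[of n] Ug
      proof eventually_elim
        fix z assume *: "U (h n) z = complex_of_real (r n z) * U f z" "U g z = complex_of_real (exp (- t * snd z)) * U f z"
        have "U (h n) z - U g z = complex_of_real (r n z - exp (- t * snd z)) * U f z"
          unfolding * by (simp add: algebra_simps)
        then show "(cmod (U (h n) z - U g z))\<^sup>2 = (r n z - exp (- t * snd z))\<^sup>2 * (cmod (U f z))\<^sup>2"
          by (simp only: norm_mult norm_of_real power_mult_distrib power2_abs)
      qed
    qed measurable
    finally show ?thesis .
  qed
  have "(\<lambda>n. \<integral>z. (r n z - exp (- t * snd z))\<^sup>2 * (cmod (U f z))\<^sup>2 \<partial>\<mu>) \<longlonglongrightarrow> (\<integral>z. 0 \<partial>\<mu>)"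
  proof (rule integral_dominated_convergence)
    show "integrable \<mu> (\<lambda>z. (cmod (U f z))\<^sup>2)" using Uf by (simp add: L2_def)
    show "AE z in \<mu>. (\<lambda>n. (r n z - exp (- t * snd z))\<^sup>2 * (cmod (U f z))\<^sup>2) \<longlonglongrightarrow> 0"
    proof (rule AE_I2)
      fix z :: "nat \<times> real"
      have "(\<lambda>n. (1 + t * snd z / real (Suc n)) ^ Suc n) \<longlonglongrightarrow> exp (t * snd z)"
        by (rule LIMSEQ_Suc[OF tendsto_exp_limit_sequentially])
      then have "(\<lambda>n. inverse ((1 + t * snd z / real (Suc n)) ^ Suc n)) \<longlonglongrightarrow> inverse (exp (t * snd z))"
        by (rule tendsto_inverse) simp
      moreover have "inverse ((1 + t * snd z / real (Suc n)) ^ Suc n) = r n z" for n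
        by (simp only: r_def inverse_eq_divide power_one_over times_divide_eq_left)
      ultimately have "(\<lambda>n. r n z) \<longlonglongrightarrow> exp (- t * snd z)" by (simp only: exp_minus mult_minus_left)
      then have "(\<lambda>n. (r n z - exp (- t * snd z))\<^sup>2 * (cmod (U f z))\<^sup>2) \<longlonglongrightarrow> (exp (- t * snd z) - exp (- t * snd z))\<^sup>2 * (cmod (U f z))\<^sup>2"
        by (intro tendsto_intros)
      then show "(\<lambda>n. (r n z - exp (- t * snd z))\<^sup>2 * (cmod (U f z))\<^sup>2) \<longlonglongrightarrow> 0" by simp
    qed
    show "AE z in \<mu>. norm ((r n z - exp (- t * snd z))\<^sup>2 * (cmod (U f z))\<^sup>2) \<le> (cmod (U f z))\<^sup>2" for n
      using pos
    proof eventually_elim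
      fix z :: "nat \<times> real" assume z: "0 \<le> snd z"
      define q where "q = t / real (Suc n) * snd z"
      have "0 \<le> q" using z t by (simp add: q_def)
      then have q: "0 \<le> 1 / (1 + q)" "1 / (1 + q) \<le> 1" by (auto simp: divide_le_eq)
      have "0 \<le> r n z" "r n z \<le> 1"
        unfolding r_def q_def[symmetric] using zero_le_power[OF q(1)] power_le_one[OF q] by blast+
      moreover have "0 \<le> exp (- t * snd z)" "exp (- t * snd z) \<le> 1" using z t by auto
      ultimately have "\<bar>r n z - exp (- t * snd z)\<bar> \<le> 1" by linarith
      then have "(r n z - exp (- t * snd z))\<^sup>2 \<le> 1" by (simp add: abs_square_le_1)
      then show "norm ((r n z - exp (- t * snd z))\<^sup>2 * (cmod (U f z))\<^sup>2) \<le> (cmod (U f z))\<^sup>2"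
        by (simp add: mult_left_le_one_le)
    qed
  qed measurable
  then have "(\<lambda>n. \<integral>x. (cmod (h n x - g x))\<^sup>2 \<partial>lebesgue) \<longlonglongrightarrow> 0" unfolding eq by simp
  then show ?thesis unfolding exponential_limit_def using g h(1,2) by blast
qed

lemma exponential_limit_lincomb:
  assumes "exponential_limit t f g" "exponential_limit t f' g'"
  shows "exponential_limit t (\<lambda>x. c * f x + d * f' x) (\<lambda>x. c * g x + d * g' x)"
proof -
  obtain h where g: "g \<in> L2 lebesgue" and h: "\<And>n. h n \<in> L2 lebesgue" "\<And>n. resolvent_power (t / real (Suc n)) (Suc n) f (h n)"
    and l: "(\<lambda>n. \<integral>x. (cmod (h n x - g x))\<^sup>2 \<partial>lebesgue) \<longlonglongrightarrow> 0"
    using assms(1) unfolding exponential_limit_def by blast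
  obtain h' where g': "g' \<in> L2 lebesgue" and h': "\<And>n. h' n \<in> L2 lebesgue" "\<And>n. resolvent_power (t / real (Suc n)) (Suc n) f' (h' n)"
    and l': "(\<lambda>n. \<integral>x. (cmod (h' n x - g' x))\<^sup>2 \<partial>lebesgue) \<longlonglongrightarrow> 0"
    using assms(2) unfolding exponential_limit_def by blast
  let ?H = "\<lambda>n x. c * h n x + d * h' n x" and ?G = "\<lambda>x. c * g x + d * g' x"
  have GL: "?G \<in> L2 lebesgue" by (rule L2_lincomb[OF g g'])
  have HL: "?H n \<in> L2 lebesgue" for n by (rule L2_lincomb[OF h(1) h'(1)])
  let ?B = "\<lambda>n. 2 * (cmod c)\<^sup>2 * (\<integral>x. (cmod (h n x - g x))\<^sup>2 \<partial>lebesgue) + 2 * (cmod d)\<^sup>2 * (\<integral>x. (cmod (h' n x - g' x))\<^sup>2 \<partial>lebesgue)"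
  have le: "(\<integral>x. (cmod (?H n x - ?G x))\<^sup>2 \<partial>lebesgue) \<le> ?B n" for n
  proof -
    have i: "integrable lebesgue (\<lambda>x. (cmod (h n x - g x))\<^sup>2)" "integrable lebesgue (\<lambda>x. (cmod (h' n x - g' x))\<^sup>2)"
      "integrable lebesgue (\<lambda>x. (cmod (?H n x - ?G x))\<^sup>2)"
      using L2_diff[OF h(1) g] L2_diff[OF h'(1) g'] L2_diff[OF HL GL] by (simp_all add: L2_def)
    have "(cmod (?H n x - ?G x))\<^sup>2 \<le> 2 * (cmod c)\<^sup>2 * (cmod (h n x - g x))\<^sup>2 + 2 * (cmod d)\<^sup>2 * (cmod (h' n x - g' x))\<^sup>2" for x
    proof -
      let ?a = "cmod c * cmod (h n x - g x)" and ?b = "cmod d * cmod (h' n x - g' x)"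
      have "?H n x - ?G x = c * (h n x - g x) + d * (h' n x - g' x)" by (simp add: algebra_simps)
      then have "cmod (?H n x - ?G x) \<le> ?a + ?b" by (metis norm_triangle_ineq norm_mult)
      then have "(cmod (?H n x - ?G x))\<^sup>2 \<le> (?a + ?b)\<^sup>2" by (intro power_mono) auto
      also have "\<dots> \<le> 2 * ?a\<^sup>2 + 2 * ?b\<^sup>2"
        using sum_squares_bound[of ?a ?b] by (simp add: power2_sum)
      finally show ?thesis by (simp add: power_mult_distrib)
    qed
    then have "(\<integral>x. (cmod (?H n x - ?G x))\<^sup>2 \<partial>lebesgue) \<le>
      (\<integral>x. 2 * (cmod c)\<^sup>2 * (cmod (h n x - g x))\<^sup>2 + 2 * (cmod d)\<^sup>2 * (cmod (h' n x - g' x))\<^sup>2 \<partial>lebesgue)"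
      using i by (intro integral_mono) auto
    also have "\<dots> = ?B n" using i by simp
    finally show ?thesis .
  qed
  have "?B \<longlonglongrightarrow> 2 * (cmod c)\<^sup>2 * 0 + 2 * (cmod d)\<^sup>2 * 0"
    by (intro tendsto_intros l l')
  then have B0: "?B \<longlonglongrightarrow> 0" by simp
  have "(\<lambda>n. \<integral>x. (cmod (?H n x - ?G x))\<^sup>2 \<partial>lebesgue) \<longlonglongrightarrow> 0"
  proof (rule tendsto_sandwich[OF _ _ tendsto_const B0])
    show "\<forall>\<^sub>F n in sequentially. 0 \<le> (\<integral>x. (cmod (?H n x - ?G x))\<^sup>2 \<partial>lebesgue)"
      by (rule always_eventually) simp
    show "\<forall>\<^sub>F n in sequentially. (\<integral>x. (cmod (?H n x - ?G x))\<^sup>2 \<partial>lebesgue) \<le> ?B n"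
      by (rule always_eventually) (use le in blast)
  qed
  then show ?thesis
    unfolding exponential_limit_def
    by (intro conjI GL exI[of _ ?H] allI HL resolvent_power_lincomb[OF h(2) h'(2)])
qed

text \<open>If \<open>h\<close> has non-negative real part, the negative part of \<open>Re g\<close> is at most \<open>|h - g|\<close>.\<close>
lemma exponential_limit_positive:
  assumes lim: "exponential_limit t f g" and t: "t > 0" and f: "AE x in lebesgue. 0 \<le> Re (f x)"
  shows "AE x in lebesgue. 0 \<le> Re (g x)"
proof -
  obtain h where g: "g \<in> L2 lebesgue" and h: "\<And>n. h n \<in> L2 lebesgue" "\<And>n. resolvent_power (t / real (Suc n)) (Suc n) f (h n)"
    and l: "(\<lambda>n. \<integral>x. (cmod (h n x - g x))\<^sup>2 \<partial>lebesgue) \<longlonglongrightarrow> 0"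
    using lim unfolding exponential_limit_def by blast
  define m where "m x = max 0 (- Re (g x))" for x
  have gm [measurable]: "g \<in> borel_measurable lebesgue" by (rule L2_measurable[OF g])
  have mL: "m \<in> L2_real lebesgue"
  proof (rule L2_real_bound)
    show "(\<lambda>x. Re (g x)) \<in> L2_real lebesgue" using g by (simp add: L2_iff)
    show "m \<in> borel_measurable lebesgue" unfolding m_def[abs_def] by measurable
  qed (auto simp: m_def)
  then have im: "integrable lebesgue (\<lambda>x. (m x)\<^sup>2)" by (simp add: L2_real_def)
  have "(\<integral>x. (m x)\<^sup>2 \<partial>lebesgue) \<le> (\<integral>x. (cmod (h n x - g x))\<^sup>2 \<partial>lebesgue)" for n
  proof (rule integral_mono_AE[OF im])
    show "integrable lebesgue (\<lambda>x. (cmod (h n x - g x))\<^sup>2)" using L2_diff[OF h(1) g] by (simp add: L2_def)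
    have "AE x in lebesgue. 0 \<le> Re (h n x)"
      by (rule resolvent_power_positive[OF h(2) _ f]) (use t in simp)
    then show "AE x in lebesgue. (m x)\<^sup>2 \<le> (cmod (h n x - g x))\<^sup>2"
    proof eventually_elim
      fix x assume "0 \<le> Re (h n x)"
      then have "m x \<le> cmod (h n x - g x)"
        using abs_Re_le_cmod[of "h n x - g x"] norm_ge_zero[of "h n x - g x"] by (simp add: m_def)
      then show "(m x)\<^sup>2 \<le> (cmod (h n x - g x))\<^sup>2" by (intro power_mono) (auto simp: m_def)
    qed
  qed
  then have "(\<integral>x. (m x)\<^sup>2 \<partial>lebesgue) \<le> 0" by (intro LIMSEQ_le_const[OF l]) auto
  moreover have "0 \<le> (\<integral>x. (m x)\<^sup>2 \<partial>lebesgue)" by simp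
  ultimately have "(\<integral>x. (m x)\<^sup>2 \<partial>lebesgue) = 0" by linarith
  then have "AE x in lebesgue. (m x)\<^sup>2 = 0" using integral_nonneg_eq_0_iff_AE[OF im] by simp
  then show ?thesis by eventually_elim (simp add: m_def max_def split: if_splits)
qed

proposition semigroup_comparison:
  fixes f f0 f1 g g0 g1 :: "real^'n \<Rightarrow> real"
  assumes t: "t > 0"
    and sg: "schrodinger_semigroup V t (\<lambda>x. complex_of_real (f x)) (\<lambda>x. complex_of_real (g x))"
    and sg0: "schrodinger_semigroup V t (\<lambda>x. complex_of_real (f0 x)) (\<lambda>x. complex_of_real (g0 x))"
    and sg1: "schrodinger_semigroup V t (\<lambda>x. complex_of_real (f1 x)) (\<lambda>x. complex_of_real (g1 x))"
    and le: "\<And>x. f x \<le> c * f0 x + d * f1 x"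
  shows "AE x in lebesgue. g x \<le> c * g0 x + d * g1 x"
proof -
  have "exponential_limit t
     (\<lambda>x. 1 * (complex_of_real c * complex_of_real (f0 x) + complex_of_real d * complex_of_real (f1 x)) + (- 1) * complex_of_real (f x))
     (\<lambda>x. 1 * (complex_of_real c * complex_of_real (g0 x) + complex_of_real d * complex_of_real (g1 x)) + (- 1) * complex_of_real (g x))"
    by (intro exponential_limit_lincomb semigroup_exponential_limit sg sg0 sg1 t)
  from exponential_limit_positive[OF this t] le show ?thesis by simp
qed

proposition semigroup_positive:
  fixes f g :: "real^'n \<Rightarrow> real"
  assumes t: "t > 0"
    and sg: "schrodinger_semigroup V t (\<lambda>x. complex_of_real (f x)) (\<lambda>x. complex_of_real (g x))"
    and f: "\<And>x. 0 \<le> f x"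
  shows "AE x in lebesgue. 0 \<le> g x"
  using exponential_limit_positive[OF semigroup_exponential_limit[OF sg t] t] f by simp

end

section \<open>Hoelder's inequality by optimising Young's inequality\<close>

lemma weighted_Young:
  fixes a b r \<theta> :: real
  assumes "0 < \<theta>" "\<theta> < 1" "0 \<le> a" "0 \<le> b" "0 < r"
  shows "a powr \<theta> * b powr (1 - \<theta>) \<le> \<theta> * r powr (1 - \<theta>) * a + (1 - \<theta>) * r powr (- \<theta>) * b"
proof (cases "a = 0 \<or> b = 0")
  case True
  then show ?thesis using assms by auto
next
  case False
  then have ab: "a > 0" "b > 0" using assms by auto
  have le: "(r powr (1 - \<theta>) * a) powr \<theta> * (r powr (- \<theta>) * b) powr (1 - \<theta>)
      \<le> \<theta> * (r powr (1 - \<theta>) * a) + (1 - \<theta>) * (r powr (- \<theta>) * b)"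
    by (rule Youngs_inequality_0) (use assms ab in auto)
  have eq: "(r powr (1 - \<theta>) * a) powr \<theta> * (r powr (- \<theta>) * b) powr (1 - \<theta>)
      = (r powr ((1 - \<theta>) * \<theta>) * r powr (- \<theta> * (1 - \<theta>))) * (a powr \<theta> * b powr (1 - \<theta>))"
    using assms ab by (simp add: powr_mult powr_powr mult_ac)
  have one: "r powr ((1 - \<theta>) * \<theta>) * r powr (- \<theta> * (1 - \<theta>)) = 1"
    using assms by (simp flip: powr_add add: algebra_simps)
  show ?thesis using le unfolding eq one by (simp add: mult.assoc)
qed

text \<open>The minimum of the right-hand side over \<open>r\<close> is attained at \<open>r = b / a\<close>; if \<open>a\<close> or \<open>b\<close> vanishes,
  the infimum \<open>0\<close> is approached as \<open>r\<close> tends to \<open>\<infinity>\<close> or to \<open>0\<close>.\<close>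
lemma le_powr_mult_if_weighted_bounds:
  fixes x a b \<theta> :: real
  assumes th: "0 < \<theta>" "\<theta> < 1" and a: "0 \<le> a" and b: "0 \<le> b"
    and le: "\<And>r. r > 0 \<Longrightarrow> x \<le> \<theta> * r powr (1 - \<theta>) * a + (1 - \<theta>) * r powr (- \<theta>) * b"
  shows "x \<le> a powr \<theta> * b powr (1 - \<theta>)"
proof -
  have small: "x \<le> 0" if "0 \<le> k" "\<And>c. c > 0 \<Longrightarrow> x \<le> c * k" for k
  proof (rule field_le_epsilon)
    fix e :: real assume "e > 0"
    have "x \<le> e / (k + 1) * k" using that(1) \<open>e > 0\<close> by (intro that(2)) simp
    also have "\<dots> \<le> e" using that(1) \<open>e > 0\<close> by (simp add: divide_le_eq mult_le_cancel_left)
    finally show "x \<le> 0 + e" by simp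
  qed
  consider "a = 0" | "b = 0" | "a > 0" "b > 0" using a b by linarith
  then show ?thesis
  proof cases
    case 1
    have "x \<le> 0"
    proof (rule small[of "(1 - \<theta>) * b"])
      fix c :: real assume c: "c > 0"
      have "(c powr (- 1 / \<theta>)) powr (- \<theta>) = c" using c th by (simp add: powr_powr)
      then show "x \<le> c * ((1 - \<theta>) * b)" using le[of "c powr (- 1 / \<theta>)"] c 1 by (simp add: mult_ac)
    qed (use th b in auto)
    then show ?thesis using 1 by simp
  next
    case 2
    have "x \<le> 0"
    proof (rule small[of "\<theta> * a"])
      fix c :: real assume c: "c > 0"
      have "(c powr (1 / (1 - \<theta>))) powr (1 - \<theta>) = c" using c th by (simp add: powr_powr)
      then show "x \<le> c * (\<theta> * a)" using le[of "c powr (1 / (1 - \<theta>))"] c 2 by (simp add: mult_ac)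
    qed (use th a in auto)
    then show ?thesis using 2 by simp
  next
    case 3
    have e1: "(b / a) powr (1 - \<theta>) * a = a powr \<theta> * b powr (1 - \<theta>)"
    proof -
      have "a = a powr (1 - \<theta>) * a powr \<theta>" using 3 by (simp flip: powr_add)
      then have "(b / a) powr (1 - \<theta>) * a = b powr (1 - \<theta>) / a powr (1 - \<theta>) * (a powr (1 - \<theta>) * a powr \<theta>)"
        using 3 by (simp add: powr_divide)
      then show ?thesis using 3 by simp
    qed
    have e2: "(b / a) powr (- \<theta>) * b = a powr \<theta> * b powr (1 - \<theta>)"
    proof -
      have "b = b powr \<theta> * b powr (1 - \<theta>)" using 3 by (simp flip: powr_add)
      moreover have "(b / a) powr (- \<theta>) = a powr \<theta> / b powr \<theta>"
        using 3 by (simp add: powr_minus powr_divide)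
      ultimately have "(b / a) powr (- \<theta>) * b = a powr \<theta> / b powr \<theta> * (b powr \<theta> * b powr (1 - \<theta>))" by simp
      then show ?thesis using 3 by simp
    qed
    have "x \<le> \<theta> * ((b / a) powr (1 - \<theta>) * a) + (1 - \<theta>) * ((b / a) powr (- \<theta>) * b)"
      using le[of "b / a"] 3 by (simp add: mult.assoc)
    also have "\<dots> = a powr \<theta> * b powr (1 - \<theta>)" unfolding e1 e2 by (simp add: algebra_simps)
    finally show ?thesis .
  qed
qed

text \<open>With rational parameters, inequalities that hold almost everywhere for each parameter hold
  simultaneously almost everywhere.\<close>
lemma weighted_bounds_rational:
  fixes x a b \<theta> :: real
  assumes le: "\<And>q::rat. q > 0 \<Longrightarrow> x \<le> \<theta> * real_of_rat q powr (1 - \<theta>) * a + (1 - \<theta>) * real_of_rat q powr (- \<theta>) * b"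
    and r: "r > 0"
  shows "x \<le> \<theta> * r powr (1 - \<theta>) * a + (1 - \<theta>) * r powr (- \<theta>) * b"
proof (rule ccontr)
  define F where "F r = \<theta> * r powr (1 - \<theta>) * a + (1 - \<theta>) * r powr (- \<theta>) * b" for r
  assume "\<not> x \<le> \<theta> * r powr (1 - \<theta>) * a + (1 - \<theta>) * r powr (- \<theta>) * b"
  then have "F r < x" by (simp add: F_def)
  moreover have "isCont F r" unfolding F_def[abs_def] using r by (intro continuous_intros) auto
  ultimately have "eventually (\<lambda>y. F y < x) (at r)"
    using order_tendstoD(2) unfolding isCont_def by blast
  then obtain d where d: "d > 0" "\<And>y. y \<noteq> r \<Longrightarrow> dist y r < d \<Longrightarrow> F y < x"
    unfolding eventually_at by auto
  obtain q where q: "r < real_of_rat q" "real_of_rat q < r + d" using of_rat_dense[of r "r + d"] d(1) by auto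
  then have "F (real_of_rat q) < x" using d(2)[of "real_of_rat q"] by (simp add: dist_real_def)
  moreover have "q > 0" using q(1) r by (metis less_trans zero_less_of_rat_iff)
  ultimately show False using le[of q] by (simp add: F_def)
qed

lemma ennreal_powr_top: "ennreal_powr top r = top"
  by (simp add: ennreal_powr_def)

lemma ennreal_powr_ennreal: "0 \<le> v \<Longrightarrow> ennreal_powr (ennreal v) r = ennreal (v powr r)"
  by (simp add: ennreal_powr_def)

lemma ennreal_powr_zero: "ennreal_powr 0 r = 0"
  using ennreal_powr_ennreal[of 0 r] by simp

lemma ennreal_powr_one: "ennreal_powr x 1 = x"
  by (cases x rule: ennreal_cases) (simp_all add: ennreal_powr_ennreal ennreal_powr_top)

lemma ennreal_powr_eq_zero: "ennreal_powr x r = 0 \<longleftrightarrow> x = 0"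
  by (cases x rule: ennreal_cases) (auto simp: ennreal_powr_ennreal ennreal_powr_top)

lemma ennreal_powr_mult: "ennreal_powr (x * y) r = ennreal_powr x r * ennreal_powr y r"
proof (cases "x = 0 \<or> y = 0")
  case False
  show ?thesis
  proof (cases "x = top \<or> y = top")
    case True
    then show ?thesis using False
      by (auto simp: ennreal_powr_top ennreal_top_mult ennreal_mult_top ennreal_powr_eq_zero)
  next
    case fin: False
    then obtain v w where "x = ennreal v" "0 \<le> v" "y = ennreal w" "0 \<le> w"
      by (metis ennreal_cases)
    then show ?thesis
      by (simp add: ennreal_powr_ennreal powr_mult flip: ennreal_mult)
  qed
qed (auto simp: ennreal_powr_zero)

lemma ennreal_powr_powr: "ennreal_powr (ennreal_powr x r) s = ennreal_powr x (r * s)"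
  by (cases x rule: ennreal_cases) (simp_all add: ennreal_powr_ennreal ennreal_powr_top powr_powr)

lemma ennreal_powr_add: "ennreal_powr x r * ennreal_powr x s = ennreal_powr x (r + s)"
  by (cases x rule: ennreal_cases)
     (simp_all add: ennreal_powr_ennreal ennreal_powr_top powr_add flip: ennreal_mult)

lemma ennreal_powr_mono: "x \<le> y \<Longrightarrow> 0 \<le> r \<Longrightarrow> ennreal_powr x r \<le> ennreal_powr y r"
  by (cases x rule: ennreal_cases; cases y rule: ennreal_cases)
     (auto simp: ennreal_powr_ennreal ennreal_powr_top powr_mono2 top_unique)

lemma ennreal_powr_measurable [measurable (raw)]:
  assumes [measurable]: "f \<in> borel_measurable M"
  shows "(\<lambda>x. ennreal_powr (f x) r) \<in> borel_measurable M"
  unfolding ennreal_powr_def by measurable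

text \<open>Integrate Young's inequality and optimise its parameter. If one of the two integrals is \<open>0\<close>
  the integrand on the left vanishes almost everywhere, also when the other integral is infinite.\<close>
lemma Hoelder_nn_integral:
  assumes th: "0 < \<theta>" "\<theta> < 1" and [measurable]: "f \<in> borel_measurable M" "g \<in> borel_measurable M"
  shows "(\<integral>\<^sup>+x. ennreal_powr (f x) \<theta> * ennreal_powr (g x) (1 - \<theta>) \<partial>M)
     \<le> ennreal_powr (\<integral>\<^sup>+x. f x \<partial>M) \<theta> * ennreal_powr (\<integral>\<^sup>+x. g x \<partial>M) (1 - \<theta>)"
    (is "?X \<le> ennreal_powr ?A \<theta> * ennreal_powr ?B (1 - \<theta>)")
proof (cases "?A = 0 \<or> ?B = 0")
  case True
  then have "AE x in M. f x = 0 \<or> g x = 0"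
    by (auto simp: nn_integral_0_iff_AE elim: eventually_mono)
  then have "?X = (\<integral>\<^sup>+x. 0 \<partial>M)"
    by (intro nn_integral_cong_AE) (auto simp: ennreal_powr_zero elim!: eventually_mono)
  then show ?thesis by simp
next
  case nz: False
  show ?thesis
  proof (cases "?A = top \<or> ?B = top")
    case True
    then have "ennreal_powr ?A \<theta> * ennreal_powr ?B (1 - \<theta>) = top"
      using nz by (auto simp: ennreal_powr_top ennreal_top_mult ennreal_mult_top ennreal_powr_eq_zero)
    then show ?thesis by simp
  next
    case False
    then obtain A B where A: "?A = ennreal A" "0 \<le> A" and B: "?B = ennreal B" "0 \<le> B"
      by (metis ennreal_cases)
    have bound: "?X \<le> ennreal (\<theta> * r powr (1 - \<theta>) * A + (1 - \<theta>) * r powr (- \<theta>) * B)" if r: "r > 0" for r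
    proof -
      have c: "0 < \<theta> * r powr (1 - \<theta>)" "0 < (1 - \<theta>) * r powr (- \<theta>)" using th r by auto
      have "ennreal_powr y \<theta> * ennreal_powr z (1 - \<theta>) \<le> ennreal (\<theta> * r powr (1 - \<theta>)) * y + ennreal ((1 - \<theta>) * r powr (- \<theta>)) * z" for y z
      proof (cases "y = top \<or> z = top")
        case True
        then show ?thesis using c th r by (auto simp: ennreal_mult_top)
      next
        case False
        then obtain v w where vw: "y = ennreal v" "0 \<le> v" "z = ennreal w" "0 \<le> w" by (metis ennreal_cases)
        have "ennreal_powr y \<theta> * ennreal_powr z (1 - \<theta>) = ennreal (v powr \<theta> * w powr (1 - \<theta>))"
          using vw by (simp add: ennreal_powr_ennreal ennreal_mult)
        also have "\<dots> \<le> ennreal (\<theta> * r powr (1 - \<theta>) * v + (1 - \<theta>) * r powr (- \<theta>) * w)"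
          by (intro ennreal_leI weighted_Young th vw r)
        also have "\<dots> = ennreal (\<theta> * r powr (1 - \<theta>)) * y + ennreal ((1 - \<theta>) * r powr (- \<theta>)) * z"
          using vw c by (simp add: ennreal_plus ennreal_mult less_imp_le)
        finally show ?thesis .
      qed
      then have "?X \<le> (\<integral>\<^sup>+x. ennreal (\<theta> * r powr (1 - \<theta>)) * f x + ennreal ((1 - \<theta>) * r powr (- \<theta>)) * g x \<partial>M)"
        by (intro nn_integral_mono)
      also have "\<dots> = ennreal (\<theta> * r powr (1 - \<theta>)) * ?A + ennreal ((1 - \<theta>) * r powr (- \<theta>)) * ?B"
        by (simp add: nn_integral_add nn_integral_cmult)
      also have "\<dots> = ennreal (\<theta> * r powr (1 - \<theta>) * A + (1 - \<theta>) * r powr (- \<theta>) * B)"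
        unfolding A(1) B(1) using c A(2) B(2) by (simp add: ennreal_plus ennreal_mult less_imp_le)
      finally show ?thesis .
    qed
    from bound[of 1] have "?X \<noteq> top" by (auto simp: top_unique)
    then obtain X where X: "?X = ennreal X" "0 \<le> X" by (metis ennreal_cases)
    have "X \<le> A powr \<theta> * B powr (1 - \<theta>)"
    proof (rule le_powr_mult_if_weighted_bounds[OF th A(2) B(2)])
      fix r :: real assume r: "r > 0"
      have "0 \<le> \<theta> * r powr (1 - \<theta>) * A + (1 - \<theta>) * r powr (- \<theta>) * B" using th A B by simp
      then show "X \<le> \<theta> * r powr (1 - \<theta>) * A + (1 - \<theta>) * r powr (- \<theta>) * B"
        using bound[OF r] unfolding X(1) by (simp add: ennreal_le_iff)
    qed
    then have "ennreal X \<le> ennreal (A powr \<theta> * B powr (1 - \<theta>))" by (rule ennreal_leI)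
    then show ?thesis
      unfolding X(1) A(1) B(1) using A(2) B(2) by (simp add: ennreal_powr_ennreal ennreal_mult)
  qed
qed

section \<open>Interpolation of the Riesz transforms\<close>

text \<open>The function \<open>riesz_repr V a u\<close> below is the transform computed from a jointly measurable
  representative \<open>u\<close> of the semigroup orbit of a function.\<close>
definition time_integral :: "(real \<Rightarrow> 'x \<Rightarrow> real) \<Rightarrow> real \<Rightarrow> 'x \<Rightarrow> ennreal" where
  "time_integral u a x = (\<integral>\<^sup>+t\<in>{0<..}. ennreal (u t x * t powr (a - 1)) \<partial>lborel)"

definition riesz_repr :: "('x \<Rightarrow> real) \<Rightarrow> real \<Rightarrow> (real \<Rightarrow> 'x \<Rightarrow> real) \<Rightarrow> 'x \<Rightarrow> ennreal" where
  "riesz_repr V a u x = ennreal (V x powr a) * (ennreal (1 / Gamma a) * time_integral u a x)"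

definition semigroup_orbit :: "(real^'n::finite \<Rightarrow> real) \<Rightarrow> (real^'n \<Rightarrow> real) \<Rightarrow> (real \<Rightarrow> real^'n \<Rightarrow> real) \<Rightarrow> bool" where
  "semigroup_orbit V f u \<longleftrightarrow> (\<lambda>(t, x). u t x) \<in> borel_measurable borel \<and>
     (\<forall>t>0. schrodinger_semigroup V t (\<lambda>x. complex_of_real (f x)) (\<lambda>x. complex_of_real (u t x)))"

lemma riesz_iff_orbit:
  "riesz V a f h \<longleftrightarrow> (\<exists>u. semigroup_orbit V f u \<and> (AE x in lebesgue. h x = riesz_repr V a u x))"
  unfolding riesz_def semigroup_orbit_def riesz_repr_def time_integral_def by blast

lemma Lp_norm_cong_AE: "AE x in lebesgue. g x = h x \<Longrightarrow> Lp_norm p g = Lp_norm p h"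
  unfolding Lp_norm_def by (subst nn_integral_cong_AE) (auto elim: eventually_mono)

lemma riesz_boundedD:
  assumes "riesz_bounded V a p"
  obtains C where "C > 0" "\<And>f. finitely_simple f \<Longrightarrow> (\<And>x. 0 \<le> f x) \<Longrightarrow>
     \<exists>u. semigroup_orbit V f u \<and> Lp_norm p (riesz_repr V a u) \<le> ennreal C * Lp_norm p (\<lambda>x. ennreal (f x))"
proof -
  obtain C where C: "C > 0" and h: "\<And>f. finitely_simple f \<Longrightarrow> (\<And>x. 0 \<le> f x) \<Longrightarrow>
     \<exists>h. riesz V a f h \<and> Lp_norm p h \<le> ennreal C * Lp_norm p (\<lambda>x. ennreal (f x))"
    using assms unfolding riesz_bounded_def by blast
  show ?thesis
  proof (rule that[OF C])
    fix f :: "real^'a \<Rightarrow> real" assume "finitely_simple f" "\<And>x. 0 \<le> f x"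
    from h[OF this] obtain h u where *: "semigroup_orbit V f u" "AE x in lebesgue. h x = riesz_repr V a u x"
      "Lp_norm p h \<le> ennreal C * Lp_norm p (\<lambda>x. ennreal (f x))" unfolding riesz_iff_orbit by blast
    then show "\<exists>u. semigroup_orbit V f u \<and> Lp_norm p (riesz_repr V a u) \<le> ennreal C * Lp_norm p (\<lambda>x. ennreal (f x))"
      using Lp_norm_cong_AE[OF *(2), of p] by auto
  qed
qed

lemma orbit_measurable:
  assumes "semigroup_orbit V f u"
  shows "(\<lambda>z. u (fst z) (snd z)) \<in> borel_measurable (lborel \<Otimes>\<^sub>M lborel)"
proof -
  have "(\<lambda>z. u (fst z) (snd z)) \<in> borel_measurable borel"
    using assms unfolding semigroup_orbit_def case_prod_beta' by blast
  then show ?thesis unfolding lborel_prod by simp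
qed

lemma time_integral_measurable:
  assumes "semigroup_orbit V f u"
  shows "time_integral u a \<in> borel_measurable lebesgue"
proof -
  note m [measurable] = orbit_measurable[OF assms]
  have "(\<lambda>z. ennreal (u (snd z) (fst z) * snd z powr (a - 1)) * indicator {0<..} (snd z)) \<in> borel_measurable (lborel \<Otimes>\<^sub>M lborel)"
  proof -
    have "(\<lambda>z. u (fst (snd z, fst z)) (snd (snd z, fst z))) \<in> borel_measurable (lborel \<Otimes>\<^sub>M lborel)"
      by (rule measurable_compose[OF _ m, of "\<lambda>z. (snd z, fst z)"]) measurable
    then have [measurable]: "(\<lambda>z. u (snd z) (fst z)) \<in> borel_measurable (lborel \<Otimes>\<^sub>M lborel)" by simp
    show ?thesis by measurable
  qed
  then have "(\<lambda>x. \<integral>\<^sup>+t. ennreal (u t x * t powr (a - 1)) * indicator {0<..} t \<partial>lborel) \<in> borel_measurable lborel"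
    using lborel.borel_measurable_nn_integral[of "\<lambda>x t. ennreal (u t x * t powr (a - 1)) * indicator {0<..} t" lborel]
    by (simp add: case_prod_beta)
  then show ?thesis
    unfolding time_integral_def[abs_def] by (intro measurable_completion)
qed

lemma riesz_repr_measurable:
  assumes "semigroup_orbit V f u" "V \<in> borel_measurable lebesgue"
  shows "riesz_repr V a u \<in> borel_measurable lebesgue"
  unfolding riesz_repr_def[abs_def]
  using time_integral_measurable[OF assms(1)] assms(2) by measurable

lemma finitely_simple_powr:
  assumes "finitely_simple f"
  shows "finitely_simple (\<lambda>x. f x powr q)"
proof -
  obtain K where "simple_function lebesgue f" "compact K" "\<And>x. x \<notin> K \<Longrightarrow> f x = 0"
    using assms unfolding finitely_simple_def by auto
  then show ?thesis
    unfolding finitely_simple_def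
    using simple_function_compose1[of lebesgue f "\<lambda>y. y powr q"] by (intro conjI exI[of _ K]) auto
qed

text \<open>Young's inequality bounds \<open>f\<close> by linear combinations of \<open>f0\<close> and \<open>f1\<close>. The semigroup respects
  these bounds, and minimising over the parameter gives the product of powers.\<close>
proposition semigroup_Hoelder:
  fixes V :: "real^'n::finite \<Rightarrow> real"
  assumes V: "locally_integrable V" "AE x in lebesgue. 0 \<le> V x"
    and th: "0 < \<theta>" "\<theta> < 1"
    and u: "semigroup_orbit V f u" and u0: "semigroup_orbit V f0 u0" and u1: "semigroup_orbit V f1 u1"
    and f0: "\<And>x. 0 \<le> f0 x" and f1: "\<And>x. 0 \<le> f1 x"
    and f: "\<And>x. f x = f0 x powr \<theta> * f1 x powr (1 - \<theta>)" and t: "t > 0"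
  shows "AE x in lebesgue. ennreal (u t x) \<le> ennreal_powr (ennreal (u0 t x)) \<theta> * ennreal_powr (ennreal (u1 t x)) (1 - \<theta>)"
proof -
  have sg: "schrodinger_semigroup V t (\<lambda>x. complex_of_real (f x)) (\<lambda>x. complex_of_real (u t x))"
    "schrodinger_semigroup V t (\<lambda>x. complex_of_real (f0 x)) (\<lambda>x. complex_of_real (u0 t x))"
    "schrodinger_semigroup V t (\<lambda>x. complex_of_real (f1 x)) (\<lambda>x. complex_of_real (u1 t x))"
    using u u0 u1 t unfolding semigroup_orbit_def by auto
  have "AE x in lebesgue. q > 0 \<longrightarrow> u t x \<le> \<theta> * real_of_rat q powr (1 - \<theta>) * u0 t x + (1 - \<theta>) * real_of_rat q powr (- \<theta>) * u1 t x" for q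
  proof (cases "q > 0")
    case True
    then have "f x \<le> \<theta> * real_of_rat q powr (1 - \<theta>) * f0 x + (1 - \<theta>) * real_of_rat q powr (- \<theta>) * f1 x" for x
      unfolding f by (intro weighted_Young th f0 f1) simp
    from semigroup_comparison[OF V t sg this] show ?thesis by simp
  qed simp
  then have "AE x in lebesgue. \<forall>q. q > 0 \<longrightarrow> u t x \<le> \<theta> * real_of_rat q powr (1 - \<theta>) * u0 t x + (1 - \<theta>) * real_of_rat q powr (- \<theta>) * u1 t x"
    by (simp only: AE_all_countable) simp
  with semigroup_positive[OF V t sg(2) f0] semigroup_positive[OF V t sg(3) f1]
  show ?thesis
  proof eventually_elim
    fix x assume pos: "0 \<le> u0 t x" "0 \<le> u1 t x"
      and q: "\<forall>q. q > 0 \<longrightarrow> u t x \<le> \<theta> * real_of_rat q powr (1 - \<theta>) * u0 t x + (1 - \<theta>) * real_of_rat q powr (- \<theta>) * u1 t x"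
    have "u t x \<le> u0 t x powr \<theta> * u1 t x powr (1 - \<theta>)"
      by (rule le_powr_mult_if_weighted_bounds[OF th pos weighted_bounds_rational]) (use q in auto)
    then show "ennreal (u t x) \<le> ennreal_powr (ennreal (u0 t x)) \<theta> * ennreal_powr (ennreal (u1 t x)) (1 - \<theta>)"
      using pos by (simp add: ennreal_powr_ennreal ennreal_leI flip: ennreal_mult)
  qed
qed

text \<open>By Fubini's theorem, for almost every \<open>x\<close> the pointwise bound holds for almost every \<open>t\<close>; then
  Hoelder's inequality applies, since \<open>a - 1\<close> is the convex combination of \<open>a0 - 1\<close> and \<open>a1 - 1\<close>.\<close>
lemma time_integral_Hoelder:
  fixes V :: "real^'n::finite \<Rightarrow> real"
  assumes th: "0 < \<theta>" "\<theta> < 1"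
    and u: "semigroup_orbit V f u" and u0: "semigroup_orbit V f0 u0" and u1: "semigroup_orbit V f1 u1"
    and le: "\<And>t. t > 0 \<Longrightarrow> AE x in lebesgue. ennreal (u t x) \<le> ennreal_powr (ennreal (u0 t x)) \<theta> * ennreal_powr (ennreal (u1 t x)) (1 - \<theta>)"
    and a: "a = \<theta> * a0 + (1 - \<theta>) * a1"
  shows "AE x in lebesgue. time_integral u a x \<le> ennreal_powr (time_integral u0 a0 x) \<theta> * ennreal_powr (time_integral u1 a1 x) (1 - \<theta>)"
proof -
  note [measurable] = orbit_measurable[OF u] orbit_measurable[OF u0] orbit_measurable[OF u1]
  let ?P = "\<lambda>t x. t > 0 \<longrightarrow> ennreal (u t x) \<le> ennreal_powr (ennreal (u0 t x)) \<theta> * ennreal_powr (ennreal (u1 t x)) (1 - \<theta>)"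
  have "AE x in lborel. AE t in lborel. ?P t x"
  proof (subst lborel_pair.AE_commute[symmetric])
    show "{z \<in> space (lborel \<Otimes>\<^sub>M lborel). ?P (fst z) (snd z)} \<in> sets (lborel \<Otimes>\<^sub>M lborel)"
      by measurable
    show "AE t in lborel. AE x in lborel. ?P t x"
      using le by (auto simp: AE_completion_iff intro!: AE_I2)
  qed
  then have "AE x in lebesgue. AE t in lborel. ?P t x" by (rule AE_completion)
  then show ?thesis
  proof eventually_elim
    fix x assume ae: "AE t in lborel. ?P t x"
    have m: "(\<lambda>t. w t x) \<in> borel_measurable lborel" if "semigroup_orbit V f' w" for f' w
      using measurable_compose[OF measurable_Pair2'[of x lborel lborel] orbit_measurable[OF that]]
      by (simp add: comp_def)
    note [measurable] = m[OF u0] m[OF u1]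
    define F0 where "F0 t = ennreal (u0 t x * t powr (a0 - 1)) * indicator {0<..} t" for t
    define F1 where "F1 t = ennreal (u1 t x * t powr (a1 - 1)) * indicator {0<..} t" for t
    have "time_integral u a x \<le> (\<integral>\<^sup>+t. ennreal_powr (F0 t) \<theta> * ennreal_powr (F1 t) (1 - \<theta>) \<partial>lborel)"
      unfolding time_integral_def
    proof (rule nn_integral_mono_AE)
      show "AE t in lborel. ennreal (u t x * t powr (a - 1)) * indicator {0<..} t \<le> ennreal_powr (F0 t) \<theta> * ennreal_powr (F1 t) (1 - \<theta>)"
        using ae
      proof eventually_elim
        fix t :: real assume P: "?P t x"
        show "ennreal (u t x * t powr (a - 1)) * indicator {0<..} t \<le> ennreal_powr (F0 t) \<theta> * ennreal_powr (F1 t) (1 - \<theta>)"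
        proof (cases "t > 0")
          case True
          have "a - 1 = (a0 - 1) * \<theta> + (a1 - 1) * (1 - \<theta>)" by (simp add: a algebra_simps)
          then have tp: "ennreal (t powr (a - 1)) = ennreal_powr (ennreal (t powr (a0 - 1))) \<theta> * ennreal_powr (ennreal (t powr (a1 - 1))) (1 - \<theta>)"
            by (simp add: ennreal_powr_ennreal powr_powr powr_add flip: ennreal_mult)
          have "ennreal (u t x * t powr (a - 1)) = ennreal (u t x) * ennreal (t powr (a - 1))"
            by (simp add: ennreal_mult'')
          also have "\<dots> \<le> (ennreal_powr (ennreal (u0 t x)) \<theta> * ennreal_powr (ennreal (u1 t x)) (1 - \<theta>)) * ennreal (t powr (a - 1))"
            using P True by (intro mult_right_mono) auto
          also have "\<dots> = ennreal_powr (ennreal (u0 t x) * ennreal (t powr (a0 - 1))) \<theta> * ennreal_powr (ennreal (u1 t x) * ennreal (t powr (a1 - 1))) (1 - \<theta>)"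
            unfolding tp ennreal_powr_mult by (simp add: mult_ac)
          finally show ?thesis using True by (simp add: F0_def F1_def ennreal_mult'')
        qed simp
      qed
    qed
    also have "\<dots> \<le> ennreal_powr (\<integral>\<^sup>+t. F0 t \<partial>lborel) \<theta> * ennreal_powr (\<integral>\<^sup>+t. F1 t \<partial>lborel) (1 - \<theta>)"
      by (rule Hoelder_nn_integral[OF th]) (unfold F0_def F1_def, measurable)
    finally show "time_integral u a x \<le> ennreal_powr (time_integral u0 a0 x) \<theta> * ennreal_powr (time_integral u1 a1 x) (1 - \<theta>)"
      by (simp add: time_integral_def F0_def F1_def)
  qed
qed

lemma riesz_repr_Hoelder:
  fixes V :: "'x \<Rightarrow> real"
  assumes V: "0 \<le> V x" and a0: "a0 > 0" and a1: "a1 > 0" and th: "0 < \<theta>" "\<theta> < 1"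
    and a: "a = \<theta> * a0 + (1 - \<theta>) * a1"
    and le: "time_integral u a x \<le> ennreal_powr (time_integral u0 a0 x) \<theta> * ennreal_powr (time_integral u1 a1 x) (1 - \<theta>)"
  shows "riesz_repr V a u x \<le> ennreal (Gamma a0 powr \<theta> * Gamma a1 powr (1 - \<theta>) / Gamma a) *
     (ennreal_powr (riesz_repr V a0 u0 x) \<theta> * ennreal_powr (riesz_repr V a1 u1 x) (1 - \<theta>))"
proof -
  have apos: "a > 0" unfolding a using a0 a1 th by (simp add: add_pos_pos)
  have G: "Gamma a0 > 0" "Gamma a1 > 0" "Gamma a > 0" using a0 a1 apos by (auto intro: Gamma_real_pos)
  let ?J0 = "ennreal_powr (time_integral u0 a0 x) \<theta>" and ?J1 = "ennreal_powr (time_integral u1 a1 x) (1 - \<theta>)"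
  define c where "c = Gamma a0 powr \<theta> * Gamma a1 powr (1 - \<theta>) / Gamma a"
  have Vp: "ennreal (V x powr a) = ennreal_powr (ennreal (V x powr a0)) \<theta> * ennreal_powr (ennreal (V x powr a1)) (1 - \<theta>)"
    by (simp add: a ennreal_powr_ennreal powr_powr powr_add mult.commute flip: ennreal_mult)
  have "c * ((1 / Gamma a0) powr \<theta> * (1 / Gamma a1) powr (1 - \<theta>)) = 1 / Gamma a"
    using G by (simp add: c_def powr_divide)
  then have Gp: "ennreal (1 / Gamma a) = ennreal c * (ennreal_powr (ennreal (1 / Gamma a0)) \<theta> * ennreal_powr (ennreal (1 / Gamma a1)) (1 - \<theta>))"
    using G by (simp add: ennreal_powr_ennreal c_def flip: ennreal_mult)
  have "riesz_repr V a u x \<le> ennreal (V x powr a) * (ennreal (1 / Gamma a) * (?J0 * ?J1))"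
    unfolding riesz_repr_def by (intro mult_left_mono le) auto
  also have "\<dots> = ennreal c * (ennreal_powr (riesz_repr V a0 u0 x) \<theta> * ennreal_powr (riesz_repr V a1 u1 x) (1 - \<theta>))"
    unfolding riesz_repr_def ennreal_powr_mult Vp Gp by (simp only: mult_ac)
  finally show ?thesis by (simp add: c_def)
qed

text \<open>Hoelder's inequality for \<open>h0\<close> and \<open>h1\<close> to the power \<open>p1\<close> with weights \<open>\<theta> p\<close> and \<open>1 - \<theta> p\<close>;
  the relation between the exponents says that \<open>1 - \<theta> p = (1 - \<theta>) p / p1\<close>.\<close>
lemma Lp_norm_interpolation:
  fixes h h0 h1 :: "'a::euclidean_space \<Rightarrow> ennreal"
  assumes m: "h0 \<in> borel_measurable lebesgue" "h1 \<in> borel_measurable lebesgue"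
    and th: "0 < \<theta>" "\<theta> < 1" and p1: "1 \<le> p1" and p: "1 / p = \<theta> + (1 - \<theta>) / p1" and c: "0 \<le> c"
    and le: "AE x in lebesgue. h x \<le> ennreal c * (ennreal_powr (h0 x) \<theta> * ennreal_powr (h1 x) (1 - \<theta>))"
  shows "Lp_norm p h \<le> ennreal c * (ennreal_powr (Lp_norm 1 h0) \<theta> * ennreal_powr (Lp_norm p1 h1) (1 - \<theta>))"
proof -
  note [measurable] = m
  have "1 / p > 0" unfolding p using th p1 by (simp add: add_pos_pos)
  then have ppos: "p > 0" by simp
  have e1: "1 - \<theta> * p = (1 - \<theta>) * p / p1"
    using arg_cong[OF p, of "\<lambda>r. r * p"] ppos by (simp add: field_simps)
  have tp: "0 < \<theta> * p" "\<theta> * p < 1"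
  proof -
    show "0 < \<theta> * p" using th ppos by simp
    have "0 < (1 - \<theta>) * p / p1" using th ppos p1 by simp
    then show "\<theta> * p < 1" using e1 by linarith
  qed
  let ?I0 = "\<integral>\<^sup>+x. h0 x \<partial>lebesgue" and ?I1 = "\<integral>\<^sup>+x. ennreal_powr (h1 x) p1 \<partial>lebesgue"
  have e2: "p1 * (1 - \<theta> * p) = (1 - \<theta>) * p" unfolding e1 using p1 by simp
  have "(\<integral>\<^sup>+x. ennreal_powr (h x) p \<partial>lebesgue) \<le>
     (\<integral>\<^sup>+x. ennreal (c powr p) * (ennreal_powr (h0 x) (\<theta> * p) * ennreal_powr (ennreal_powr (h1 x) p1) (1 - \<theta> * p)) \<partial>lebesgue)"
  proof (rule nn_integral_mono_AE)
    show "AE x in lebesgue. ennreal_powr (h x) p \<le>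
        ennreal (c powr p) * (ennreal_powr (h0 x) (\<theta> * p) * ennreal_powr (ennreal_powr (h1 x) p1) (1 - \<theta> * p))"
      using le
    proof eventually_elim
      fix x assume "h x \<le> ennreal c * (ennreal_powr (h0 x) \<theta> * ennreal_powr (h1 x) (1 - \<theta>))"
      then have "ennreal_powr (h x) p \<le> ennreal_powr (ennreal c * (ennreal_powr (h0 x) \<theta> * ennreal_powr (h1 x) (1 - \<theta>))) p"
        using ppos by (intro ennreal_powr_mono) auto
      then show "ennreal_powr (h x) p \<le>
          ennreal (c powr p) * (ennreal_powr (h0 x) (\<theta> * p) * ennreal_powr (ennreal_powr (h1 x) p1) (1 - \<theta> * p))"
        unfolding ennreal_powr_mult ennreal_powr_powr e2 using c by (simp add: ennreal_powr_ennreal)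
    qed
  qed
  also have "\<dots> = ennreal (c powr p) * (\<integral>\<^sup>+x. ennreal_powr (h0 x) (\<theta> * p) * ennreal_powr (ennreal_powr (h1 x) p1) (1 - \<theta> * p) \<partial>lebesgue)"
    by (rule nn_integral_cmult) measurable
  also have "\<dots> \<le> ennreal (c powr p) * (ennreal_powr ?I0 (\<theta> * p) * ennreal_powr ?I1 (1 - \<theta> * p))"
    by (intro mult_left_mono Hoelder_nn_integral tp) measurable
  finally have "Lp_norm p h \<le> ennreal_powr (ennreal (c powr p) * (ennreal_powr ?I0 (\<theta> * p) * ennreal_powr ?I1 (1 - \<theta> * p))) (1 / p)"
    unfolding Lp_norm_def using ppos by (intro ennreal_powr_mono) auto
  also have "\<dots> = ennreal c * (ennreal_powr ?I0 \<theta> * ennreal_powr ?I1 ((1 - \<theta> * p) / p))"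
    unfolding ennreal_powr_mult ennreal_powr_powr using c ppos by (simp add: ennreal_powr_ennreal powr_powr)
  also have "(1 - \<theta> * p) / p = 1 / p1 * (1 - \<theta>)" unfolding e1 using ppos by simp
  finally show ?thesis
    by (simp only: Lp_norm_def ennreal_powr_one ennreal_powr_powr div_by_1)
qed

theorem theorem2:
  fixes V :: "real^'n::finite \<Rightarrow> real" and a0 a1 p1 a p \<theta> :: real
  assumes "a0 > 0" and "a1 > 0"
    and "locally_integrable V" and "AE x in lebesgue. 0 \<le> V x"
    and "1 \<le> p1" and "riesz_bounded V a1 p1"
    and "riesz_bounded V a0 1"
    and "0 < \<theta>" and "\<theta> < 1"
    and "1 / p = \<theta> + (1 - \<theta>) / p1"
    and "a = \<theta> * a0 + (1 - \<theta>) * a1"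
  shows "riesz_bounded V a p"
proof -
  note V = assms(3,4) and p1 = assms(5) and th = assms(8,9) and p = assms(10) and a = assms(11)
  have "1 / p > 0" unfolding p using th p1 by (simp add: add_pos_pos)
  then have ppos: "p > 0" by simp
  have p1pos: "p1 > 0" using p1 by simp
  have Vm: "V \<in> borel_measurable lebesgue" by (rule locally_integrable_measurable[OF V(1)])
  have apos: "a > 0" unfolding a using assms(1,2) th by (simp add: add_pos_pos)
  obtain C0 where C0: "C0 > 0" "\<And>f. finitely_simple f \<Longrightarrow> (\<And>x. 0 \<le> f x) \<Longrightarrow>
     \<exists>u. semigroup_orbit V f u \<and> Lp_norm 1 (riesz_repr V a0 u) \<le> ennreal C0 * Lp_norm 1 (\<lambda>x. ennreal (f x))"
    using riesz_boundedD[OF assms(7)] by blast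
  obtain C1 where C1: "C1 > 0" "\<And>f. finitely_simple f \<Longrightarrow> (\<And>x. 0 \<le> f x) \<Longrightarrow>
     \<exists>u. semigroup_orbit V f u \<and> Lp_norm p1 (riesz_repr V a1 u) \<le> ennreal C1 * Lp_norm p1 (\<lambda>x. ennreal (f x))"
    using riesz_boundedD[OF assms(6)] by blast
  define c where "c = Gamma a0 powr \<theta> * Gamma a1 powr (1 - \<theta>) / Gamma a"
  have "Gamma a0 > 0" "Gamma a1 > 0" "Gamma a > 0" using assms(1,2) apos by (auto intro: Gamma_real_pos)
  then have c: "c > 0" by (simp add: c_def)
  define C where "C = c * (C0 powr \<theta> * C1 powr (1 - \<theta>))"
  have "C > 0" using c C0(1) C1(1) by (simp add: C_def)
  have "\<exists>h. riesz V a f h \<and> Lp_norm p h \<le> ennreal C * Lp_norm p (\<lambda>x. ennreal (f x))"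
    if fs: "finitely_simple f" and fpos: "\<And>x. 0 \<le> f x" for f
  proof -
    define f0 f1 where "f0 x = f x powr p" and "f1 x = f x powr (p / p1)" for x
    have f0: "finitely_simple f0" "\<And>x. 0 \<le> f0 x" and f1: "finitely_simple f1" "\<And>x. 0 \<le> f1 x"
      using finitely_simple_powr[OF fs] by (simp_all add: f0_def[abs_def] f1_def[abs_def])
    have f_eq: "f x = f0 x powr \<theta> * f1 x powr (1 - \<theta>)" for x
    proof -
      have "p * \<theta> + p / p1 * (1 - \<theta>) = p * (\<theta> + (1 - \<theta>) / p1)" by (simp add: algebra_simps)
      also have "\<dots> = 1" unfolding p[symmetric] using ppos by simp
      finally show ?thesis using fpos[of x] by (simp add: f0_def f1_def powr_powr flip: powr_add)
    qed
    obtain u where u: "semigroup_orbit V f u" using C0(2)[OF fs fpos] by blast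
    obtain u0 where u0: "semigroup_orbit V f0 u0"
      "Lp_norm 1 (riesz_repr V a0 u0) \<le> ennreal C0 * Lp_norm 1 (\<lambda>x. ennreal (f0 x))" using C0(2)[OF f0] by blast
    obtain u1 where u1: "semigroup_orbit V f1 u1"
      "Lp_norm p1 (riesz_repr V a1 u1) \<le> ennreal C1 * Lp_norm p1 (\<lambda>x. ennreal (f1 x))" using C1(2)[OF f1] by blast
    have "AE x in lebesgue. time_integral u a x \<le> ennreal_powr (time_integral u0 a0 x) \<theta> * ennreal_powr (time_integral u1 a1 x) (1 - \<theta>)"
      by (rule time_integral_Hoelder[OF th u u0(1) u1(1) semigroup_Hoelder[OF V th u u0(1) u1(1) f0(2) f1(2) f_eq] a])
    with V(2) have "AE x in lebesgue. riesz_repr V a u x \<le> ennreal c *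
       (ennreal_powr (riesz_repr V a0 u0 x) \<theta> * ennreal_powr (riesz_repr V a1 u1 x) (1 - \<theta>))"
    proof eventually_elim
      fix x assume "0 \<le> V x" "time_integral u a x \<le> ennreal_powr (time_integral u0 a0 x) \<theta> * ennreal_powr (time_integral u1 a1 x) (1 - \<theta>)"
      from riesz_repr_Hoelder[of V x a0 a1 \<theta> a u u0 u1, OF this(1) assms(1,2) th a this(2)]
      show "riesz_repr V a u x \<le> ennreal c *
         (ennreal_powr (riesz_repr V a0 u0 x) \<theta> * ennreal_powr (riesz_repr V a1 u1 x) (1 - \<theta>))" unfolding c_def .
    qed
    from Lp_norm_interpolation[OF riesz_repr_measurable[OF u0(1) Vm] riesz_repr_measurable[OF u1(1) Vm] th p1 p less_imp_le[OF c] this]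
    have "Lp_norm p (riesz_repr V a u) \<le> ennreal c *
       (ennreal_powr (Lp_norm 1 (riesz_repr V a0 u0)) \<theta> * ennreal_powr (Lp_norm p1 (riesz_repr V a1 u1)) (1 - \<theta>))" .
    also have "\<dots> \<le> ennreal c * (ennreal_powr (ennreal C0 * Lp_norm 1 (\<lambda>x. ennreal (f0 x))) \<theta> *
        ennreal_powr (ennreal C1 * Lp_norm p1 (\<lambda>x. ennreal (f1 x))) (1 - \<theta>))"
      using th by (intro mult_left_mono mult_mono ennreal_powr_mono u0(2) u1(2)) auto
    also have "\<dots> = ennreal C * Lp_norm p (\<lambda>x. ennreal (f x))"
    proof -
      define F where "F = (\<integral>\<^sup>+x. ennreal (f x powr p) \<partial>lebesgue)"
      have n: "Lp_norm p (\<lambda>x. ennreal (f x)) = ennreal_powr F (1 / p)"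
        using fpos by (simp add: Lp_norm_def F_def ennreal_powr_ennreal)
      have n0: "Lp_norm 1 (\<lambda>x. ennreal (f0 x)) = F"
        by (simp add: Lp_norm_def F_def ennreal_powr_one f0_def)
      have n1: "Lp_norm p1 (\<lambda>x. ennreal (f1 x)) = ennreal_powr F (1 / p1)"
        using p1pos by (simp add: Lp_norm_def F_def f1_def ennreal_powr_ennreal powr_powr)
      have split: "ennreal_powr F (1 / p) = ennreal_powr F \<theta> * ennreal_powr F (1 / p1 * (1 - \<theta>))"
        unfolding ennreal_powr_add p by simp
      show ?thesis
        unfolding n n0 n1 split ennreal_powr_mult ennreal_powr_powr C_def
        using c C0(1) C1(1) by (simp add: ennreal_powr_ennreal ennreal_mult mult_ac)
    qed
    finally have "Lp_norm p (riesz_repr V a u) \<le> ennreal C * Lp_norm p (\<lambda>x. ennreal (f x))" .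
    moreover have "riesz V a f (riesz_repr V a u)" unfolding riesz_iff_orbit using u by blast
    ultimately show ?thesis by blast
  qed
  then show ?thesis unfolding riesz_bounded_def using \<open>C > 0\<close> by blast
qed

end
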